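(* Let $(\Omega,\mathcal A,(p_\theta\cdot\mu)_{\theta\in\Theta})$ be a statistical model with monotone likelihood ratio for a real statistic $T$, $\Theta$ being an interval of $\mathbb R$ with the usual order. Let $K(T)$ be a global essential statistic and $G_\theta$ its mean distribution function under $P_\theta$. Let $(\{\Theta_1^f,\Theta_0^f\})_{f\in\mathcal F}$ be the set of all one-sided hypotheses and, for every $\omega\in\Omega$ and $f\in\mathcal F$, put $Q_1^\omega(\Theta_1^f)=Q^\omega_{\Theta_1^f}(\{1\})$ and $Q_0^\omega(\Theta_1^f)=Q^\omega_{\Theta_0^f}(\{1\})$, where $Q^\omega_{\Theta_1^f}$ (resp. $Q^\omega_{\Theta_0^f}$) is the most favourable vote under $\Theta_1^f$ (resp. $\Theta_0^f$). The maps $Q_1$ and $Q_0$ from $\Omega\times\{\Theta_1^f\}_{f\in\mathcal F}$ to $[0,1]$ define compatible votes if and only if, for almost every $t\in\mathbb R$, the function $\theta\mapsto G_\theta(K(t))$ satisfies: (1) $G_\theta(K(t))$ is right-continuous at $\theta_f\in\Theta-\{\sup\Theta\}$ if $t\in\mathbb R-D_i^{\{\theta>\theta_f\}}$; (2) $G_\theta(K(t))$ is left-continuous at $\theta_f\in\Theta-\{\inf\Theta\}$ if $t\in\mathbb R-D_s^{\{\theta<\theta_f\}}$; (3) if $\inf\Theta\notin\Theta$, then $\lim_{\theta\to\inf\Theta}G_\theta(K(t))=1$; (4) if $\sup\Theta\notin\Theta$, then $\lim_{\theta\to\sup\Theta}G_\theta(K(t))=0$. Under these conditions the two types of votes $Q_1$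 and $Q_0$ have, for almost every $\omega$, the same extension to a probability on the Borel sets of $\Theta$.
   Context: $P_\theta=p_\theta\cdot\mu$ with fixed densities. "Almost every $\omega$": outside an event that is $P_\theta$-null for all $\theta\in\Theta$; "almost every $t$": outside a set $M\subset\mathbb R$ with $T^{-1}(M)$ negligible in that sense. "Increasing" means nondecreasing. Monotone likelihood ratio: for all $\theta'<\theta''$ there is an increasing $h_{(\theta'',\theta')}:\mathbb R\to[0,+\infty]$ with $p_{\theta''}/p_{\theta'}=h_{(\theta'',\theta')}(T)$ outside $\{p_{\theta'}=p_{\theta''}=0\}$. One-sided hypotheses $\{\Theta_1,\Theta_0\}$: partition of $\Theta$ into two nonempty sets with every element of $\Theta_1$ smaller than every element of $\Theta_0$. For $\Theta'\subseteq\Theta$: $D_i^{\Theta'}$ (resp. $D_s^{\Theta'}$) is the largest lower (resp. upper) half-line of $\mathbb R$, open or closed, possibly empty, such that $p_\theta=0$ on $T^{-1}(D_i^{\Theta'})$ (resp. $T^{-1}(D_s^{\Theta'})$) for all $\theta\in\Theta'$. $\{\theta>\theta_f\}$ denotes $\{\theta\in\Theta:\theta>\theta_f\}$, etc. Essential statistic of $\{\Theta_1,\Theta_0\}$. Write $D_i=D_i^{\Theta_0}$, $D_s=D_s^{\Theta_1}$. A normalized family consists of increasing functions $h_{(\theta_0,\theta_1)}:\mathbb R\to[0,+\infty]$, $(\theta_0,\theta_1)\in\Theta_0\times\Theta_1$, with $p_{\theta_0}/p_{\theta_1}=h_{(\theta_0,\theta_1)}(T)$ where the ratio is defined, each being constant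 on every interval $I\subseteq\mathbb R-(D_i\cup D_s)$ with $p_{\theta_0}=p_{\theta_1}=0$ on $T^{-1}(I)$, equal to $+\infty$ on $D_s$ and to $0$ on $D_i-D_s$ (such families exist). For $(k,\beta)\in\{(0,1)\}\cup(]0,\infty[\times\{0,1\})\cup\{(\infty,0)\}$ let $\phi^{(\theta_0,\theta_1)}_{(k,\beta)}=\mathbf 1_{\{h_{(\theta_0,\theta_1)}(T)<k\}}+\beta\mathbf 1_{\{h_{(\theta_0,\theta_1)}(T)=k\}}$, and let $\Delta_s$ be the set of all these for $(\theta_0,\theta_1)\in\Theta_0\times\Theta_1$. Let $f_{(t,u)}=\mathbf 1_{\{T<t\}}+u\mathbf 1_{\{T=t\}}$, $F=\{f_{(t,u)}:(t,u)\in\{(-\infty,1)\}\cup(\mathbb R\times\{0,1\})\cup\{(+\infty,0)\}\}$ totally ordered lexicographically in $(t,u)$ (i.e. pointwise) with the order topology; $\overline{\Delta_s}$ is the closure of $\Delta_s$ in $F$. Add formally $f_{(-\infty,0)}$ below and $f_{(+\infty,1)}$ above $F$; put $f_{(a_t,u_t)}=\sup(\{f\in\overline{\Delta_s}:f\le f_{(t,0)}\}\cup\{f_{(-\infty,0)}\})$, $f_{(b_t,v_t)}=\inf(\{f\in\overline{\Delta_s}:f\ge f_{(t,1)}\}\cup\{f_{(+\infty,1)}\})$. Then $K^{\Theta_1}(t)=-\infty$ if $(a_t,u_t)=(-\infty,0)$; $b_t-1$ if $(a_t,u_t)=(-\infty,1)$; $(a_t+b_t)/2$ if $-\infty<a_t\le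 b_t<+\infty$; $a_t+1$ if $(b_t,v_t)=(+\infty,0)$ and $a_t>-\infty$; $+\infty$ if $(b_t,v_t)=(+\infty,1)$. $K^{\Theta_1}(T)$ is the essential statistic. The mean distribution function of a statistic $S$ under $P_\theta$ is $k\mapsto\frac12[P_\theta(S<k)+P_\theta(S\le k)]$; that of $K^{\Theta_1}(T)$ is denoted $G_\theta^{\Theta_1}$. Votes for $\{\Theta_1,\Theta_0\}$: $Q_\theta^\omega$ is the probability on $\{0,1\}$ with $Q^\omega_\theta(\{1\})=1$ if $T(\omega)\in D_i-D_s$, $1-G^{\Theta_1}_\theta(K^{\Theta_1}(T(\omega)))$ if $T(\omega)\notin D_i\cup D_s$, $0$ if $T(\omega)\in D_s$. Most favourable votes: probabilities $Q^\omega_{\Theta_0}$, $Q^\omega_{\Theta_1}$ on $\{0,1\}$ with $Q^\omega_{\Theta_0}(\{0\})=\sup_{\theta\in\Theta_0}Q^\omega_\theta(\{0\})$, $Q^\omega_{\Theta_1}(\{1\})=\sup_{\theta\in\Theta_1}Q^\omega_\theta(\{1\})$. Global essential statistic: with $N=\{t\in\mathbb R:\forall\omega\in T^{-1}(t)\ \forall\theta\in\Theta\ p_\theta(\omega)=0\}$, it is $K(T)$ with $K:\mathbb R\to[-\infty,+\infty]$ increasing whose mean distribution functions $G_\theta$ satisfy for all one-sided hypotheses $\{\Theta_1,\Theta_0\}$: $G_\theta(K(t))=G^{\Theta_1}_\theta(K^{\Theta_1}(t))$ for all $t\in\mathbb R-(D_i^{\Theta_0}\cup D_s^{\Theta_1}\cup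 N)$, $\theta\in\Theta$; $G_{\theta_0}(K(t))=0$ for $t\in D_i^{\Theta_0}-N$, $\theta_0\in\Theta_0$; $G_{\theta_1}(K(t))=1$ for $t\in D_s^{\Theta_1}-N$, $\theta_1\in\Theta_1$. (Such a statistic exists.) Compatible votes: a map $Q:\Omega\times\{\Theta_1^f\}\to[0,1]$, $Q^\omega(\Theta_1^f)$ being the value at $d=1$ of a vote, defines compatible votes if for almost every $\omega$: (a) $\Theta_1^f\subset\Theta_1^{f'}$ implies $Q^\omega(\Theta_1^f)\le Q^\omega(\Theta_1^{f'})$; (b) if $(\Theta_1^{f_n})$ increases to $\Theta$ (resp. decreases to $\emptyset$) then $Q^\omega(\Theta_1^{f_n})\to1$ (resp. $0$); (c) if $(\Theta_1^{f_n})$, $(\Theta_1^{f'_n})$ have the same limit, one increasing, the other decreasing, then $Q^\omega(\Theta_1^{f_n})$ and $Q^\omega(\Theta_1^{f'_n})$ have the same limit. *)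

theory Defs
  imports "HOL-Probability.Probability"
begin

section \<open>Models with monotone likelihood ratio\<close>

definition statistical_model :: "'w measure \<Rightarrow> (real \<Rightarrow> 'w \<Rightarrow> real) \<Rightarrow> real set \<Rightarrow> bool" where
  "statistical_model M p \<Theta> \<longleftrightarrow> \<Theta> \<noteq> {} \<and>
     (\<forall>\<theta>\<in>\<Theta>. p \<theta> \<in> borel_measurable M \<and> (\<forall>\<omega>\<in>space M. 0 \<le> p \<theta> \<omega>) \<and>
        prob_space (density M (\<lambda>\<omega>. ennreal (p \<theta> \<omega>))))"

definition model_prob :: "'w measure \<Rightarrow> (real \<Rightarrow> 'w \<Rightarrow> real) \<Rightarrow> real \<Rightarrow> 'w measure" where
  "model_prob M p \<theta> = density M (\<lambda>\<omega>. ennreal (p \<theta> \<omega>))"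

definition null_event :: "'w measure \<Rightarrow> (real \<Rightarrow> 'w \<Rightarrow> real) \<Rightarrow> real set \<Rightarrow> 'w set \<Rightarrow> bool" where
  "null_event M p \<Theta> E \<longleftrightarrow> E \<in> sets M \<and> (\<forall>\<theta>\<in>\<Theta>. emeasure (model_prob M p \<theta>) E = 0)"

definition almost_every_outcome ::
  "'w measure \<Rightarrow> (real \<Rightarrow> 'w \<Rightarrow> real) \<Rightarrow> real set \<Rightarrow> ('w \<Rightarrow> bool) \<Rightarrow> bool" where
  "almost_every_outcome M p \<Theta> A \<longleftrightarrow>
     (\<exists>E. null_event M p \<Theta> E \<and> (\<forall>\<omega>\<in>space M - E. A \<omega>))"

definition almost_every_value ::
  "'w measure \<Rightarrow> (real \<Rightarrow> 'w \<Rightarrow> real) \<Rightarrow> ('w \<Rightarrow> real) \<Rightarrow> real set \<Rightarrow> (real \<Rightarrow> bool) \<Rightarrow> bool" where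
  "almost_every_value M p T \<Theta> A \<longleftrightarrow>
     (\<exists>S E. null_event M p \<Theta> E \<and> T -` S \<inter> space M \<subseteq> E \<and> (\<forall>t. t \<notin> S \<longrightarrow> A t))"

text \<open>Division in \<^typ>\<open>ennreal\<close> gives \<open>a / 0 = \<infinity>\<close> for \<open>a \<noteq> 0\<close>, so it is the
  \<open>[0, +\<infinity>]\<close>-valued ratio of densities wherever these are not both zero.\<close>

definition ratio_is ::
  "'w measure \<Rightarrow> (real \<Rightarrow> 'w \<Rightarrow> real) \<Rightarrow> ('w \<Rightarrow> real) \<Rightarrow> real \<Rightarrow> real \<Rightarrow> (real \<Rightarrow> ennreal) \<Rightarrow> bool" where
  "ratio_is M p T \<theta>'' \<theta>' h \<longleftrightarrow>
     (\<forall>\<omega>\<in>space M. \<not> (p \<theta>' \<omega> = 0 \<and> p \<theta>'' \<omega> = 0) \<longrightarrow>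
        ennreal (p \<theta>'' \<omega>) / ennreal (p \<theta>' \<omega>) = h (T \<omega>))"

definition monotone_likelihood_ratio ::
  "'w measure \<Rightarrow> (real \<Rightarrow> 'w \<Rightarrow> real) \<Rightarrow> ('w \<Rightarrow> real) \<Rightarrow> real set \<Rightarrow> bool" where
  "monotone_likelihood_ratio M p T \<Theta> \<longleftrightarrow>
     (\<forall>\<theta>'\<in>\<Theta>. \<forall>\<theta>''\<in>\<Theta>. \<theta>' < \<theta>'' \<longrightarrow> (\<exists>h. mono h \<and> ratio_is M p T \<theta>'' \<theta>' h))"

definition one_sided :: "real set \<Rightarrow> real set \<Rightarrow> real set \<Rightarrow> bool" where
  "one_sided \<Theta> \<Theta>1 \<Theta>0 \<longleftrightarrow> \<Theta>1 \<noteq> {} \<and> \<Theta>0 \<noteq> {} \<and> \<Theta>1 \<union> \<Theta>0 = \<Theta> \<and> \<Theta>1 \<inter> \<Theta>0 = {} \<and>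
     (\<forall>\<theta>1\<in>\<Theta>1. \<forall>\<theta>0\<in>\<Theta>0. \<theta>1 < \<theta>0)"

section \<open>Null half-lines\<close>

definition lower_half_line :: "real set \<Rightarrow> bool" where
  "lower_half_line D \<longleftrightarrow> D = {} \<or> (\<exists>a. D = {..<a} \<or> D = {..a})"

definition upper_half_line :: "real set \<Rightarrow> bool" where
  "upper_half_line D \<longleftrightarrow> D = {} \<or> (\<exists>a. D = {a<..} \<or> D = {a..})"

definition vanish_on ::
  "'w measure \<Rightarrow> (real \<Rightarrow> 'w \<Rightarrow> real) \<Rightarrow> ('w \<Rightarrow> real) \<Rightarrow> real set \<Rightarrow> real set \<Rightarrow> bool" where
  "vanish_on M p T \<Theta>' D \<longleftrightarrow> (\<forall>\<theta>\<in>\<Theta>'. \<forall>\<omega>\<in>T -` D \<inter> space M. p \<theta> \<omega> = 0)"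

definition lower_null ::
  "'w measure \<Rightarrow> (real \<Rightarrow> 'w \<Rightarrow> real) \<Rightarrow> ('w \<Rightarrow> real) \<Rightarrow> real set \<Rightarrow> real set" where
  "lower_null M p T \<Theta>' = (GREATEST D. lower_half_line D \<and> vanish_on M p T \<Theta>' D)"

definition upper_null ::
  "'w measure \<Rightarrow> (real \<Rightarrow> 'w \<Rightarrow> real) \<Rightarrow> ('w \<Rightarrow> real) \<Rightarrow> real set \<Rightarrow> real set" where
  "upper_null M p T \<Theta>' = (GREATEST D. upper_half_line D \<and> vanish_on M p T \<Theta>' D)"

text \<open>These largest half-lines exist as soon as \<open>\<Theta>'\<close> is a nonempty set of parameters.\<close>

lemma down_closed_half_line:
  assumes "\<And>x y. x \<in> D \<Longrightarrow> y \<le> x \<Longrightarrow> y \<in> D" "D \<noteq> UNIV"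
  shows "lower_half_line D"
proof (cases "D = {}")
  case False
  obtain b where b: "b \<notin> D" using assms(2) by blast
  have bdd: "bdd_above D" using assms(1) b by (meson bdd_aboveI linear)
  have lt: "{..<Sup D} \<subseteq> D"
  proof
    fix x assume "x \<in> {..<Sup D}"
    then obtain z where "z \<in> D" "x < z" using less_cSupD[OF False, of x] by auto
    then show "x \<in> D" using assms(1)[of z x] by simp
  qed
  have le: "D \<subseteq> {..Sup D}" using bdd by (auto intro: cSup_upper)
  show ?thesis
  proof (cases "Sup D \<in> D")
    case True
    then have "D = {..Sup D}" using le assms(1)[OF True] by auto
    then show ?thesis unfolding lower_half_line_def by blast
  next
    case False
    have "D \<subseteq> {..<Sup D}"
    proof
      fix x assume "x \<in> D"
      then have "x \<le> Sup D" "x \<noteq> Sup D" using le False by blast+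
      then show "x \<in> {..<Sup D}" by simp
    qed
    then have "D = {..<Sup D}" using lt by (rule subset_antisym)
    then show ?thesis unfolding lower_half_line_def by blast
  qed
qed (simp add: lower_half_line_def)

lemma up_closed_half_line:
  assumes "\<And>x y. x \<in> D \<Longrightarrow> x \<le> y \<Longrightarrow> y \<in> D" "D \<noteq> UNIV"
  shows "upper_half_line D"
proof (cases "D = {}")
  case False
  obtain b where b: "b \<notin> D" using assms(2) by blast
  have bdd: "bdd_below D" using assms(1) b by (meson bdd_belowI linear)
  have gt: "{Inf D<..} \<subseteq> D"
  proof
    fix x assume "x \<in> {Inf D<..}"
    then obtain z where "z \<in> D" "z < x" using cInf_lessD[OF False, of x] by auto
    then show "x \<in> D" using assms(1)[of z x] by simp
  qed
  have ge: "D \<subseteq> {Inf D..}" using bdd by (auto intro: cInf_lower)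
  show ?thesis
  proof (cases "Inf D \<in> D")
    case True
    then have "D = {Inf D..}" using ge assms(1)[OF True] by auto
    then show ?thesis unfolding upper_half_line_def by blast
  next
    case False
    have "D \<subseteq> {Inf D<..}"
    proof
      fix x assume "x \<in> D"
      then have "Inf D \<le> x" "x \<noteq> Inf D" using ge False by blast+
      then show "x \<in> {Inf D<..}" by simp
    qed
    then have "D = {Inf D<..}" using gt by (rule subset_antisym)
    then show ?thesis unfolding upper_half_line_def by blast
  qed
qed (simp add: upper_half_line_def)

lemma not_vanish_on_UNIV:
  assumes "statistical_model M p \<Theta>" "\<Theta>' \<subseteq> \<Theta>" "\<Theta>' \<noteq> {}"
  shows "\<not> vanish_on M p T \<Theta>' UNIV"
proof
  assume *: "vanish_on M p T \<Theta>' UNIV"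
  obtain \<theta> where \<theta>: "\<theta> \<in> \<Theta>'" using assms(3) by blast
  then have "p \<theta> \<in> borel_measurable M"
    and pr: "prob_space (density M (\<lambda>\<omega>. ennreal (p \<theta> \<omega>)))"
    using assms unfolding statistical_model_def by auto
  then have "emeasure (density M (\<lambda>\<omega>. ennreal (p \<theta> \<omega>))) (space M)
      = (\<integral>\<^sup>+ \<omega>. ennreal (p \<theta> \<omega>) * indicator (space M) \<omega> \<partial>M)"
    by (intro emeasure_density) auto
  also have "\<dots> = (\<integral>\<^sup>+ \<omega>. 0 \<partial>M)"
    using * \<theta> by (intro nn_integral_cong) (auto simp: vanish_on_def)
  finally show False using prob_space.emeasure_space_1[OF pr] by simp
qed

lemma lower_null_greatest:
  assumes "statistical_model M p \<Theta>" "\<Theta>' \<subseteq> \<Theta>" "\<Theta>' \<noteq> {}"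
  shows "lower_half_line (lower_null M p T \<Theta>')" "vanish_on M p T \<Theta>' (lower_null M p T \<Theta>')"
    and "\<And>D. lower_half_line D \<Longrightarrow> vanish_on M p T \<Theta>' D \<Longrightarrow> D \<subseteq> lower_null M p T \<Theta>'"
proof -
  let ?P = "\<lambda>D. lower_half_line D \<and> vanish_on M p T \<Theta>' D"
  let ?U = "\<Union>{D. ?P D}"
  have v: "vanish_on M p T \<Theta>' ?U" unfolding vanish_on_def by blast
  then have "?U \<noteq> UNIV" using not_vanish_on_UNIV[OF assms] by metis
  moreover have "y \<in> ?U" if xy: "x \<in> ?U" "y \<le> x" for x y
  proof -
    obtain D where D: "?P D" "x \<in> D" using xy(1) by blast
    then have "y \<in> D" using xy(2) unfolding lower_half_line_def by auto
    then show ?thesis using D(1) by blast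
  qed
  ultimately have PU: "?P ?U" using v down_closed_half_line[of ?U] by blast
  have eq: "lower_null M p T \<Theta>' = ?U"
    unfolding lower_null_def by (rule Greatest_equality[where P = ?P]) (rule PU, blast)
  show "lower_half_line (lower_null M p T \<Theta>')"
    "vanish_on M p T \<Theta>' (lower_null M p T \<Theta>')"
    using PU unfolding eq by simp_all
  show "D \<subseteq> lower_null M p T \<Theta>'" if "lower_half_line D" "vanish_on M p T \<Theta>' D" for D
    unfolding eq using that by blast
qed

lemma upper_null_greatest:
  assumes "statistical_model M p \<Theta>" "\<Theta>' \<subseteq> \<Theta>" "\<Theta>' \<noteq> {}"
  shows "upper_half_line (upper_null M p T \<Theta>')" "vanish_on M p T \<Theta>' (upper_null M p T \<Theta>')"
    and "\<And>D. upper_half_line D \<Longrightarrow> vanish_on M p T \<Theta>' D \<Longrightarrow> D \<subseteq> upper_null M p T \<Theta>'"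
proof -
  let ?P = "\<lambda>D. upper_half_line D \<and> vanish_on M p T \<Theta>' D"
  let ?U = "\<Union>{D. ?P D}"
  have v: "vanish_on M p T \<Theta>' ?U" unfolding vanish_on_def by blast
  then have "?U \<noteq> UNIV" using not_vanish_on_UNIV[OF assms] by metis
  moreover have "y \<in> ?U" if xy: "x \<in> ?U" "x \<le> y" for x y
  proof -
    obtain D where D: "?P D" "x \<in> D" using xy(1) by blast
    then have "y \<in> D" using xy(2) unfolding upper_half_line_def by auto
    then show ?thesis using D(1) by blast
  qed
  ultimately have PU: "?P ?U" using v up_closed_half_line[of ?U] by blast
  have eq: "upper_null M p T \<Theta>' = ?U"
    unfolding upper_null_def by (rule Greatest_equality[where P = ?P]) (rule PU, blast)
  show "upper_half_line (upper_null M p T \<Theta>')"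
    "vanish_on M p T \<Theta>' (upper_null M p T \<Theta>')"
    using PU unfolding eq by simp_all
  show "D \<subseteq> upper_null M p T \<Theta>'" if "upper_half_line D" "vanish_on M p T \<Theta>' D" for D
    unfolding eq using that by blast
qed

section \<open>The indexed family of tests and its order\<close>

text \<open>\<open>Cut t u\<close> stands for \<open>f\<^sub>(\<^sub>t\<^sub>,\<^sub>u\<^sub>)\<close>, with \<open>u = 0\<close> and \<open>u = 1\<close> written \<^const>\<open>False\<close> and
  \<^const>\<open>True\<close>. All pairs are kept: the least one \<open>(-\<infinity>, 0)\<close> and the greatest one
  \<open>(+\<infinity>, 1)\<close> are exactly the two formal elements adjoined to the family. The order is
  lexicographic; the library order on products is the componentwise one.\<close>

datatype cut = Cut (pos: ereal) (att: bool)

instantiation cut :: complete_linorder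
begin

definition less_eq_cut :: "cut \<Rightarrow> cut \<Rightarrow> bool" where
  "x \<le> y \<longleftrightarrow> pos x < pos y \<or> (pos x = pos y \<and> att x \<le> att y)"

definition less_cut :: "cut \<Rightarrow> cut \<Rightarrow> bool" where
  "x < y \<longleftrightarrow> pos x < pos y \<or> (pos x = pos y \<and> att x < att y)"

definition inf_cut :: "cut \<Rightarrow> cut \<Rightarrow> cut" where "inf_cut x y = (if x \<le> y then x else y)"

definition sup_cut :: "cut \<Rightarrow> cut \<Rightarrow> cut" where "sup_cut x y = (if x \<le> y then y else x)"

definition bot_cut :: cut where "bot_cut = Cut (-\<infinity>) False"

definition top_cut :: cut where "top_cut = Cut \<infinity> True"

definition Sup_cut :: "cut set \<Rightarrow> cut" where
  "Sup_cut A = Cut (Sup (pos ` A)) (\<exists>x\<in>A. pos x = Sup (pos ` A) \<and> att x)"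

definition Inf_cut :: "cut set \<Rightarrow> cut" where
  "Inf_cut A = Cut (Inf (pos ` A)) (\<forall>x\<in>A. pos x = Inf (pos ` A) \<longrightarrow> att x)"

instance
proof
  fix x y z :: cut and A :: "cut set"
  show lt: "(x < y) = (x \<le> y \<and> \<not> y \<le> x)" for x y :: cut
    by (auto simp: less_eq_cut_def less_cut_def)
  show "x \<le> x" by (simp add: less_eq_cut_def)
  show tr: "x \<le> y \<Longrightarrow> y \<le> z \<Longrightarrow> x \<le> z" for x y z :: cut
    by (auto simp: less_eq_cut_def)
  show "x \<le> y \<Longrightarrow> y \<le> x \<Longrightarrow> x = y"
    by (cases x; cases y) (auto simp: less_eq_cut_def)
  show lin: "x \<le> y \<or> y \<le> x" for x y :: cut by (auto simp: less_eq_cut_def)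
  show "inf x y \<le> x" "inf x y \<le> y" "x \<le> sup x y" "y \<le> sup x y"
    using lin[of x y] by (auto simp: inf_cut_def sup_cut_def less_eq_cut_def)
  show "x \<le> y \<Longrightarrow> x \<le> z \<Longrightarrow> x \<le> inf y z" by (simp add: inf_cut_def)
  show "y \<le> x \<Longrightarrow> z \<le> x \<Longrightarrow> sup y z \<le> x" by (simp add: sup_cut_def)
  show "Inf A \<le> x" if "x \<in> A"
  proof -
    have "Inf (pos ` A) \<le> pos x" using that by (intro Inf_lower) auto
    then show ?thesis using that by (auto simp: less_eq_cut_def Inf_cut_def le_less)
  qed
  show "x \<le> Sup A" if "x \<in> A"
  proof -
    have "pos x \<le> Sup (pos ` A)" using that by (intro Sup_upper) auto
    then show ?thesis using that by (auto simp: less_eq_cut_def Sup_cut_def le_less)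
  qed
  show "z \<le> Inf A" if z: "\<And>x. x \<in> A \<Longrightarrow> z \<le> x"
  proof -
    have "pos z \<le> Inf (pos ` A)"
      by (intro Inf_greatest) (use z in \<open>fastforce simp: less_eq_cut_def\<close>)
    moreover have "att x" if "att z" "pos z = Inf (pos ` A)" "x \<in> A" "pos x = Inf (pos ` A)" for x
      using z[OF that(3)] that by (auto simp: less_eq_cut_def)
    ultimately show ?thesis by (auto simp: less_eq_cut_def Inf_cut_def le_less)
  qed
  show "Sup A \<le> z" if z: "\<And>x. x \<in> A \<Longrightarrow> x \<le> z"
  proof -
    have "Sup (pos ` A) \<le> pos z"
      by (intro Sup_least) (use z in \<open>fastforce simp: less_eq_cut_def\<close>)
    moreover have "att z" if "pos z = Sup (pos ` A)" "x \<in> A" "pos x = Sup (pos ` A)" "att x" for x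
      using z[OF that(2)] that by (auto simp: less_eq_cut_def)
    ultimately show ?thesis by (auto simp: less_eq_cut_def Sup_cut_def le_less)
  qed
  show "Inf ({} :: cut set) = top" "Sup ({} :: cut set) = bot"
    by (simp_all add: Inf_cut_def Sup_cut_def top_cut_def bot_cut_def
        top_ereal_def bot_ereal_def)
qed

end

definition test_family :: "cut set" where
  "test_family = {Cut (-\<infinity>) True} \<union> {Cut (ereal t) u | t u. True} \<union> {Cut \<infinity> False}"

text \<open>Tests are taken as functions of the value \<open>s\<close> of \<open>T\<close>; as such, distinct elements of
  \<^const>\<open>test_family\<close> are distinct functions, and the pointwise order is the lexicographic one.\<close>

definition cut_test :: "cut \<Rightarrow> real \<Rightarrow> real" where
  "cut_test c s = of_bool (ereal s < pos c) + of_bool (att c) * of_bool (ereal s = pos c)"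

definition order_topology_on :: "'a::linorder set \<Rightarrow> 'a topology" where
  "order_topology_on F = topology_generated_by
     ({F} \<union> {{x\<in>F. x < y} | y. y \<in> F} \<union> {{x\<in>F. y < x} | y. y \<in> F})"

section \<open>The essential statistic of one-sided hypotheses\<close>

definition normalized_family ::
  "'w measure \<Rightarrow> (real \<Rightarrow> 'w \<Rightarrow> real) \<Rightarrow> ('w \<Rightarrow> real) \<Rightarrow> real set \<Rightarrow> real set \<Rightarrow>
   (real \<Rightarrow> real \<Rightarrow> real \<Rightarrow> ennreal) \<Rightarrow> bool" where
  "normalized_family M p T \<Theta>1 \<Theta>0 h \<longleftrightarrow>
     (let Di = lower_null M p T \<Theta>0; Ds = upper_null M p T \<Theta>1 in
      \<forall>\<theta>0\<in>\<Theta>0. \<forall>\<theta>1\<in>\<Theta>1.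
        mono (h \<theta>0 \<theta>1) \<and>
        ratio_is M p T \<theta>0 \<theta>1 (h \<theta>0 \<theta>1) \<and>
        (\<forall>I. is_interval I \<and> I \<subseteq> UNIV - (Di \<union> Ds) \<and> vanish_on M p T {\<theta>0, \<theta>1} I \<longrightarrow>
             (h \<theta>0 \<theta>1) constant_on I) \<and>
        (\<forall>t\<in>Ds. h \<theta>0 \<theta>1 t = \<infinity>) \<and>
        (\<forall>t\<in>Di - Ds. h \<theta>0 \<theta>1 t = 0))"

definition simple_test :: "(real \<Rightarrow> ennreal) \<Rightarrow> ennreal \<Rightarrow> bool \<Rightarrow> real \<Rightarrow> real" where
  "simple_test g k \<beta> s = of_bool (g s < k) + of_bool \<beta> * of_bool (g s = k)"

definition simple_tests ::
  "real set \<Rightarrow> real set \<Rightarrow> (real \<Rightarrow> real \<Rightarrow> real \<Rightarrow> ennreal) \<Rightarrow> cut set" where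
  "simple_tests \<Theta>1 \<Theta>0 h = {c \<in> test_family. \<exists>\<theta>0\<in>\<Theta>0. \<exists>\<theta>1\<in>\<Theta>1.
     \<exists>(k, \<beta>) \<in> {(0, True)} \<union> {0<..<\<infinity>} \<times> {False, True} \<union> {(\<infinity>, False)}.
       cut_test c = simple_test (h \<theta>0 \<theta>1) k \<beta>}"

definition ess_statistic ::
  "real set \<Rightarrow> real set \<Rightarrow> (real \<Rightarrow> real \<Rightarrow> real \<Rightarrow> ennreal) \<Rightarrow> real \<Rightarrow> ereal" where
  "ess_statistic \<Theta>1 \<Theta>0 h t =
     (let C = order_topology_on test_family closure_of simple_tests \<Theta>1 \<Theta>0 h;
          A = Sup ({f \<in> C. f \<le> Cut (ereal t) False} \<union> {Cut (-\<infinity>) False});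
          B = Inf ({f \<in> C. Cut (ereal t) True \<le> f} \<union> {Cut \<infinity> True})
      in if A = Cut (-\<infinity>) False then -\<infinity>
         else if A = Cut (-\<infinity>) True then pos B - 1
         else if B = Cut \<infinity> True then \<infinity>
         else if B = Cut \<infinity> False then pos A + 1
         else (pos A + pos B) / 2)"

definition mean_df ::
  "'w measure \<Rightarrow> (real \<Rightarrow> 'w \<Rightarrow> real) \<Rightarrow> ('w \<Rightarrow> ereal) \<Rightarrow> real \<Rightarrow> ereal \<Rightarrow> real" where
  "mean_df M p S \<theta> k =
     (measure (model_prob M p \<theta>) {\<omega>\<in>space M. S \<omega> < k} +
      measure (model_prob M p \<theta>) {\<omega>\<in>space M. S \<omega> \<le> k}) / 2"

section \<open>Votes\<close>

text \<open>A probability on \<open>{0, 1}\<close> is given by its value at \<open>1\<close>; its value at \<open>0\<close> is the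
  complement to one.\<close>

definition vote ::
  "'w measure \<Rightarrow> (real \<Rightarrow> 'w \<Rightarrow> real) \<Rightarrow> ('w \<Rightarrow> real) \<Rightarrow> real set \<Rightarrow> real set \<Rightarrow>
   (real \<Rightarrow> real \<Rightarrow> real \<Rightarrow> ennreal) \<Rightarrow> real \<Rightarrow> 'w \<Rightarrow> real" where
  "vote M p T \<Theta>1 \<Theta>0 h \<theta> \<omega> =
     (let Di = lower_null M p T \<Theta>0; Ds = upper_null M p T \<Theta>1; K = ess_statistic \<Theta>1 \<Theta>0 h in
      if T \<omega> \<in> Ds then 0
      else if T \<omega> \<in> Di then 1
      else 1 - mean_df M p (\<lambda>\<omega>. K (T \<omega>)) \<theta> (K (T \<omega>)))"

text \<open>\<open>h \<Theta>1\<close> is the normalized family chosen for the hypotheses \<open>{\<Theta>1, \<Theta> - \<Theta>1}\<close>.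
  \<open>votes_Q1\<close> and \<open>votes_Q0\<close> are the values at \<open>1\<close> of the most favourable votes under
  \<open>\<Theta>1\<close> and under \<open>\<Theta> - \<Theta>1\<close>; the latter maximizes the value at \<open>0\<close>.\<close>

definition votes_Q1 ::
  "'w measure \<Rightarrow> (real \<Rightarrow> 'w \<Rightarrow> real) \<Rightarrow> ('w \<Rightarrow> real) \<Rightarrow> real set \<Rightarrow>
   (real set \<Rightarrow> real \<Rightarrow> real \<Rightarrow> real \<Rightarrow> ennreal) \<Rightarrow> 'w \<Rightarrow> real set \<Rightarrow> real" where
  "votes_Q1 M p T \<Theta> h \<omega> \<Theta>1 = (SUP \<theta>\<in>\<Theta>1. vote M p T \<Theta>1 (\<Theta> - \<Theta>1) (h \<Theta>1) \<theta> \<omega>)"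

definition votes_Q0 ::
  "'w measure \<Rightarrow> (real \<Rightarrow> 'w \<Rightarrow> real) \<Rightarrow> ('w \<Rightarrow> real) \<Rightarrow> real set \<Rightarrow>
   (real set \<Rightarrow> real \<Rightarrow> real \<Rightarrow> real \<Rightarrow> ennreal) \<Rightarrow> 'w \<Rightarrow> real set \<Rightarrow> real" where
  "votes_Q0 M p T \<Theta> h \<omega> \<Theta>1 =
     1 - (SUP \<theta>\<in>\<Theta> - \<Theta>1. 1 - vote M p T \<Theta>1 (\<Theta> - \<Theta>1) (h \<Theta>1) \<theta> \<omega>)"

definition left_hypotheses :: "real set \<Rightarrow> real set set" where
  "left_hypotheses \<Theta> = {\<Theta>1. one_sided \<Theta> \<Theta>1 (\<Theta> - \<Theta>1)}"

definition compatible_votes ::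
  "'w measure \<Rightarrow> (real \<Rightarrow> 'w \<Rightarrow> real) \<Rightarrow> real set \<Rightarrow> ('w \<Rightarrow> real set \<Rightarrow> real) \<Rightarrow> bool" where
  "compatible_votes M p \<Theta> Q \<longleftrightarrow>
     (\<forall>\<omega>\<in>space M. \<forall>A\<in>left_hypotheses \<Theta>. Q \<omega> A \<in> {0..1}) \<and>
     almost_every_outcome M p \<Theta> (\<lambda>\<omega>.
       (\<forall>A\<in>left_hypotheses \<Theta>. \<forall>B\<in>left_hypotheses \<Theta>. A \<subseteq> B \<longrightarrow> Q \<omega> A \<le> Q \<omega> B) \<and>
       (\<forall>A. range A \<subseteq> left_hypotheses \<Theta> \<and> incseq A \<and> (\<Union>n. A n) = \<Theta> \<longrightarrow>
            (\<lambda>n. Q \<omega> (A n)) \<longlonglongrightarrow> 1) \<and>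
       (\<forall>A. range A \<subseteq> left_hypotheses \<Theta> \<and> decseq A \<and> (\<Inter>n. A n) = {} \<longrightarrow>
            (\<lambda>n. Q \<omega> (A n)) \<longlonglongrightarrow> 0) \<and>
       (\<forall>A B. range A \<subseteq> left_hypotheses \<Theta> \<and> range B \<subseteq> left_hypotheses \<Theta> \<and>
            incseq A \<and> decseq B \<and> (\<Union>n. A n) = (\<Inter>n. B n) \<longrightarrow>
            (\<exists>l. (\<lambda>n. Q \<omega> (A n)) \<longlonglongrightarrow> l \<and> (\<lambda>n. Q \<omega> (B n)) \<longlonglongrightarrow> l)))"

definition extends_to ::
  "real set \<Rightarrow> (real set \<Rightarrow> real) \<Rightarrow> real measure \<Rightarrow> bool" where
  "extends_to \<Theta> q \<nu> \<longleftrightarrow> prob_space \<nu> \<and> sets \<nu> = sets (restrict_space borel \<Theta>) \<and>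
     (\<forall>A\<in>left_hypotheses \<Theta>. measure \<nu> A = q A)"

section \<open>The global essential statistic\<close>

definition unseen_values ::
  "'w measure \<Rightarrow> (real \<Rightarrow> 'w \<Rightarrow> real) \<Rightarrow> ('w \<Rightarrow> real) \<Rightarrow> real set \<Rightarrow> real set" where
  "unseen_values M p T \<Theta> = {t. \<forall>\<omega>\<in>T -` {t} \<inter> space M. \<forall>\<theta>\<in>\<Theta>. p \<theta> \<omega> = 0}"

definition global_ess_statistic ::
  "'w measure \<Rightarrow> (real \<Rightarrow> 'w \<Rightarrow> real) \<Rightarrow> ('w \<Rightarrow> real) \<Rightarrow> real set \<Rightarrow>
   (real set \<Rightarrow> real \<Rightarrow> real \<Rightarrow> real \<Rightarrow> ennreal) \<Rightarrow> (real \<Rightarrow> ereal) \<Rightarrow> bool" where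
  "global_ess_statistic M p T \<Theta> h K \<longleftrightarrow> mono K \<and>
     (\<forall>\<Theta>1 \<Theta>0. one_sided \<Theta> \<Theta>1 \<Theta>0 \<longrightarrow>
       (let Di = lower_null M p T \<Theta>0; Ds = upper_null M p T \<Theta>1; N = unseen_values M p T \<Theta>;
            K1 = ess_statistic \<Theta>1 \<Theta>0 (h \<Theta>1);
            G = mean_df M p (\<lambda>\<omega>. K (T \<omega>)); G1 = mean_df M p (\<lambda>\<omega>. K1 (T \<omega>))
        in (\<forall>t\<in>UNIV - (Di \<union> Ds \<union> N). \<forall>\<theta>\<in>\<Theta>. G \<theta> (K t) = G1 \<theta> (K1 t)) \<and>
           (\<forall>t\<in>Di - N. \<forall>\<theta>0\<in>\<Theta>0. G \<theta>0 (K t) = 0) \<and>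
           (\<forall>t\<in>Ds - N. \<forall>\<theta>1\<in>\<Theta>1. G \<theta>1 (K t) = 1)))"

text \<open>The infimum and the supremum of \<open>\<Theta>\<close> are taken in \<open>[-\<infinity>, +\<infinity>]\<close>, so an unbounded
  \<open>\<Theta>\<close> does not contain them.\<close>

definition to_inf :: "real set \<Rightarrow> real filter" where
  "to_inf \<Theta> = (if bdd_below \<Theta> then at (Inf \<Theta>) within \<Theta> else at_bot)"

definition to_sup :: "real set \<Rightarrow> real filter" where
  "to_sup \<Theta> = (if bdd_above \<Theta> then at (Sup \<Theta>) within \<Theta> else at_top)"

definition regular_at ::
  "'w measure \<Rightarrow> (real \<Rightarrow> 'w \<Rightarrow> real) \<Rightarrow> ('w \<Rightarrow> real) \<Rightarrow> real set \<Rightarrow> (real \<Rightarrow> ereal) \<Rightarrow> real \<Rightarrow> bool" where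
  "regular_at M p T \<Theta> K t \<longleftrightarrow>
     (let G = (\<lambda>\<theta>. mean_df M p (\<lambda>\<omega>. K (T \<omega>)) \<theta> (K t)) in
      (\<forall>\<theta>f\<in>\<Theta>. ereal \<theta>f \<noteq> (SUP \<theta>\<in>\<Theta>. ereal \<theta>) \<and> t \<notin> lower_null M p T {\<theta>\<in>\<Theta>. \<theta> > \<theta>f} \<longrightarrow>
          continuous (at \<theta>f within \<Theta> \<inter> {\<theta>f<..}) G) \<and>
      (\<forall>\<theta>f\<in>\<Theta>. ereal \<theta>f \<noteq> (INF \<theta>\<in>\<Theta>. ereal \<theta>) \<and> t \<notin> upper_null M p T {\<theta>\<in>\<Theta>. \<theta> < \<theta>f} \<longrightarrow>
          continuous (at \<theta>f within \<Theta> \<inter> {..<\<theta>f}) G) \<and>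
      ((INF \<theta>\<in>\<Theta>. ereal \<theta>) \<notin> ereal ` \<Theta> \<longrightarrow> (G \<longlongrightarrow> 1) (to_inf \<Theta>)) \<and>
      ((SUP \<theta>\<in>\<Theta>. ereal \<theta>) \<notin> ereal ` \<Theta> \<longrightarrow> (G \<longlongrightarrow> 0) (to_sup \<Theta>)))"

end

theory Submission
  imports Defs
begin

text \<open>Fix a value \<open>t\<close> of the statistic at which some density is positive. Likelihood ratios being
  monotone, the curve \<open>F \<theta> = 1 - G\<^sub>\<theta>(K(t))\<close> increases, and it equals 0 on the lower set
  \<open>\<Sigma>\<close> of the parameters whose density vanishes on \<open>T \<ge> t\<close> and 1 on the disjoint upper set \<open>\<I>\<close> of
  those whose density vanishes on \<open>T \<le> t\<close>. Both votes are then explicit: \<open>Q\<^sub>1(A)\<close> is 1 if the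
  complement of \<open>A\<close> lies in \<open>\<I>\<close> and \<open>sup\<^sub>A F\<close> otherwise, and \<open>Q\<^sub>0(A)\<close> is 0 if \<open>A\<close> lies in \<open>\<Sigma>\<close> and the
  infimum of \<open>F\<close> over the complement of \<open>A\<close> otherwise. So at each such \<open>t\<close> right continuity of \<open>F\<close>
  is what makes \<open>Q\<^sub>1\<close> continuous along decreasing hypotheses and left continuity is what makes
  \<open>Q\<^sub>0\<close> continuous along increasing ones; when both hold the two votes agree, and they extend
  through the Lebesgue-Stieltjes measure of \<open>x \<mapsto> Q(\<Theta> \<inter> ]-\<infinity>, x])\<close>. The remaining values of \<open>t\<close> are
  covered by a null event.\<close>

section \<open>Compatible votes and their extension\<close>

text \<open>As long as the conventional values 0 and 1 stay out of play, each vote sees one side of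
  a cut only: a supremum over \<open>A\<close> passes to increasing unions whatever the jumps of the
  curve, and an infimum over the complement passes to decreasing intersections. Hence the
  equivalence needs both votes. The conventions are the obstacle. If all parameters above
  \<open>a\<close> lie in \<open>\<I>\<close>, the curve may jump to 1 just after \<open>a\<close>;
  yet both votes for the section up to \<open>a\<close> are then 1 and the jump is invisible. This
  is why continuity is demanded only off the null half-lines. The two conventions could even
  contradict each other, were it not for a parameter whose density is positive at the given value:
  it lies in neither \<open>\<Sigma>\<close> nor \<open>\<I>\<close>, and every hypothesis leaves it
  on one side or the other. Such a parameter is missing exactly at the unseen values, so these have
  to be shown negligible, although there may be uncountably many densities and the set of these
  values need not be measurable.\<close>

definition compatible_at :: "real set \<Rightarrow> (real set \<Rightarrow> real) \<Rightarrow> bool" where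
  "compatible_at \<Theta> q \<longleftrightarrow>
     (\<forall>A\<in>left_hypotheses \<Theta>. \<forall>B\<in>left_hypotheses \<Theta>. A \<subseteq> B \<longrightarrow> q A \<le> q B) \<and>
     (\<forall>A. range A \<subseteq> left_hypotheses \<Theta> \<and> incseq A \<and> (\<Union>n. A n) = \<Theta> \<longrightarrow>
          (\<lambda>n. q (A n)) \<longlonglongrightarrow> 1) \<and>
     (\<forall>A. range A \<subseteq> left_hypotheses \<Theta> \<and> decseq A \<and> (\<Inter>n. A n) = {} \<longrightarrow>
          (\<lambda>n. q (A n)) \<longlonglongrightarrow> 0) \<and>
     (\<forall>A B. range A \<subseteq> left_hypotheses \<Theta> \<and> range B \<subseteq> left_hypotheses \<Theta> \<and>
          incseq A \<and> decseq B \<and> (\<Union>n. A n) = (\<Inter>n. B n) \<longrightarrow>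
          (\<exists>l. (\<lambda>n. q (A n)) \<longlonglongrightarrow> l \<and> (\<lambda>n. q (B n)) \<longlonglongrightarrow> l))"

lemma compatible_votes_iff:
  "compatible_votes M p \<Theta> Q \<longleftrightarrow> (\<forall>\<omega>\<in>space M. \<forall>A\<in>left_hypotheses \<Theta>. Q \<omega> A \<in> {0..1}) \<and>
     almost_every_outcome M p \<Theta> (\<lambda>\<omega>. compatible_at \<Theta> (Q \<omega>))"
  unfolding compatible_votes_def compatible_at_def ..

lemma compatible_at_mono:
  "\<lbrakk>compatible_at \<Theta> q; A \<in> left_hypotheses \<Theta>; B \<in> left_hypotheses \<Theta>; A \<subseteq> B\<rbrakk> \<Longrightarrow> q A \<le> q B"
  unfolding compatible_at_def by simp

lemma compatible_at_full:
  "\<lbrakk>compatible_at \<Theta> q; range A \<subseteq> left_hypotheses \<Theta>; incseq A; (\<Union>n. A n) = \<Theta>\<rbrakk>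
    \<Longrightarrow> (\<lambda>n. q (A n)) \<longlonglongrightarrow> 1"
  unfolding compatible_at_def by simp

lemma compatible_at_empty:
  "\<lbrakk>compatible_at \<Theta> q; range A \<subseteq> left_hypotheses \<Theta>; decseq A; (\<Inter>n. A n) = {}\<rbrakk>
    \<Longrightarrow> (\<lambda>n. q (A n)) \<longlonglongrightarrow> 0"
  unfolding compatible_at_def by simp

lemma compatible_at_common:
  assumes "compatible_at \<Theta> q" "range A \<subseteq> left_hypotheses \<Theta>" "range B \<subseteq> left_hypotheses \<Theta>"
    "incseq A" "decseq B" "(\<Union>n. A n) = (\<Inter>n. B n)"
  shows "\<exists>l. (\<lambda>n. q (A n)) \<longlonglongrightarrow> l \<and> (\<lambda>n. q (B n)) \<longlonglongrightarrow> l"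
  using assms unfolding compatible_at_def by simp

text \<open>A limit that is itself a hypothesis fits the clause on common limits: the opposite
  sequence is taken constant, which identifies \<open>l\<close>.\<close>

lemma compatible_at_incseq:
  assumes "compatible_at \<Theta> q" "range A \<subseteq> left_hypotheses \<Theta>" "incseq A" "(\<Union>n. A n) \<in> left_hypotheses \<Theta>"
  shows "(\<lambda>n. q (A n)) \<longlonglongrightarrow> q (\<Union>n. A n)"
proof -
  define B where "B = (\<lambda>n::nat. \<Union>n. A n)"
  have "range B \<subseteq> left_hypotheses \<Theta>" "decseq B" "(\<Union>n. A n) = (\<Inter>n. B n)"
    using assms(4) by (auto simp: B_def decseq_def)
  then obtain l where l: "(\<lambda>n. q (A n)) \<longlonglongrightarrow> l" "(\<lambda>n. q (B n)) \<longlonglongrightarrow> l"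
    using compatible_at_common[OF assms(1)] assms(2,3) by meson
  then have "l = q (\<Union>n. A n)"
    unfolding B_def by (simp add: LIMSEQ_const_iff)
  with l show ?thesis by simp
qed

lemma compatible_at_decseq:
  assumes "compatible_at \<Theta> q" "range B \<subseteq> left_hypotheses \<Theta>" "decseq B" "(\<Inter>n. B n) \<in> left_hypotheses \<Theta>"
  shows "(\<lambda>n. q (B n)) \<longlonglongrightarrow> q (\<Inter>n. B n)"
proof -
  define A where "A = (\<lambda>n::nat. \<Inter>n. B n)"
  have "range A \<subseteq> left_hypotheses \<Theta>" "incseq A" "(\<Union>n. A n) = (\<Inter>n. B n)"
    using assms(4) by (auto simp: A_def incseq_def)
  then obtain l where l: "(\<lambda>n. q (A n)) \<longlonglongrightarrow> l" "(\<lambda>n. q (B n)) \<longlonglongrightarrow> l"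
    using compatible_at_common[OF assms(1)] assms(2,3) by meson
  then have "l = q (\<Inter>n. B n)"
    unfolding A_def by (simp add: LIMSEQ_const_iff)
  with l show ?thesis by simp
qed

lemma compatible_at_cong:
  assumes "\<And>A. A \<in> left_hypotheses \<Theta> \<Longrightarrow> q A = q' A" "compatible_at \<Theta> q"
  shows "compatible_at \<Theta> q'"
proof -
  have "q (A n) = q' (A n)" if "range A \<subseteq> left_hypotheses \<Theta>" for A :: "nat \<Rightarrow> real set" and n
    using assms(1) that by blast
  then show ?thesis using assms unfolding compatible_at_def by simp
qed

section \<open>Left hypotheses as lower sections of the parameter interval\<close>

lemma left_hypothesesI:
  assumes "A \<subseteq> \<Theta>" "A \<noteq> {}" "A \<noteq> \<Theta>" "\<And>x y. x \<in> A \<Longrightarrow> y \<in> \<Theta> \<Longrightarrow> y \<le> x \<Longrightarrow> y \<in> A"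
  shows "A \<in> left_hypotheses \<Theta>"
proof -
  have "x < y" if "x \<in> A" "y \<in> \<Theta> - A" for x y using assms(4)[OF that(1)] that(2) by force
  then show ?thesis using assms(1-3) unfolding left_hypotheses_def one_sided_def by blast
qed

lemma left_hypothesesD:
  assumes "A \<in> left_hypotheses \<Theta>"
  shows "one_sided \<Theta> A (\<Theta> - A)" "A \<subseteq> \<Theta>" "A \<noteq> {}" "\<Theta> - A \<noteq> {}"
    and "\<And>x y. x \<in> A \<Longrightarrow> y \<in> \<Theta> - A \<Longrightarrow> x < y"
    and "\<And>x y. x \<in> A \<Longrightarrow> y \<in> \<Theta> \<Longrightarrow> y \<le> x \<Longrightarrow> y \<in> A"
proof -
  show 1: "one_sided \<Theta> A (\<Theta> - A)" using assms unfolding left_hypotheses_def by simp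
  then show "A \<subseteq> \<Theta>" "A \<noteq> {}" "\<Theta> - A \<noteq> {}"
    and 2: "\<And>x y. x \<in> A \<Longrightarrow> y \<in> \<Theta> - A \<Longrightarrow> x < y"
    unfolding one_sided_def by blast+
  show "\<And>x y. x \<in> A \<Longrightarrow> y \<in> \<Theta> \<Longrightarrow> y \<le> x \<Longrightarrow> y \<in> A"
    using 2 by (meson DiffI leD)
qed

text \<open>The cut is \<open>Sup A\<close>. It lies between a member of \<open>A\<close> and a
  member of the complement, hence in the interval \<open>\<Theta>\<close>; whether it belongs to
  \<open>A\<close> decides the case. The point \<open>b\<close> records that the other side is
  nonempty: it comes from the complement in the first case and from \<open>A\<close> in the
  second.\<close>

lemma left_hypotheses_cases:
  assumes "is_interval \<Theta>" "A \<in> left_hypotheses \<Theta>"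
  obtains (atMost) a b where "a \<in> \<Theta>" "b \<in> \<Theta>" "a < b" "A = \<Theta> \<inter> {..a}"
  | (lessThan) a b where "a \<in> \<Theta>" "b \<in> \<Theta>" "b < a" "A = \<Theta> \<inter> {..<a}"
proof -
  note A = left_hypothesesD[OF assms(2)]
  define a where "a = Sup A"
  obtain x y where x: "x \<in> A" and y: "y \<in> \<Theta> - A" using A(3,4) by blast
  have bdd: "bdd_above A" using A(5) y by (meson bdd_aboveI less_imp_le)
  have up: "z \<le> a" if "z \<in> A" for z unfolding a_def using that bdd by (rule cSup_upper)
  have low: "a \<le> z" if "z \<in> \<Theta> - A" for z
    unfolding a_def using A(3) A(5)[OF _ that] by (intro cSup_least) (auto intro: less_imp_le)
  have a: "a \<in> \<Theta>"
    using assms(1) x y up[OF x] low[OF y] A(2) unfolding is_interval_1 by blast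
  show ?thesis
  proof (cases "a \<in> A")
    case True
    then have "A = \<Theta> \<inter> {..a}" using A(2) A(6)[OF True] up by auto
    moreover have "a < y" using A(5)[OF True y] .
    ultimately show ?thesis using atMost[of a y] a y by blast
  next
    case False
    have lt: "z < a" if "z \<in> A" for z using up[OF that] that False by (cases "z = a") auto
    have "z \<in> A" if "z \<in> \<Theta>" "z < a" for z using low[of z] that by force
    then have "A = \<Theta> \<inter> {..<a}" using A(2) lt by auto
    then show ?thesis using lessThan[of a x] a x A(2) lt[OF x] by blast
  qed
qed

lemma left_hypotheses_atMost:
  assumes "a \<in> \<Theta>" "b \<in> \<Theta>" "a \<le> x" "x < b"
  shows "\<Theta> \<inter> {..x} \<in> left_hypotheses \<Theta>"
proof -
  have "a \<in> \<Theta> \<inter> {..x}" "b \<notin> \<Theta> \<inter> {..x}" using assms by auto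
  then show ?thesis using assms(2) by (intro left_hypothesesI) auto
qed

lemma left_hypotheses_lessThan:
  assumes "a \<in> \<Theta>" "b \<in> \<Theta>" "b < x" "x \<le> a"
  shows "\<Theta> \<inter> {..<x} \<in> left_hypotheses \<Theta>"
proof -
  have "b \<in> \<Theta> \<inter> {..<x}" "a \<notin> \<Theta> \<inter> {..<x}" using assms by auto
  then show ?thesis using assms(1) by (intro left_hypothesesI) auto
qed

text \<open>The distribution function lives on the whole line, \<open>q\<close> only on sections of
  \<open>\<Theta>\<close>. Two gaps have to be closed: all the mass must sit on
  \<open>\<Theta>\<close>, and the sections \<open>\<Theta> \<inter> {..<a}\<close>, which a
  distribution function reaches only through left limits, must receive the value
  \<open>q\<close>.\<close>

lemma compatible_at_extends:
  fixes q :: "real set \<Rightarrow> real"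
  assumes int: "is_interval \<Theta>" and ne: "\<Theta> \<noteq> {}" and q: "compatible_at \<Theta> q"
    and q01: "\<And>A. A \<in> left_hypotheses \<Theta> \<Longrightarrow> q A \<in> {0..1}"
  shows "\<exists>\<nu>. extends_to \<Theta> q \<nu>"
proof -
  \<comment> \<open>\<open>{}\<close> and \<open>\<Theta>\<close> are not hypotheses, so
    \<open>q\<close> says nothing about them; a probability on \<open>\<Theta>\<close> leaves no
    choice but 0 and 1.\<close>
  define qe where "qe = (\<lambda>A. if A = {} then 0 else if A = \<Theta> then 1 else q A)"
  \<comment> \<open>Lower sets are taken in the line and cut with \<open>\<Theta>\<close>
    afterwards: half-lines, their increasing unions and their decreasing intersections then fall
    under one notion.\<close>
  define lower where "lower = (\<lambda>L::real set. \<forall>x\<in>L. \<forall>y\<le>x. y \<in> L)"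
  have left: "\<Theta> \<inter> L = {} \<or> \<Theta> \<inter> L = \<Theta> \<or> \<Theta> \<inter> L \<in> left_hypotheses \<Theta>" if "lower L" for L
    using that left_hypothesesI[of "\<Theta> \<inter> L" \<Theta>] unfolding lower_def by blast
  have qe01: "0 \<le> qe (\<Theta> \<inter> L)" "qe (\<Theta> \<inter> L) \<le> 1" if "lower L" for L
    using left[OF that] q01[of "\<Theta> \<inter> L"] by (auto simp: qe_def)
  have mono: "qe (\<Theta> \<inter> L) \<le> qe (\<Theta> \<inter> L')" if L: "lower L" "lower L'" "L \<subseteq> L'" for L L'
  proof (cases "\<Theta> \<inter> L = {} \<or> \<Theta> \<inter> L' = \<Theta>")
    case True
    then have "qe (\<Theta> \<inter> L) = 0 \<or> qe (\<Theta> \<inter> L') = 1"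
    proof
      assume "\<Theta> \<inter> L' = \<Theta>"
      then have "qe (\<Theta> \<inter> L') = 1" using ne by (simp add: qe_def)
      then show ?thesis ..
    qed (simp add: qe_def)
    then show ?thesis using qe01[OF L(1)] qe01[OF L(2)] by auto
  next
    case False
    moreover from this have ne': "\<Theta> \<inter> L \<noteq> \<Theta>" "\<Theta> \<inter> L' \<noteq> {}" using L(3) by blast+
    ultimately have "q (\<Theta> \<inter> L) \<le> q (\<Theta> \<inter> L')"
      using left[OF L(1)] left[OF L(2)] L(3) by (intro compatible_at_mono[OF q]) auto
    then show ?thesis using False ne' by (simp add: qe_def)
  qed
  have inc: "(\<lambda>n. qe (\<Theta> \<inter> L n)) \<longlonglongrightarrow> qe (\<Theta> \<inter> (\<Union>n. L n))"
    if L: "\<And>n. lower (L n)" "incseq L" for L :: "nat \<Rightarrow> real set"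
  proof (cases "\<Theta> \<inter> (\<Union>n. L n) = {} \<or> (\<exists>m. \<Theta> \<inter> L m = \<Theta>)")
    case True
    then show ?thesis
    proof
      assume "\<Theta> \<inter> (\<Union>n. L n) = {}"
      then have "\<Theta> \<inter> L n = {}" for n by blast
      then show ?thesis using \<open>\<Theta> \<inter> (\<Union>n. L n) = {}\<close> by simp
    next
      assume "\<exists>m. \<Theta> \<inter> L m = \<Theta>"
      then obtain m where m: "\<Theta> \<inter> L m = \<Theta>" by blast
      have "\<Theta> \<inter> L n = \<Theta>" if "n \<ge> m" for n
        using m incseqD[OF L(2) that] by blast
      moreover have "\<Theta> \<inter> (\<Union>n. L n) = \<Theta>" using m by blast
      ultimately show ?thesis
        by (intro tendsto_eventually eventually_mono[OF eventually_ge_at_top[of m]]) simp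
    qed
  next
    case False
    then obtain m where m: "\<Theta> \<inter> L m \<noteq> {}" by blast
    \<comment> \<open>Once \<open>m\<close> terms are dropped, every trace on
      \<open>\<Theta>\<close> is a hypothesis. The union of the traces is either
      \<open>\<Theta>\<close>, where the limit is 1, or a hypothesis, where
      \<open>compatible_at_incseq\<close> applies.\<close>
    define A where "A = (\<lambda>n. \<Theta> \<inter> L (n + m))"
    have ne_A: "A n \<noteq> {}" for n
      using m incseqD[OF L(2), of m "n + m"] unfolding A_def by auto
    have A: "A n \<in> left_hypotheses \<Theta>" for n
      using left[OF L(1)] False ne_A[of n] unfolding A_def by blast
    have "incseq A"
      unfolding A_def incseq_def by (intro allI impI Int_mono order_refl incseqD[OF L(2)]) simp
    moreover have U: "(\<Union>n. A n) = \<Theta> \<inter> (\<Union>n. L n)"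
    proof -
      have "x \<in> L (n + m)" if "x \<in> L n" for x n using incseqD[OF L(2), of n "n + m"] that by auto
      then show ?thesis unfolding A_def by blast
    qed
    moreover have "lower (\<Union>n. L n)" using L(1) unfolding lower_def by blast
    ultimately have "(\<lambda>n. q (A n)) \<longlonglongrightarrow> qe (\<Theta> \<inter> (\<Union>n. L n))"
      using left[of "\<Union>n. L n"] False A compatible_at_full[OF q, of A]
        compatible_at_incseq[OF q, of A] by (simp add: qe_def image_subset_iff) metis
    moreover have "qe (A n) = q (A n)" for n
      using left_hypothesesD(3,4)[OF A[of n]] unfolding qe_def by auto
    ultimately have "(\<lambda>n. qe (\<Theta> \<inter> L (n + m))) \<longlonglongrightarrow> qe (\<Theta> \<inter> (\<Union>n. L n))" by (simp add: A_def)
    then show ?thesis by (rule LIMSEQ_offset)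
  qed
  have dec: "(\<lambda>n. qe (\<Theta> \<inter> L n)) \<longlonglongrightarrow> qe (\<Theta> \<inter> (\<Inter>n. L n))"
    if L: "\<And>n. lower (L n)" "decseq L" for L :: "nat \<Rightarrow> real set"
  proof (cases "\<Theta> \<inter> (\<Inter>n. L n) = \<Theta> \<or> (\<exists>m. \<Theta> \<inter> L m = {})")
    case True
    then show ?thesis
    proof
      assume "\<Theta> \<inter> (\<Inter>n. L n) = \<Theta>"
      then have "\<Theta> \<inter> L n = \<Theta>" for n by blast
      then show ?thesis using \<open>\<Theta> \<inter> (\<Inter>n. L n) = \<Theta>\<close> by simp
    next
      assume "\<exists>m. \<Theta> \<inter> L m = {}"
      then obtain m where m: "\<Theta> \<inter> L m = {}" by blast
      have "\<Theta> \<inter> L n = {}" if "n \<ge> m" for n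
        using m decseqD[OF L(2) that] by blast
      moreover have "\<Theta> \<inter> (\<Inter>n. L n) = {}" using m by blast
      ultimately show ?thesis
        by (intro tendsto_eventually eventually_mono[OF eventually_ge_at_top[of m]]) simp
    qed
  next
    case False
    then obtain m where m: "\<Theta> \<inter> L m \<noteq> \<Theta>" by blast
    define A where "A = (\<lambda>n. \<Theta> \<inter> L (n + m))"
    have ne_A: "A n \<noteq> \<Theta>" for n
      using m decseqD[OF L(2), of m "n + m"] unfolding A_def by auto
    have A: "A n \<in> left_hypotheses \<Theta>" for n
      using left[OF L(1)] False ne_A[of n] unfolding A_def by blast
    have "decseq A"
      unfolding A_def decseq_def by (intro allI impI Int_mono order_refl decseqD[OF L(2)]) simp
    moreover have U: "(\<Inter>n. A n) = \<Theta> \<inter> (\<Inter>n. L n)"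
    proof -
      have "x \<in> L n" if "x \<in> L (n + m)" for x n using decseqD[OF L(2), of n "n + m"] that by auto
      then show ?thesis unfolding A_def by blast
    qed
    moreover have "lower (\<Inter>n. L n)" using L(1) unfolding lower_def by blast
    ultimately have "(\<lambda>n. q (A n)) \<longlonglongrightarrow> qe (\<Theta> \<inter> (\<Inter>n. L n))"
      using left[of "\<Inter>n. L n"] False A compatible_at_empty[OF q, of A]
        compatible_at_decseq[OF q, of A] by (simp add: qe_def image_subset_iff) metis
    moreover have "qe (A n) = q (A n)" for n
      using left_hypothesesD(3,4)[OF A[of n]] unfolding qe_def by auto
    ultimately have "(\<lambda>n. qe (\<Theta> \<inter> L (n + m))) \<longlonglongrightarrow> qe (\<Theta> \<inter> (\<Inter>n. L n))" by (simp add: A_def)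
    then show ?thesis by (rule LIMSEQ_offset)
  qed
  have lower_atMost: "lower {..x}" and lower_lessThan: "lower {..<x}" for x
    unfolding lower_def by auto
  define H where "H = (\<lambda>x. qe (\<Theta> \<inter> {..x}))"
  have H_mono: "H x \<le> H y" if "x \<le> y" for x y
    unfolding H_def using that by (intro mono lower_atMost) auto
  have "(H \<longlongrightarrow> H a) (at_right a)" for a
  proof (rule tendsto_at_right_sequentially[of a "a + 1"])
    fix s assume s: "\<And>n. a < s n" "decseq s" "s \<longlonglongrightarrow> a"
    have "decseq (\<lambda>n. {..s n})" using s(2) by (auto simp: decseq_def intro: order_trans)
    moreover have "(\<Inter>n. {..s n}) = {..a}"
    proof -
      have "x \<le> a" if "\<And>n. x \<le> s n" for x using that s(3) by (meson LIMSEQ_le_const)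
      moreover have "x \<le> s n" if "x \<le> a" for x n using that s(1)[of n] by linarith
      ultimately show ?thesis by blast
    qed
    ultimately show "(\<lambda>n. H (s n)) \<longlonglongrightarrow> H a"
      unfolding H_def using dec[of "\<lambda>n. {..s n}"] lower_atMost by simp
  qed simp
  then have H_right: "continuous (at_right a) H" for a unfolding continuous_within .
  \<comment> \<open>The measure of an open half-line is a left limit of \<open>H\<close>; continuity
    of \<open>qe\<close> along increasing lower sets identifies it.\<close>
  have H_left: "(H \<longlongrightarrow> qe (\<Theta> \<inter> {..<a})) (at_left a)" for a
  proof (rule tendsto_at_left_sequentially[of "a - 1" a])
    fix s assume s: "\<And>n. s n < a" "incseq s" "s \<longlonglongrightarrow> a"
    have "incseq (\<lambda>n. {..s n})" using s(2) by (auto simp: incseq_def intro: order_trans)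
    moreover have "(\<Union>n. {..s n}) = {..<a}"
    proof -
      have "\<exists>n. x \<le> s n" if "x < a" for x
        using order_tendstoD(1)[OF s(3) that] by (meson eventually_sequentially less_imp_le order_refl)
      moreover have "x < a" if "x \<le> s n" for x n using that s(1)[of n] by linarith
      ultimately show ?thesis by blast
    qed
    ultimately show "(\<lambda>n. H (s n)) \<longlonglongrightarrow> qe (\<Theta> \<inter> {..<a})"
      unfolding H_def using inc[of "\<lambda>n. {..s n}"] lower_atMost by simp
  qed simp
  have H_top: "(H \<longlongrightarrow> 1) at_top"
  proof (rule tendsto_at_topI_sequentially)
    fix s :: "nat \<Rightarrow> real" assume s: "filterlim s at_top sequentially"
    have "(\<lambda>n. H (real n)) \<longlonglongrightarrow> qe (\<Theta> \<inter> (\<Union>n. {..real n}))"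
      unfolding H_def by (rule inc) (auto simp: lower_atMost incseq_def)
    moreover have "(\<Union>n. {..real n}) = UNIV" using real_arch_simple by blast
    ultimately have n1: "(\<lambda>n. H (real n)) \<longlonglongrightarrow> 1" using ne by (simp add: qe_def)
    show "(\<lambda>n. H (s n)) \<longlonglongrightarrow> 1"
    proof (rule order_tendstoI)
      fix y :: real assume "y < 1"
      then obtain k where "y < H (real k)"
        using order_tendstoD(1)[OF n1] by (metis eventually_sequentially order_refl)
      moreover have "eventually (\<lambda>n. real k \<le> s n) sequentially"
        using s by (simp add: filterlim_at_top)
      ultimately show "eventually (\<lambda>n. y < H (s n)) sequentially"
        by (elim eventually_mono) (metis H_mono less_le_trans)
    next
      fix y :: real assume y: "1 < y"
      have "H x \<le> 1" for x
        unfolding H_def by (rule qe01(2)[OF lower_atMost])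
      then have "H (s n) < y" for n using y by (rule le_less_trans)
      then show "eventually (\<lambda>n. H (s n) < y) sequentially" by simp
    qed
  qed
  have H_bot: "(H \<longlongrightarrow> 0) at_bot"
  proof (rule order_tendstoI)
    fix y :: real assume y: "y < 0"
    have "0 \<le> H x" for x
      unfolding H_def by (rule qe01(1)[OF lower_atMost])
    with y have "y < H x" for x by (rule less_le_trans)
    then show "eventually (\<lambda>x. y < H x) at_bot" by simp
  next
    fix y :: real assume y: "0 < y"
    have "(\<lambda>n. H (- real n)) \<longlonglongrightarrow> qe (\<Theta> \<inter> (\<Inter>n. {..- real n}))"
      unfolding H_def by (rule dec) (auto simp: lower_atMost decseq_def)
    moreover have "(\<Inter>n. {..- real n}) = {}"
    proof -
      have "\<exists>n. \<not> x \<le> - real n" for x using reals_Archimedean2[of "-x"] by (metis le_minus_iff not_le)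
      then show ?thesis by auto
    qed
    ultimately have "(\<lambda>n. H (- real n)) \<longlonglongrightarrow> 0" by (simp add: qe_def)
    then obtain k where "H (- real k) < y"
      using y by (metis eventually_sequentially order_refl order_tendstoD(2))
    then show "eventually (\<lambda>x. H x < y) at_bot"
      using H_mono unfolding eventually_at_bot_linorder by (meson le_less_trans)
  qed
  define \<nu>0 where "\<nu>0 = interval_measure H"
  interpret \<nu>0: real_distribution \<nu>0
    unfolding \<nu>0_def by (rule real_distribution_interval_measure[OF H_mono H_right H_bot H_top])
  have cdf: "cdf \<nu>0 = H"
    unfolding \<nu>0_def by (rule cdf_interval_measure[OF H_mono H_right H_bot])
  have m_atMost: "measure \<nu>0 {..x} = qe (\<Theta> \<inter> {..x})" for x
    using fun_cong[OF cdf, of x] by (simp add: cdf_def H_def)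
  have m_lessThan: "measure \<nu>0 {..<x} = qe (\<Theta> \<inter> {..<x})" for x
    using tendsto_unique[OF _ \<nu>0.cdf_at_left[of x, unfolded cdf] H_left[of x]] by simp
  have lower_borel: "L \<in> sets borel" if "lower L" for L
    using that by (intro real_interval_borel_measurable) (auto simp: lower_def is_interval_1)
  have m_lower: "measure \<nu>0 L = qe (\<Theta> \<inter> L)" if "lower L" for L
  proof (cases "L = UNIV")
    case True
    then show ?thesis using \<nu>0.prob_space ne by (simp add: qe_def)
  next
    case False
    then have "lower_half_line L" using down_closed_half_line[of L] that unfolding lower_def by blast
    moreover have "measure \<nu>0 {} = qe (\<Theta> \<inter> {})" by (simp add: qe_def)
    ultimately show ?thesis unfolding lower_half_line_def using m_atMost m_lessThan by metis
  qed
  \<comment> \<open>\<open>\<Theta>\<close> is the difference of two lower sets: the points below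
    some parameter, and the points strictly below all of them. Their traces on
    \<open>\<Theta>\<close> are \<open>\<Theta>\<close> and \<open>{}\<close>, so their measures are
    1 and 0.\<close>
  define U where "U = (\<Union>\<theta>\<in>\<Theta>. {..\<theta>})"
  define V where "V = (\<Inter>\<theta>\<in>\<Theta>. {..<\<theta>})"
  have lUV: "lower U" "lower V" unfolding lower_def U_def V_def by (auto intro: order_trans le_less_trans)
  have UV: "U - V = \<Theta>"
  proof (intro subset_antisym subsetI)
    fix x assume "x \<in> U - V"
    then obtain a b where "a \<in> \<Theta>" "b \<in> \<Theta>" "x \<le> a" "b \<le> x" unfolding U_def V_def by force
    then show "x \<in> \<Theta>" using int unfolding is_interval_1 by blast
  qed (auto simp: U_def V_def)
  have "V \<subseteq> U" using ne unfolding U_def V_def by fastforce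
  have "\<Theta> \<inter> U = \<Theta>" "\<Theta> \<inter> V = {}" using UV by blast+
  then have "measure \<nu>0 U = 1" "measure \<nu>0 V = 0"
    using m_lower lUV ne by (auto simp: qe_def)
  then have \<Theta>1: "measure \<nu>0 \<Theta> = 1"
    using \<nu>0.finite_measure_Diff[of U V] lower_borel[OF lUV(1)] lower_borel[OF lUV(2)] \<open>V \<subseteq> U\<close> UV
    by simp
  have \<Theta>_borel: "\<Theta> \<in> sets borel" using int by (rule real_interval_borel_measurable)
  have AE: "AE x in \<nu>0. x \<in> \<Theta>" using \<Theta>1 \<Theta>_borel by (intro \<nu>0.AE_prob_1)
  define \<nu> where "\<nu> = restrict_space \<nu>0 \<Theta>"
  have m\<nu>: "measure \<nu> A = measure \<nu>0 A" if "A \<subseteq> \<Theta>" for A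
    unfolding \<nu>_def by (rule measure_restrict_space) (use that \<Theta>_borel in auto)
  have "emeasure \<nu> (space \<nu>) = 1"
    unfolding \<nu>_def using \<Theta>_borel \<Theta>1
    by (subst emeasure_restrict_space) (auto simp: space_restrict_space \<nu>0.emeasure_eq_measure)
  then have "prob_space \<nu>" by (rule prob_spaceI)
  moreover have "sets \<nu> = sets (restrict_space borel \<Theta>)"
    unfolding \<nu>_def by (intro sets_restrict_space_cong) simp
  moreover have "measure \<nu> A = q A" if A: "A \<in> left_hypotheses \<Theta>" for A
  proof -
    note Ad = left_hypothesesD[OF A]
    \<comment> \<open>The lower hull of \<open>A\<close> in the line has trace \<open>A\<close> on
      \<open>\<Theta>\<close>, and it differs from \<open>A\<close> only outside
      \<open>\<Theta>\<close>, where there is no mass.\<close>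
    define L where "L = (\<Union>\<theta>\<in>A. {..\<theta>})"
    have L: "lower L" unfolding L_def lower_def by (auto intro: order_trans)
    have AL: "A = \<Theta> \<inter> L" using Ad(2,6) unfolding L_def by auto
    have "measure \<nu>0 A = measure \<nu>0 L"
      using AE lower_borel[OF L] \<Theta>_borel by (intro \<nu>0.finite_measure_eq_AE) (auto simp: AL)
    also have "\<dots> = qe A" using m_lower[OF L] AL by simp
    also have "\<dots> = q A" using Ad(2-4) by (auto simp: qe_def)
    finally show ?thesis using m\<nu>[OF Ad(2)] by simp
  qed
  ultimately show ?thesis unfolding extends_to_def by blast
qed

text \<open>Pushed forward to the line, both measures have the same distribution function: each
  \<open>\<Theta> \<inter> {..x}\<close> is empty, all of \<open>\<Theta>\<close>, or a hypothesis
  whose measure is prescribed. The push-forward loses nothing because the measurable sets of both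
  are Borel subsets of \<open>\<Theta>\<close>.\<close>

lemma extends_to_unique:
  assumes int: "is_interval \<Theta>" and "extends_to \<Theta> q \<nu>" "extends_to \<Theta> q \<nu>'"
  shows "\<nu> = \<nu>'"
proof -
  have \<Theta>_borel: "\<Theta> \<in> sets borel" using int by (rule real_interval_borel_measurable)
  have *: "real_distribution (distr \<nu> borel (\<lambda>x. x))"
    "\<And>X. X \<in> sets \<nu> \<Longrightarrow> X \<in> sets borel \<and> emeasure \<nu> X = emeasure (distr \<nu> borel (\<lambda>x. x)) X"
    "\<And>x. cdf (distr \<nu> borel (\<lambda>x. x)) x =
       (if \<Theta> \<inter> {..x} = {} then 0 else if \<Theta> \<inter> {..x} = \<Theta> then 1 else q (\<Theta> \<inter> {..x}))"
    if "extends_to \<Theta> q \<nu>" for \<nu>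
  proof -
    from that have "prob_space \<nu>" and s: "sets \<nu> = sets (restrict_space borel \<Theta>)"
      and m: "\<And>A. A \<in> left_hypotheses \<Theta> \<Longrightarrow> measure \<nu> A = q A"
      unfolding extends_to_def by auto
    interpret \<nu>: prob_space \<nu> by fact
    have sp: "space \<nu> = \<Theta>" using sets_eq_imp_space_eq[OF s] by (simp add: space_restrict_space)
    have meas: "(\<lambda>x. x) \<in> measurable \<nu> borel"
      using measurable_restrict_space1[of "\<lambda>x::real. x" borel borel \<Theta>] measurable_cong_sets[OF s refl]
      by auto
    show "real_distribution (distr \<nu> borel (\<lambda>x. x))"
      using \<nu>.prob_space_distr[OF meas]
      unfolding real_distribution_def real_distribution_axioms_def by simp
    show "X \<in> sets borel \<and> emeasure \<nu> X = emeasure (distr \<nu> borel (\<lambda>x. x)) X" if "X \<in> sets \<nu>" for X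
    proof -
      have "X \<in> sets borel" using that \<Theta>_borel unfolding s by (auto simp: sets_restrict_space_iff)
      moreover have "X \<subseteq> \<Theta>" using sets.sets_into_space[OF that] sp by simp
      ultimately show ?thesis using meas sp by (simp add: emeasure_distr Int_absorb2)
    qed
    fix x
    have "cdf (distr \<nu> borel (\<lambda>x. x)) x = measure \<nu> ({..x} \<inter> \<Theta>)"
      using meas by (simp add: cdf_def measure_distr sp)
    moreover have "measure \<nu> ({..x} \<inter> \<Theta>) = q (\<Theta> \<inter> {..x})"
      if "\<Theta> \<inter> {..x} \<noteq> {}" "\<Theta> \<inter> {..x} \<noteq> \<Theta>"
    proof -
      have "\<Theta> \<inter> {..x} \<in> left_hypotheses \<Theta>" by (rule left_hypothesesI) (use that in auto)
      from m[OF this] show ?thesis by (simp only: Int_commute)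
    qed
    moreover have "measure \<nu> ({..x} \<inter> \<Theta>) = 0" if "\<Theta> \<inter> {..x} = {}"
      using that by (simp add: Int_commute)
    moreover have "measure \<nu> ({..x} \<inter> \<Theta>) = 1" if "\<Theta> \<inter> {..x} = \<Theta>"
      using that \<nu>.prob_space sp by (simp add: Int_commute)
    ultimately show "cdf (distr \<nu> borel (\<lambda>x. x)) x =
       (if \<Theta> \<inter> {..x} = {} then 0 else if \<Theta> \<inter> {..x} = \<Theta> then 1 else q (\<Theta> \<inter> {..x}))"
      by presburger
  qed
  have "distr \<nu> borel (\<lambda>x. x) = distr \<nu>' borel (\<lambda>x. x)"
    by (intro cdf_unique[OF *(1)[OF assms(2)] *(1)[OF assms(3)]] ext)
      (simp only: *(3)[OF assms(2)] *(3)[OF assms(3)])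
  moreover have sets_eq: "sets \<nu> = sets \<nu>'" using assms(2,3) unfolding extends_to_def by simp
  ultimately have "emeasure \<nu> X = emeasure \<nu>' X" if "X \<in> sets \<nu>" for X
    using *(2)[OF assms(2), of X] *(2)[OF assms(3), of X] that by simp
  with sets_eq show ?thesis by (rule measure_eqI)
qed

text \<open>Sequences are traded for points: an increasing one eventually contains any given point
  of its union, a decreasing one eventually lies below any given parameter missing from its
  intersection. At a section with maximum \<open>a\<close> the increasing sequence is constant once
  it contains \<open>a\<close>, so only the approach from the right has to be controlled; at a
  section without maximum it is the decreasing sequence that becomes constant.\<close>

lemma compatible_atI:
  assumes int: "is_interval \<Theta>"
    and mono: "\<And>A B. A \<in> left_hypotheses \<Theta> \<Longrightarrow> B \<in> left_hypotheses \<Theta> \<Longrightarrow> A \<subseteq> B \<Longrightarrow> q A \<le> q B"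
    and q01: "\<And>A. A \<in> left_hypotheses \<Theta> \<Longrightarrow> q A \<in> {0..1::real}"
    and right: "\<And>a b e. a \<in> \<Theta> \<Longrightarrow> b \<in> \<Theta> \<Longrightarrow> a < b \<Longrightarrow> 0 < e \<Longrightarrow>
      \<exists>x\<in>\<Theta>. a < x \<and> (\<forall>B\<in>left_hypotheses \<Theta>. B \<subseteq> {..<x} \<longrightarrow> q B < q (\<Theta> \<inter> {..a}) + e)"
    and left: "\<And>a b e. a \<in> \<Theta> \<Longrightarrow> b \<in> \<Theta> \<Longrightarrow> b < a \<Longrightarrow> 0 < e \<Longrightarrow>
      \<exists>x\<in>\<Theta>. x < a \<and> (\<forall>B\<in>left_hypotheses \<Theta>. x \<in> B \<longrightarrow> q (\<Theta> \<inter> {..<a}) - e < q B)"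
    and bot: "\<And>e. (\<forall>a\<in>\<Theta>. \<exists>b\<in>\<Theta>. b < a) \<Longrightarrow> 0 < e \<Longrightarrow>
      \<exists>x\<in>\<Theta>. \<forall>B\<in>left_hypotheses \<Theta>. B \<subseteq> {..<x} \<longrightarrow> q B < e"
    and top: "\<And>e. (\<forall>a\<in>\<Theta>. \<exists>b\<in>\<Theta>. a < b) \<Longrightarrow> 0 < e \<Longrightarrow>
      \<exists>x\<in>\<Theta>. \<forall>B\<in>left_hypotheses \<Theta>. x \<in> B \<longrightarrow> 1 - e < q B"
  shows "compatible_at \<Theta> q"
proof -
  have inc_ev: "eventually (\<lambda>n. x \<in> A n) sequentially"
    if "incseq A" "x \<in> (\<Union>n. A n)" for A :: "nat \<Rightarrow> real set" and x
    using that by (auto simp: eventually_sequentially incseq_def subset_iff)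
  have dec_ev: "eventually (\<lambda>n. B n \<subseteq> {..<x}) sequentially"
    if B: "range B \<subseteq> left_hypotheses \<Theta>" "decseq B" "x \<in> \<Theta>" "x \<notin> (\<Inter>n. B n)"
    for B :: "nat \<Rightarrow> real set" and x
  proof -
    obtain m where m: "x \<notin> B m" using B(4) by blast
    have "B m \<subseteq> {..<x}"
    proof
      fix y assume "y \<in> B m"
      then show "y \<in> {..<x}" using left_hypothesesD(5)[of "B m" \<Theta> y x] B(1,3) m by auto
    qed
    then show ?thesis using B(2) unfolding eventually_sequentially decseq_def by blast
  qed
  have full: "(\<lambda>n. q (A n)) \<longlonglongrightarrow> 1"
    if A: "range A \<subseteq> left_hypotheses \<Theta>" "incseq A" "(\<Union>n. A n) = \<Theta>" for A
  proof (rule order_tendstoI)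
    fix y :: real assume y: "y < 1"
    have "\<exists>b\<in>\<Theta>. a < b" if a: "a \<in> \<Theta>" for a
    proof -
      obtain n where n: "a \<in> A n" using A(3) a by blast
      have "A n \<in> left_hypotheses \<Theta>" using A(1) by blast
      then show ?thesis using left_hypothesesD(4,5) n by blast
    qed
    then obtain x where x: "x \<in> \<Theta>" "\<And>B. B \<in> left_hypotheses \<Theta> \<Longrightarrow> x \<in> B \<Longrightarrow> y < q B"
      using top[of "1 - y"] y by auto
    have "A n \<in> left_hypotheses \<Theta>" for n using A(1) by blast
    moreover have "eventually (\<lambda>n. x \<in> A n) sequentially"
      using inc_ev[OF A(2)] A(3) x(1) by blast
    ultimately show "eventually (\<lambda>n. y < q (A n)) sequentially"
      using x(2) by (simp add: eventually_mono)
  next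
    fix y :: real assume "1 < y"
    moreover have "q (A n) \<le> 1" for n using q01[of "A n"] A(1) by auto
    ultimately have "q (A n) < y" for n by (meson le_less_trans)
    then show "eventually (\<lambda>n. q (A n) < y) sequentially" by simp
  qed
  have empty: "(\<lambda>n. q (A n)) \<longlonglongrightarrow> 0"
    if A: "range A \<subseteq> left_hypotheses \<Theta>" "decseq A" "(\<Inter>n. A n) = {}" for A
  proof (rule order_tendstoI)
    fix y :: real assume y: "0 < y"
    have "\<exists>b\<in>\<Theta>. b < a" if a: "a \<in> \<Theta>" for a
    proof -
      obtain n where n: "a \<notin> A n" using A(3) by blast
      have "A n \<in> left_hypotheses \<Theta>" using A(1) by blast
      then show ?thesis using left_hypothesesD(2,3,5) n a by blast
    qed
    then obtain x where x: "x \<in> \<Theta>" "\<And>B. B \<in> left_hypotheses \<Theta> \<Longrightarrow> B \<subseteq> {..<x} \<Longrightarrow> q B < y"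
      using bot[of y] y by auto
    have "A n \<in> left_hypotheses \<Theta>" for n using A(1) by blast
    moreover have "eventually (\<lambda>n. A n \<subseteq> {..<x}) sequentially"
      using dec_ev[OF A(1,2) x(1)] A(3) by blast
    ultimately show "eventually (\<lambda>n. q (A n) < y) sequentially"
      using x(2) by (simp add: eventually_mono)
  next
    fix y :: real assume "y < 0"
    moreover have "0 \<le> q (A n)" for n using q01[of "A n"] A(1) by auto
    ultimately have "y < q (A n)" for n by (meson less_le_trans)
    then show "eventually (\<lambda>n. y < q (A n)) sequentially" by simp
  qed
  have both: "(\<lambda>n. q (A n)) \<longlonglongrightarrow> q C \<and> (\<lambda>n. q (B n)) \<longlonglongrightarrow> q C"
    if A: "range A \<subseteq> left_hypotheses \<Theta>" "incseq A" "(\<Union>n. A n) = C"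
      and B: "range B \<subseteq> left_hypotheses \<Theta>" "decseq B" "(\<Inter>n. B n) = C" for A B C
  proof -
    have A': "A n \<in> left_hypotheses \<Theta>" "A n \<subseteq> C" and B': "B n \<in> left_hypotheses \<Theta>" "C \<subseteq> B n" for n
      using A(1,3) B(1,3) by (simp_all add: image_subset_iff) blast+
    \<comment> \<open>The common limit is squeezed between a term of each sequence, hence nonempty
      and proper.\<close>
    have C: "C \<in> left_hypotheses \<Theta>"
    proof (rule left_hypothesesI)
      show "C \<subseteq> \<Theta>" "C \<noteq> {}" "C \<noteq> \<Theta>"
        using A'(2)[of 0] B'(2)[of 0] left_hypothesesD(2,4)[OF B'(1)[of 0]]
          left_hypothesesD(3)[OF A'(1)[of 0]] by auto
      show "y \<in> C" if "x \<in> C" "y \<in> \<Theta>" "y \<le> x" for x y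
        using that A(3) left_hypothesesD(6)[OF A'(1)] by blast
    qed
    have le: "q (A n) \<le> q C" and ge: "q C \<le> q (B n)" for n
      using mono A' B' C by auto
    have "eventually (\<lambda>n. q C - e < q (A n)) sequentially \<and> eventually (\<lambda>n. q (B n) < q C + e) sequentially"
      if e: "0 < e" for e
      using int C
    proof (cases rule: left_hypotheses_cases)
      case (atMost a b)
      have "C \<subseteq> A n" if "a \<in> A n" for n
        using left_hypothesesD(6)[OF A'(1) that] atMost(4) by auto
      then have "A n = C" if "a \<in> A n" for n using A'(2)[of n] that by auto
      moreover have "eventually (\<lambda>n. a \<in> A n) sequentially"
        using A(2,3) atMost(1,4) by (intro inc_ev) auto
      ultimately have "eventually (\<lambda>n. q C - e < q (A n)) sequentially"
        using e by (simp add: eventually_mono)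
      moreover obtain x where x: "x \<in> \<Theta>" "a < x"
        "\<And>B. B \<in> left_hypotheses \<Theta> \<Longrightarrow> B \<subseteq> {..<x} \<Longrightarrow> q B < q C + e"
        using right[OF atMost(1-3) e] atMost(4) by auto
      moreover have "eventually (\<lambda>n. B n \<subseteq> {..<x}) sequentially"
        using B x(1,2) atMost(4) by (intro dec_ev) auto
      ultimately show ?thesis using B'(1) by (simp add: eventually_mono)
    next
      case (lessThan a b)
      have "B n \<subseteq> C" if "B n \<subseteq> {..<a}" for n
        using left_hypothesesD(2)[OF B'(1)] that lessThan(4) by auto
      then have "B n = C" if "B n \<subseteq> {..<a}" for n using B'(2)[of n] that by auto
      moreover have "eventually (\<lambda>n. B n \<subseteq> {..<a}) sequentially"
        using B lessThan(1,4) by (intro dec_ev) auto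
      ultimately have "eventually (\<lambda>n. q (B n) < q C + e) sequentially"
        using e by (simp add: eventually_mono)
      moreover obtain x where x: "x \<in> \<Theta>" "x < a"
        "\<And>B. B \<in> left_hypotheses \<Theta> \<Longrightarrow> x \<in> B \<Longrightarrow> q C - e < q B"
        using left[OF lessThan(1-3) e] lessThan(4) by auto
      moreover have "eventually (\<lambda>n. x \<in> A n) sequentially"
        using A x(1,2) lessThan(4) by (intro inc_ev) auto
      ultimately show ?thesis using A'(1) by (simp add: eventually_mono)
    qed
    note ev = this
    show ?thesis
    proof (intro conjI order_tendstoI)
      fix y
      show "eventually (\<lambda>n. y < q (A n)) sequentially" if "y < q C"
        using ev[of "q C - y"] that by simp
      show "eventually (\<lambda>n. q (B n) < y) sequentially" if "q C < y"
        using ev[of "y - q C"] that by simp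
      show "eventually (\<lambda>n. q (A n) < y) sequentially" if "q C < y"
        using le_less_trans[OF le that] by simp
      show "eventually (\<lambda>n. y < q (B n)) sequentially" if "y < q C"
        using less_le_trans[OF that ge] by simp
    qed
  qed
  show ?thesis
    unfolding compatible_at_def
  proof (intro conjI ballI allI impI)
    fix A B :: "nat \<Rightarrow> real set"
    assume AB: "range A \<subseteq> left_hypotheses \<Theta> \<and> range B \<subseteq> left_hypotheses \<Theta> \<and>
      incseq A \<and> decseq B \<and> (\<Union>n. A n) = (\<Inter>n. B n)"
    show "\<exists>l. (\<lambda>n. q (A n)) \<longlonglongrightarrow> l \<and> (\<lambda>n. q (B n)) \<longlonglongrightarrow> l"
      by (rule exI[where x = "q (\<Inter>n. B n)"], rule both) (use AB in simp_all)
  qed (use mono full empty in simp_all)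
qed

section \<open>The vote curve at a value of the statistic\<close>

text \<open>The shift by 2 makes even the term \<open>n = 0\<close> divide by more than 1, so that
  for \<open>c = b - a\<close> all terms lie strictly between \<open>a\<close> and
  \<open>b\<close>.\<close>

lemma tendsto_add_divide: "(\<lambda>n. a + c / (real n + 2)) \<longlonglongrightarrow> a" for a c :: real
proof -
  have "(\<lambda>n. a + c * inverse (real (Suc (n + 1)))) \<longlonglongrightarrow> a + c * 0"
    by (intro tendsto_intros LIMSEQ_ignore_initial_segment[OF LIMSEQ_inverse_real_of_nat])
  then show ?thesis by (simp add: divide_inverse add.commute)
qed

text \<open>What is retained of the model at one value of the statistic. The point
  \<open>\<theta>0\<close> stands for a parameter whose density is positive there; it prevents a
  hypothesis from lying in \<open>\<Sigma>\<close> while its complement lies in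
  \<open>\<I>\<close>.\<close>

locale vote_curve =
  fixes \<Theta> :: "real set" and F :: "real \<Rightarrow> real" and \<Sigma> \<I> :: "real set" and \<theta>0 :: real
  assumes int: "is_interval \<Theta>"
    and mono_F: "\<And>x y. x \<in> \<Theta> \<Longrightarrow> y \<in> \<Theta> \<Longrightarrow> x \<le> y \<Longrightarrow> F x \<le> F y"
    and F01: "\<And>x. x \<in> \<Theta> \<Longrightarrow> 0 \<le> F x \<and> F x \<le> 1"
    and F_\<Sigma>: "\<And>x. x \<in> \<Theta> \<Longrightarrow> x \<in> \<Sigma> \<Longrightarrow> F x = 0"
    and F_\<I>: "\<And>x. x \<in> \<Theta> \<Longrightarrow> x \<in> \<I> \<Longrightarrow> F x = 1"
    and \<theta>0: "\<theta>0 \<in> \<Theta>" "\<theta>0 \<notin> \<Sigma>" "\<theta>0 \<notin> \<I>"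
begin

text \<open>The case \<open>A \<subseteq> \<Sigma>\<close>, in which every vote is 0, is absorbed by
  the supremum because \<open>F\<close> vanishes on \<open>\<Sigma>\<close>.\<close>

definition q1 :: "real set \<Rightarrow> real" where
  "q1 A = (if \<Theta> - A \<subseteq> \<I> then 1 else SUP \<theta>\<in>A. F \<theta>)"

text \<open>The infimum of \<open>F\<close> over the complement, written in the shape of
  \<open>votes_Q0\<close>; it is 1 by itself when the complement lies in
  \<open>\<I>\<close>.\<close>

definition q0 :: "real set \<Rightarrow> real" where
  "q0 A = (if A \<subseteq> \<Sigma> then 0 else 1 - (SUP \<theta>\<in>\<Theta> - A. 1 - F \<theta>))"

text \<open>Since \<open>F\<close> is monotone, one point with a close enough value settles each
  limit. A parameter \<open>b\<close> above \<open>a\<close> and outside \<open>\<I>\<close>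
  expresses that the value of the statistic avoids the null lower half-line of the parameters above
  \<open>a\<close>; likewise below \<open>a\<close> with \<open>\<Sigma>\<close>.\<close>

definition regular :: bool where
  "regular \<longleftrightarrow>
     (\<forall>a\<in>\<Theta>. \<forall>b\<in>\<Theta>. a < b \<and> b \<notin> \<I> \<longrightarrow> (\<forall>e>0. \<exists>x\<in>\<Theta>. a < x \<and> F x < F a + e)) \<and>
     (\<forall>a\<in>\<Theta>. \<forall>b\<in>\<Theta>. b < a \<and> b \<notin> \<Sigma> \<longrightarrow> (\<forall>e>0. \<exists>x\<in>\<Theta>. x < a \<and> F a - e < F x)) \<and>
     ((\<forall>a\<in>\<Theta>. \<exists>b\<in>\<Theta>. b < a) \<longrightarrow> (\<forall>e>0. \<exists>x\<in>\<Theta>. F x < e)) \<and>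
     ((\<forall>a\<in>\<Theta>. \<exists>b\<in>\<Theta>. a < b) \<longrightarrow> (\<forall>e>0. \<exists>x\<in>\<Theta>. 1 - e < F x))"

lemma regularD:
  assumes regular
  shows "\<And>a b e. a \<in> \<Theta> \<Longrightarrow> b \<in> \<Theta> \<Longrightarrow> a < b \<Longrightarrow> b \<notin> \<I> \<Longrightarrow> 0 < e \<Longrightarrow> \<exists>x\<in>\<Theta>. a < x \<and> F x < F a + e"
    and "\<And>a b e. a \<in> \<Theta> \<Longrightarrow> b \<in> \<Theta> \<Longrightarrow> b < a \<Longrightarrow> b \<notin> \<Sigma> \<Longrightarrow> 0 < e \<Longrightarrow> \<exists>x\<in>\<Theta>. x < a \<and> F a - e < F x"
    and "\<And>e. (\<forall>a\<in>\<Theta>. \<exists>b\<in>\<Theta>. b < a) \<Longrightarrow> 0 < e \<Longrightarrow> \<exists>x\<in>\<Theta>. F x < e"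
    and "\<And>e. (\<forall>a\<in>\<Theta>. \<exists>b\<in>\<Theta>. a < b) \<Longrightarrow> 0 < e \<Longrightarrow> \<exists>x\<in>\<Theta>. 1 - e < F x"
proof -
  note r = assms[unfolded regular_def]
  show "\<exists>x\<in>\<Theta>. a < x \<and> F x < F a + e" if "a \<in> \<Theta>" "b \<in> \<Theta>" "a < b" "b \<notin> \<I>" "0 < e" for a b e
    using r[THEN conjunct1, rule_format, of a b e] that by simp
  show "\<exists>x\<in>\<Theta>. x < a \<and> F a - e < F x" if "a \<in> \<Theta>" "b \<in> \<Theta>" "b < a" "b \<notin> \<Sigma>" "0 < e" for a b e
    using r[THEN conjunct2, THEN conjunct1, rule_format, of a b e] that by simp
  show "\<exists>x\<in>\<Theta>. F x < e" if "\<forall>a\<in>\<Theta>. \<exists>b\<in>\<Theta>. b < a" "0 < e" for e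
    using r[THEN conjunct2, THEN conjunct2, THEN conjunct1] that by simp
  show "\<exists>x\<in>\<Theta>. 1 - e < F x" if "\<forall>a\<in>\<Theta>. \<exists>b\<in>\<Theta>. a < b" "0 < e" for e
    using r[THEN conjunct2, THEN conjunct2, THEN conjunct2] that by simp
qed

lemma F_le_SUP: "A \<subseteq> \<Theta> \<Longrightarrow> x \<in> A \<Longrightarrow> F x \<le> (SUP \<theta>\<in>A. F \<theta>)"
  by (intro cSUP_upper bdd_aboveI[where M = 1]) (use F01 in auto)

lemma SUP_F_le: "A \<noteq> {} \<Longrightarrow> (\<And>x. x \<in> A \<Longrightarrow> F x \<le> c) \<Longrightarrow> (SUP \<theta>\<in>A. F \<theta>) \<le> c"
  by (intro cSUP_least)

lemma INF_le_F: "B \<subseteq> \<Theta> \<Longrightarrow> x \<in> B \<Longrightarrow> 1 - (SUP \<theta>\<in>B. 1 - F \<theta>) \<le> F x"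
  using cSUP_upper[of x B "\<lambda>\<theta>. 1 - F \<theta>"] bdd_aboveI[where M = 1 and A = "(\<lambda>\<theta>. 1 - F \<theta>) ` B"] F01
  by force

lemma le_INF_F: "B \<noteq> {} \<Longrightarrow> (\<And>x. x \<in> B \<Longrightarrow> c \<le> F x) \<Longrightarrow> c \<le> 1 - (SUP \<theta>\<in>B. 1 - F \<theta>)"
  using cSUP_least[of B "\<lambda>\<theta>. 1 - F \<theta>" "1 - c"] by force

lemma F_le_q1: "A \<in> left_hypotheses \<Theta> \<Longrightarrow> x \<in> A \<Longrightarrow> F x \<le> q1 A"
  unfolding q1_def using F_le_SUP[of A x] F01[of x] left_hypothesesD(2)[of A \<Theta>] by auto

lemma q1_le: "\<lbrakk>A \<in> left_hypotheses \<Theta>; b \<in> \<Theta> - A; b \<notin> \<I>; \<And>x. x \<in> A \<Longrightarrow> F x \<le> c\<rbrakk> \<Longrightarrow> q1 A \<le> c"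
  unfolding q1_def using SUP_F_le[of A c] left_hypothesesD(3)[of A \<Theta>] by auto

lemma q0_le_F: "A \<in> left_hypotheses \<Theta> \<Longrightarrow> x \<in> \<Theta> - A \<Longrightarrow> q0 A \<le> F x"
  unfolding q0_def using INF_le_F[of "\<Theta> - A" x] F01[of x] by auto

lemma le_q0: "\<lbrakk>A \<in> left_hypotheses \<Theta>; b \<in> A; b \<notin> \<Sigma>; \<And>x. x \<in> \<Theta> - A \<Longrightarrow> c \<le> F x\<rbrakk> \<Longrightarrow> c \<le> q0 A"
  unfolding q0_def using le_INF_F[of "\<Theta> - A" c] left_hypothesesD(4)[of A \<Theta>] by auto

lemma not_both_null:
  assumes "A \<subseteq> \<Sigma>" "\<Theta> - A \<subseteq> \<I>" shows False
  using assms \<theta>0 by blast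

lemma q1_bounds:
  assumes A: "A \<in> left_hypotheses \<Theta>" shows "q1 A \<in> {0..1}"
proof -
  obtain x where "x \<in> A" using left_hypothesesD(3)[OF A] by blast
  then have "0 \<le> q1 A" using F_le_q1[OF A] F01[of x] left_hypothesesD(2)[OF A] by fastforce
  moreover have "q1 A \<le> 1"
    unfolding q1_def using SUP_F_le[OF left_hypothesesD(3)[OF A], of 1] F01 left_hypothesesD(2)[OF A]
    by auto
  ultimately show ?thesis by simp
qed

lemma q1_mono:
  assumes A: "A \<in> left_hypotheses \<Theta>" and B: "B \<in> left_hypotheses \<Theta>" and "A \<subseteq> B"
  shows "q1 A \<le> q1 B"
proof (cases "\<Theta> - B \<subseteq> \<I>")
  case True
  then show ?thesis using q1_bounds[OF A] by (simp add: q1_def)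
next
  case False
  then obtain b where "b \<in> \<Theta> - A" "b \<notin> \<I>" using assms(3) by blast
  then show ?thesis by (rule q1_le[OF A]) (use F_le_q1[OF B] assms(3) in auto)
qed

text \<open>Only a jump of \<open>F\<close> at the cut can separate the supremum over
  \<open>A\<close> from the infimum over the complement. Right continuity at the end point excludes
  it if the end point belongs to \<open>A\<close>, left continuity if it does not. When a convention
  applies, the other vote takes the same value because \<open>F\<close> is constantly 0 on
  \<open>\<Sigma>\<close> and 1 on \<open>\<I>\<close>.\<close>

lemma q1_eq_q0:
  assumes reg: regular and A: "A \<in> left_hypotheses \<Theta>"
  shows "q1 A = q0 A"
proof (cases "A \<subseteq> \<Sigma> \<or> \<Theta> - A \<subseteq> \<I>")
  case True
  have "q0 A = 1" if null: "\<Theta> - A \<subseteq> \<I>"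
  proof (rule antisym)
    obtain y where y: "y \<in> \<Theta> - A" using left_hypothesesD(4)[OF A] by blast
    then show "q0 A \<le> 1" using q0_le_F[OF A y] F01[of y] by auto
    obtain b where "b \<in> A" "b \<notin> \<Sigma>" using not_both_null[OF _ null] by auto
    moreover have "1 \<le> F x" if "x \<in> \<Theta> - A" for x using F_\<I>[of x] null that by auto
    ultimately show "1 \<le> q0 A" by (rule le_q0[OF A])
  qed
  moreover have "q1 A = 0" if null: "A \<subseteq> \<Sigma>"
  proof (rule antisym)
    obtain b where "b \<in> \<Theta> - A" "b \<notin> \<I>" using not_both_null[OF null] by auto
    moreover have "F x \<le> 0" if "x \<in> A" for x
    proof -
      have "x \<in> \<Theta>" "x \<in> \<Sigma>" using null that left_hypothesesD(2)[OF A] by blast+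
      then show ?thesis using F_\<Sigma> by simp
    qed
    ultimately show "q1 A \<le> 0" by (rule q1_le[OF A])
  qed (use q1_bounds[OF A] in simp)
  moreover have "q0 A = 0" if "A \<subseteq> \<Sigma>" using that by (simp add: q0_def)
  moreover have "q1 A = 1" if "\<Theta> - A \<subseteq> \<I>" using that by (simp add: q1_def)
  ultimately show ?thesis using True by argo
next
  case False
  then obtain s i where s: "s \<in> A" "s \<notin> \<Sigma>" and i: "i \<in> \<Theta> - A" "i \<notin> \<I>" by blast
  have "q1 A \<le> q0 A"
  proof (rule q1_le[OF A i], rule le_q0[OF A s])
    fix x y assume "x \<in> A" "y \<in> \<Theta> - A"
    then show "F x \<le> F y"
      using left_hypothesesD(5)[OF A, of x y] left_hypothesesD(2)[OF A] by (intro mono_F) auto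
  qed
  moreover have "q0 A < q1 A + e" if e: "0 < e" for e
    using int A
  proof (cases rule: left_hypotheses_cases)
    case (atMost a b)
    have "i \<in> \<Theta>" "a < i" using i(1) atMost(4) by auto
    from regularD(1)[OF reg atMost(1) this i(2) e]
    obtain x where "x \<in> \<Theta>" "a < x" "F x < F a + e" by blast
    then show ?thesis using q0_le_F[OF A, of x] F_le_q1[OF A, of a] atMost(1,4) by auto
  next
    case (lessThan a b)
    have "s \<in> \<Theta>" "s < a" using s(1) lessThan(4) by auto
    from regularD(2)[OF reg lessThan(1) this s(2) e]
    obtain x where "x \<in> \<Theta>" "x < a" "F a - e < F x" by blast
    then show ?thesis using q0_le_F[OF A, of a] F_le_q1[OF A, of x] lessThan(1,4) by auto
  qed
  then have "q0 A \<le> q1 A" by (rule field_le_epsilon[OF less_imp_le])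
  ultimately show ?thesis by simp
qed

lemma regular_compatible:
  assumes reg: regular shows "compatible_at \<Theta> q1"
proof (rule compatible_atI[OF int q1_mono q1_bounds])
  fix a b e :: real assume ab: "a \<in> \<Theta>" "b \<in> \<Theta>" "a < b" and e: "0 < e"
  have C: "\<Theta> \<inter> {..a} \<in> left_hypotheses \<Theta>"
    using ab by (intro left_hypotheses_atMost) auto
  show "\<exists>x\<in>\<Theta>. a < x \<and> (\<forall>B\<in>left_hypotheses \<Theta>. B \<subseteq> {..<x} \<longrightarrow> q1 B < q1 (\<Theta> \<inter> {..a}) + e)"
  proof (cases "\<Theta> - (\<Theta> \<inter> {..a}) \<subseteq> \<I>")
    case True
    then have "q1 (\<Theta> \<inter> {..a}) = 1" by (simp add: q1_def)
    moreover have "q1 B < 1 + e" if "B \<in> left_hypotheses \<Theta>" for B using q1_bounds[OF that] e by simp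
    ultimately show ?thesis using ab(2,3) by (intro bexI[of _ b]) auto
  next
    case False
    then obtain c where "c \<in> \<Theta> - \<Theta> \<inter> {..a}" and "c \<notin> \<I>" by blast
    then have c: "c \<in> \<Theta>" "a < c" "c \<notin> \<I>" by auto
    obtain x where x: "x \<in> \<Theta>" "a < x" "F x < F a + e"
      using regularD(1)[OF reg ab(1) c e] by blast
    \<comment> \<open>Staying below \<open>c\<close> keeps \<open>c\<close> in the complement of
      \<open>B\<close>, so that \<open>q1 B\<close> is a genuine supremum; staying below
      \<open>x\<close> bounds that supremum by \<open>F x\<close>.\<close>
    have "q1 B < q1 (\<Theta> \<inter> {..a}) + e" if B: "B \<in> left_hypotheses \<Theta>" "B \<subseteq> {..<min x c}" for B
    proof -
      have "q1 B \<le> F x"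
        by (rule q1_le[OF B(1), of c])
          (use B(2) c x left_hypothesesD(2)[OF B(1)] in \<open>auto intro!: mono_F\<close>)
      then show ?thesis using x(3) F_le_q1[OF C, of a] ab(1) by simp
    qed
    then show ?thesis using x c by (intro bexI[of _ "min x c"]) (auto simp: min_def)
  qed
next
  fix a b e :: real assume ab: "a \<in> \<Theta>" "b \<in> \<Theta>" "b < a" and e: "0 < e"
  have C: "\<Theta> \<inter> {..<a} \<in> left_hypotheses \<Theta>"
    using ab by (intro left_hypotheses_lessThan) auto
  \<comment> \<open>The left clause is read off \<open>q0\<close>, whose value at the open section
    is at most \<open>F a\<close>, and then carried over to \<open>q1\<close> by the equality of the
    votes under regularity.\<close>
  have "\<exists>x\<in>\<Theta>. x < a \<and> (\<forall>B\<in>left_hypotheses \<Theta>. x \<in> B \<longrightarrow> q0 (\<Theta> \<inter> {..<a}) - e < q0 B)"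
  proof (cases "\<Theta> \<inter> {..<a} \<subseteq> \<Sigma>")
    case True
    then have "q0 (\<Theta> \<inter> {..<a}) = 0" by (simp add: q0_def)
    moreover have "- e < q0 B" if "B \<in> left_hypotheses \<Theta>" for B
      using q1_bounds[OF that] q1_eq_q0[OF reg that] e by simp
    ultimately show ?thesis using ab(2,3) by (intro bexI[of _ b]) auto
  next
    case False
    then obtain c where "c \<in> \<Theta> \<inter> {..<a}" and "c \<notin> \<Sigma>" by blast
    then have c: "c \<in> \<Theta>" "c < a" "c \<notin> \<Sigma>" by auto
    obtain x where x: "x \<in> \<Theta>" "x < a" "F a - e < F x"
      using regularD(2)[OF reg ab(1) c e] by blast
    have "q0 (\<Theta> \<inter> {..<a}) - e < q0 B" if B: "B \<in> left_hypotheses \<Theta>" "max x c \<in> B" for B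
    proof -
      note D = left_hypothesesD(6)[OF B]
      have "F x \<le> q0 B"
      proof (rule le_q0[OF B(1), of c])
        show "c \<in> B" using D[of c] c by simp
        show "F x \<le> F y" if "y \<in> \<Theta> - B" for y
          using left_hypothesesD(5)[OF B that] that x(1) by (intro mono_F) auto
      qed (rule c(3))
      then show ?thesis using x(3) q0_le_F[OF C, of a] ab(1) by simp
    qed
    then show ?thesis using x c by (intro bexI[of _ "max x c"]) (auto simp: max_def)
  qed
  then show "\<exists>x\<in>\<Theta>. x < a \<and> (\<forall>B\<in>left_hypotheses \<Theta>. x \<in> B \<longrightarrow> q1 (\<Theta> \<inter> {..<a}) - e < q1 B)"
    using q1_eq_q0[OF reg] C by auto
next
  fix e :: real assume "\<forall>a\<in>\<Theta>. \<exists>b\<in>\<Theta>. b < a" and e: "0 < e"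
  then obtain x where x: "x \<in> \<Theta>" "F x < e" using regularD(3)[OF reg] by blast
  \<comment> \<open>Here \<open>\<theta>0\<close> is the parameter outside \<open>\<I>\<close> that
    remains in the complement of \<open>B\<close>.\<close>
  have "q1 B < e" if B: "B \<in> left_hypotheses \<Theta>" "B \<subseteq> {..<min x \<theta>0}" for B
  proof -
    have "q1 B \<le> F x"
      by (rule q1_le[OF B(1), of \<theta>0])
        (use B(2) \<theta>0 x left_hypothesesD(2)[OF B(1)] in \<open>auto intro!: mono_F\<close>)
    then show ?thesis using x(2) by simp
  qed
  then show "\<exists>x\<in>\<Theta>. \<forall>B\<in>left_hypotheses \<Theta>. B \<subseteq> {..<x} \<longrightarrow> q1 B < e"
    using x \<theta>0 by (intro bexI[of _ "min x \<theta>0"]) (auto simp: min_def)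
next
  fix e :: real assume "\<forall>a\<in>\<Theta>. \<exists>b\<in>\<Theta>. a < b" and e: "0 < e"
  then obtain x where x: "x \<in> \<Theta>" "1 - e < F x" using regularD(4)[OF reg] by blast
  have "1 - e < q1 B" if "B \<in> left_hypotheses \<Theta>" "x \<in> B" for B
    using F_le_q1[OF that] x by simp
  then show "\<exists>x\<in>\<Theta>. \<forall>B\<in>left_hypotheses \<Theta>. x \<in> B \<longrightarrow> 1 - e < q1 B"
    using x by blast
qed

lemma regular_compatible0:
  assumes reg: regular shows "compatible_at \<Theta> q0"
  using q1_eq_q0[OF reg] regular_compatible[OF reg] by (rule compatible_at_cong)

section \<open>From compatibility back to regularity, by test sequences of hypotheses\<close>

lemma coinitial_sequence:
  assumes "\<forall>a\<in>\<Theta>. \<exists>b\<in>\<Theta>. b < a"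
  shows "\<exists>x :: nat \<Rightarrow> real. (\<forall>n. x n \<in> \<Theta>) \<and> decseq x \<and> (\<forall>y\<in>\<Theta>. \<exists>n. x n < y)"
proof -
  \<comment> \<open>Taking the infimum in the extended reals makes bounded and unbounded
    \<open>\<Theta>\<close> one case; as there is no least parameter, the sequence passes below each
    of them.\<close>
  obtain f :: "nat \<Rightarrow> ereal" where f: "decseq f" "range f \<subseteq> ereal ` \<Theta>" "Inf (ereal ` \<Theta>) = (INF i. f i)"
    using Inf_countable_INF[of "ereal ` \<Theta>"] \<theta>0(1) by auto
  have "\<forall>n. \<exists>r. r \<in> \<Theta> \<and> f n = ereal r" using f(2) by (auto simp: image_subset_iff)
  from choice[OF this] obtain x where "\<forall>n. x n \<in> \<Theta> \<and> f n = ereal (x n)" ..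
  then have x: "x n \<in> \<Theta>" "f n = ereal (x n)" for n by simp_all
  have "x n \<le> x m" if "m \<le> n" for m n
    using decseqD[OF f(1) that] x(2)[of m] x(2)[of n] by simp
  then have "decseq x" unfolding decseq_def by blast
  moreover have "\<exists>n. x n < y" if y: "y \<in> \<Theta>" for y
  proof -
    obtain z where z: "z \<in> \<Theta>" "z < y" using assms y by blast
    have "Inf (ereal ` \<Theta>) \<le> ereal z" using z(1) by (intro Inf_lower) simp
    also have "\<dots> < ereal y" using z(2) by simp
    finally show ?thesis unfolding f(3) by (simp add: INF_less_iff x(2))
  qed
  ultimately show ?thesis using x(1) by (intro exI[of _ x] conjI allI ballI)
qed

lemma cofinal_sequence:
  assumes "\<forall>a\<in>\<Theta>. \<exists>b\<in>\<Theta>. a < b"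
  shows "\<exists>x :: nat \<Rightarrow> real. (\<forall>n. x n \<in> \<Theta>) \<and> incseq x \<and> (\<forall>y\<in>\<Theta>. \<exists>n. y < x n)"
proof -
  obtain f :: "nat \<Rightarrow> ereal" where f: "incseq f" "range f \<subseteq> ereal ` \<Theta>" "Sup (ereal ` \<Theta>) = (SUP i. f i)"
    using Sup_countable_SUP[of "ereal ` \<Theta>"] \<theta>0(1) by auto
  have "\<forall>n. \<exists>r. r \<in> \<Theta> \<and> f n = ereal r" using f(2) by (auto simp: image_subset_iff)
  from choice[OF this] obtain x where "\<forall>n. x n \<in> \<Theta> \<and> f n = ereal (x n)" ..
  then have x: "x n \<in> \<Theta>" "f n = ereal (x n)" for n by simp_all
  have "x m \<le> x n" if "m \<le> n" for m n
    using incseqD[OF f(1) that] x(2)[of m] x(2)[of n] by simp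
  then have "incseq x" unfolding incseq_def by blast
  moreover have "\<exists>n. y < x n" if y: "y \<in> \<Theta>" for y
  proof -
    obtain z where z: "z \<in> \<Theta>" "y < z" using assms y by blast
    have "ereal y < ereal z" using z(2) by simp
    also have "\<dots> \<le> Sup (ereal ` \<Theta>)" using z(1) by (intro Sup_upper) simp
    finally show ?thesis unfolding f(3) by (simp add: less_SUP_iff x(2))
  qed
  ultimately show ?thesis using x(1) by (intro exI[of _ x] conjI allI ballI)
qed

text \<open>Each clause tests one vote on one sequence of sections. To the right of
  \<open>a\<close>, closed sections decrease to the one ending at \<open>a\<close>; there
  \<open>q1\<close> is at most \<open>F a\<close>, no convention interfering because
  \<open>b \<notin> \<I>\<close>, while \<open>F (x n)\<close> never exceeds
  \<open>q1 (B n)\<close>. To the left, open sections and \<open>q0\<close> play the dual part. At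
  the lower end \<open>q1\<close> tends to 0 and dominates \<open>F\<close> on each section; at the
  upper end \<open>q0\<close> tends to 1 and is dominated by \<open>F\<close> on each
  complement.\<close>

lemma compatible_regular:
  assumes c1: "compatible_at \<Theta> q1" and c0: "compatible_at \<Theta> q0"
  shows regular
  unfolding regular_def
proof (intro conjI ballI impI allI)
  fix a b e :: real assume ab: "a \<in> \<Theta>" "b \<in> \<Theta>" "a < b \<and> b \<notin> \<I>" and e: "0 < e"
  define x where "x = (\<lambda>n. a + (b - a) / (real n + 2))"
  have lim: "x \<longlonglongrightarrow> a" unfolding x_def by (rule tendsto_add_divide)
  have xab: "a < x n" "x n < b" for n
  proof -
    define d where "d = (b - a) / (real n + 2)"
    have "d < (b - a) / 1" unfolding d_def using ab(3) by (intro divide_strict_left_mono) auto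
    moreover have "0 < d" unfolding d_def using ab(3) by simp
    moreover have "x n = a + d" by (simp add: x_def d_def)
    ultimately show "a < x n" "x n < b" by simp_all
  qed
  have x\<Theta>: "x n \<in> \<Theta>" for n
    using mem_is_interval_1_I[OF int ab(1,2), of "x n"] xab[of n] by simp
  define B where "B = (\<lambda>n. \<Theta> \<inter> {..x n})"
  have C: "\<Theta> \<inter> {..a} \<in> left_hypotheses \<Theta>" and B: "B n \<in> left_hypotheses \<Theta>" for n
    unfolding B_def using ab xab[of n] by (auto intro: left_hypotheses_atMost)
  have "decseq x" unfolding x_def decseq_def using ab(3) by (auto intro!: divide_left_mono)
  then have "B n \<subseteq> B m" if "m \<le> n" for m n
    using decseqD[of x m n] that unfolding B_def by auto
  then have "decseq B" unfolding decseq_def by blast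
  moreover have "(\<Inter>n. B n) = \<Theta> \<inter> {..a}"
  proof -
    have "y \<le> a" if "\<And>n. y \<le> x n" for y using that lim by (meson LIMSEQ_le_const)
    moreover have "y \<le> x n" if "y \<le> a" for y n using that xab(1)[of n] by simp
    ultimately show ?thesis unfolding B_def by blast
  qed
  ultimately have lim1: "(\<lambda>n. q1 (B n)) \<longlonglongrightarrow> q1 (\<Theta> \<inter> {..a})"
    using compatible_at_decseq[OF c1, of B] B C by (simp add: image_subset_iff)
  have "q1 (\<Theta> \<inter> {..a}) \<le> F a"
    by (rule q1_le[OF C, of b]) (use ab in \<open>auto intro: mono_F\<close>)
  then obtain n where "q1 (B n) < F a + e"
    using eventually_happens'[OF sequentially_bot order_tendstoD(2)[OF lim1, of "F a + e"]] e by auto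
  then have "F (x n) < F a + e" using F_le_q1[OF B[of n], of "x n"] x\<Theta> by (auto simp: B_def)
  then show "\<exists>x\<in>\<Theta>. a < x \<and> F x < F a + e" using x\<Theta> xab(1) by blast
next
  fix a b e :: real assume ab: "a \<in> \<Theta>" "b \<in> \<Theta>" "b < a \<and> b \<notin> \<Sigma>" and e: "0 < e"
  define x where "x = (\<lambda>n. a + (b - a) / (real n + 2))"
  have lim: "x \<longlonglongrightarrow> a" unfolding x_def by (rule tendsto_add_divide)
  have xab: "x n < a" "b < x n" for n
  proof -
    define d where "d = (a - b) / (real n + 2)"
    have "d < (a - b) / 1" unfolding d_def using ab(3) by (intro divide_strict_left_mono) auto
    moreover have "0 < d" unfolding d_def using ab(3) by simp
    moreover have "x n = a - d" by (simp add: x_def d_def diff_divide_distrib)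
    ultimately show "x n < a" "b < x n" by simp_all
  qed
  have x\<Theta>: "x n \<in> \<Theta>" for n
    using mem_is_interval_1_I[OF int ab(2,1), of "x n"] xab[of n] by simp
  define B where "B = (\<lambda>n. \<Theta> \<inter> {..<x n})"
  have C: "\<Theta> \<inter> {..<a} \<in> left_hypotheses \<Theta>" and B: "B n \<in> left_hypotheses \<Theta>" for n
    unfolding B_def using ab xab[of n] by (auto intro: left_hypotheses_lessThan)
  have "incseq x" unfolding x_def incseq_def using ab(3)
    by (auto intro!: divide_left_mono_neg mult_pos_pos)
  then have "B m \<subseteq> B n" if "m \<le> n" for m n
    using incseqD[of x m n] that unfolding B_def by auto
  then have "incseq B" unfolding incseq_def by blast
  moreover have "(\<Union>n. B n) = \<Theta> \<inter> {..<a}"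
  proof -
    have "\<exists>n. y < x n" if "y < a" for y
      using eventually_happens'[OF sequentially_bot order_tendstoD(1)[OF lim that]] .
    moreover have "y < a" if "y < x n" for y n using that xab(1)[of n] by simp
    ultimately show ?thesis unfolding B_def by blast
  qed
  ultimately have lim0: "(\<lambda>n. q0 (B n)) \<longlonglongrightarrow> q0 (\<Theta> \<inter> {..<a})"
    using compatible_at_incseq[OF c0, of B] B C by (simp add: image_subset_iff)
  have "F a \<le> q0 (\<Theta> \<inter> {..<a})"
    by (rule le_q0[OF C, of b]) (use ab in \<open>auto intro: mono_F\<close>)
  then obtain n where "F a - e < q0 (B n)"
    using eventually_happens'[OF sequentially_bot order_tendstoD(1)[OF lim0, of "F a - e"]] e by auto
  then have "F a - e < F (x n)" using q0_le_F[OF B[of n], of "x n"] x\<Theta> by (auto simp: B_def)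
  then show "\<exists>x\<in>\<Theta>. x < a \<and> F a - e < F x" using x\<Theta> xab(1) by blast
next
  fix e :: real assume nl: "\<forall>a\<in>\<Theta>. \<exists>b\<in>\<Theta>. b < a" and e: "0 < e"
  obtain x where x: "\<And>n. x n \<in> \<Theta>" "decseq x" "\<And>y. y \<in> \<Theta> \<Longrightarrow> \<exists>n. x n < y"
    using coinitial_sequence[OF nl] by blast
  define B where "B = (\<lambda>n. \<Theta> \<inter> {..<x n})"
  have B: "B n \<in> left_hypotheses \<Theta>" for n
  proof -
    obtain y where y: "y \<in> \<Theta>" "y < x n" using nl x(1) by blast
    show ?thesis unfolding B_def by (rule left_hypotheses_lessThan[OF x(1) y order_refl])
  qed
  have "B n \<subseteq> B m" if "m \<le> n" for m n
    using decseqD[OF x(2) that] unfolding B_def by auto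
  then have "decseq B" unfolding decseq_def by blast
  moreover have "(\<Inter>n. B n) = {}" 
  proof (rule ccontr)
    assume "(\<Inter>n. B n) \<noteq> {}"
    then obtain y where y: "\<And>n. y \<in> B n" by blast
    from y[of 0] have "y \<in> \<Theta>" by (simp add: B_def)
    from x(3)[OF this] obtain n where "x n < y" ..
    with y[of n] show False by (simp add: B_def)
  qed
  ultimately have "(\<lambda>n. q1 (B n)) \<longlonglongrightarrow> 0"
    using compatible_at_empty[OF c1, of B] B by (simp add: image_subset_iff)
  from eventually_happens'[OF sequentially_bot order_tendstoD(2)[OF this e]]
  obtain n where n: "q1 (B n) < e" by blast
  obtain y where y: "y \<in> B n" using left_hypothesesD(3)[OF B[of n]] by blast
  then have "F y < e" using F_le_q1[OF B y] n by simp
  then show "\<exists>x\<in>\<Theta>. F x < e" using y unfolding B_def by blast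
next
  fix e :: real assume nl: "\<forall>a\<in>\<Theta>. \<exists>b\<in>\<Theta>. a < b" and e: "0 < e"
  obtain x where x: "\<And>n. x n \<in> \<Theta>" "incseq x" "\<And>y. y \<in> \<Theta> \<Longrightarrow> \<exists>n. y < x n"
    using cofinal_sequence[OF nl] by blast
  define B where "B = (\<lambda>n. \<Theta> \<inter> {..x n})"
  have B: "B n \<in> left_hypotheses \<Theta>" for n
  proof -
    obtain y where y: "y \<in> \<Theta>" "x n < y" using nl x(1) by blast
    show ?thesis unfolding B_def by (rule left_hypotheses_atMost[OF x(1) y(1) order_refl y(2)])
  qed
  have "B m \<subseteq> B n" if "m \<le> n" for m n
    using incseqD[OF x(2) that] unfolding B_def by auto
  then have "incseq B" unfolding incseq_def by blast
  moreover have "(\<Union>n. B n) = \<Theta>" 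
  proof (intro subset_antisym subsetI)
    fix y assume y: "y \<in> \<Theta>"
    from x(3)[OF y] obtain n where "y < x n" ..
    with y have "y \<in> B n" by (simp add: B_def)
    then show "y \<in> (\<Union>n. B n)" by blast
  qed (simp add: B_def)
  ultimately have "(\<lambda>n. q0 (B n)) \<longlonglongrightarrow> 1"
    using compatible_at_full[OF c0, of B] B by (simp add: image_subset_iff)
  from eventually_happens'[OF sequentially_bot order_tendstoD(1)[OF this, of "1 - e"]] e
  obtain n where n: "1 - e < q0 (B n)" by auto
  obtain y where y: "y \<in> \<Theta> - B n" using left_hypothesesD(4)[OF B[of n]] by blast
  then have "1 - e < F y" using q0_le_F[OF B y] n by simp
  then show "\<exists>x\<in>\<Theta>. 1 - e < F x" using y by blast
qed

end

section \<open>Monotone likelihood ratio and null half-lines\<close>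

text \<open>Each point chooses a rational by which it is determined, and this choice is
  injective.\<close>

lemma countable_by_rationals:
  assumes "\<And>x. x \<in> X \<Longrightarrow> \<exists>r::rat. R x r" "\<And>x y r. \<lbrakk>x \<in> X; y \<in> X; R x r; R y r\<rbrakk> \<Longrightarrow> x = y"
  shows "countable X"
proof (rule countableI')
  have "R x (SOME r. R x r)" if "x \<in> X" for x using assms(1)[OF that] by (rule someI_ex)
  then show "inj_on (\<lambda>x. SOME r. R x r) X" using assms(2) unfolding inj_on_def by metis
qed

text \<open>Rational parameters alone could miss an end point of \<open>\<Theta>\<close>. With the
  least and the greatest parameter added, if they exist, every remaining parameter has members of
  \<open>D\<close> on both sides.\<close>

lemma countable_dense_parameters:
  fixes \<Theta> :: "real set"
  assumes int: "is_interval \<Theta>"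
  obtains D where "countable D" "D \<subseteq> \<Theta>"
    "\<And>x y. \<lbrakk>x \<in> \<Theta>; y \<in> \<Theta>; x < y\<rbrakk> \<Longrightarrow> \<exists>d\<in>D. x < d \<and> d < y"
    "\<And>x. x \<in> \<Theta> - D \<Longrightarrow> (\<exists>d\<in>D. d < x) \<and> (\<exists>d\<in>D. x < d)"
proof -
  define D where "D = {d \<in> \<Theta>. d \<in> \<rat> \<or> (\<forall>y\<in>\<Theta>. d \<le> y) \<or> (\<forall>y\<in>\<Theta>. y \<le> d)}"
  have "D \<subseteq> \<rat> \<union> {Inf \<Theta>, Sup \<Theta>}"
    unfolding D_def using cInf_eq_minimum[of _ \<Theta>] cSup_eq_maximum[of _ \<Theta>] by blast
  moreover have "countable (\<rat> \<union> {Inf \<Theta>, Sup \<Theta>})" using countable_rat by simp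
  ultimately have "countable D" by (rule countable_subset)
  moreover have dense: "\<exists>d\<in>D. x < d \<and> d < y" if xy: "x \<in> \<Theta>" "y \<in> \<Theta>" "x < y" for x y
  proof -
    from Rats_dense_in_real[OF xy(3)] obtain d where d: "d \<in> \<rat>" "x < d" "d < y" by blast
    then have "d \<in> \<Theta>" using mem_is_interval_1_I[OF int xy(1,2), of d] by simp
    with d show ?thesis unfolding D_def by blast
  qed
  moreover have "(\<exists>d\<in>D. d < x) \<and> (\<exists>d\<in>D. x < d)" if x: "x \<in> \<Theta> - D" for x
  proof -
    obtain y z where "y \<in> \<Theta>" "z \<in> \<Theta>" "y < x" "x < z" using x unfolding D_def by force
    then show ?thesis using dense[of y x] dense[of x z] x by blast
  qed
  moreover have "D \<subseteq> \<Theta>" unfolding D_def by blast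
  ultimately show thesis using that by blast
qed

lemma ratio_isD:
  "\<lbrakk>ratio_is M p T a b h; \<omega> \<in> space M; p b \<omega> \<noteq> 0 \<or> p a \<omega> \<noteq> 0\<rbrakk> \<Longrightarrow>
    ennreal (p a \<omega>) / ennreal (p b \<omega>) = h (T \<omega>)"
  unfolding ratio_is_def by blast

lemma upper_half_line_atLeast: "\<lbrakk>upper_half_line D; t \<in> D\<rbrakk> \<Longrightarrow> {t..} \<subseteq> D"
  unfolding upper_half_line_def by (elim disjE exE) auto

lemma lower_half_line_atMost: "\<lbrakk>lower_half_line D; t \<in> D\<rbrakk> \<Longrightarrow> {..t} \<subseteq> D"
  unfolding lower_half_line_def by (elim disjE exE) auto

locale mlr_model =
  fixes M :: "'w measure" and p :: "real \<Rightarrow> 'w \<Rightarrow> real" and T :: "'w \<Rightarrow> real" and \<Theta> :: "real set"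
  assumes model: "statistical_model M p \<Theta>"
    and int: "is_interval \<Theta>"
    and T_meas: "T \<in> borel_measurable M"
    and mlr: "monotone_likelihood_ratio M p T \<Theta>"
begin

section \<open>Parameters whose density vanishes on one side of a value\<close>

definition null_above :: "real \<Rightarrow> real \<Rightarrow> bool" where
  "null_above \<theta> t \<longleftrightarrow> (\<forall>\<omega>\<in>space M. t \<le> T \<omega> \<longrightarrow> p \<theta> \<omega> = 0)"

definition null_below :: "real \<Rightarrow> real \<Rightarrow> bool" where
  "null_below \<theta> t \<longleftrightarrow> (\<forall>\<omega>\<in>space M. T \<omega> \<le> t \<longrightarrow> p \<theta> \<omega> = 0)"

lemma p_meas: "\<theta> \<in> \<Theta> \<Longrightarrow> p \<theta> \<in> borel_measurable M"
  and p_nonneg: "\<theta> \<in> \<Theta> \<Longrightarrow> \<omega> \<in> space M \<Longrightarrow> 0 \<le> p \<theta> \<omega>"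
  and prob_space_model: "\<theta> \<in> \<Theta> \<Longrightarrow> prob_space (model_prob M p \<theta>)"
  using model unfolding statistical_model_def model_prob_def by auto

lemma sets_model_prob [simp]: "sets (model_prob M p \<theta>) = sets M"
  and space_model_prob [simp]: "space (model_prob M p \<theta>) = space M"
  by (simp_all add: model_prob_def)

lemma emeasure_model_prob:
  "\<lbrakk>\<theta> \<in> \<Theta>; A \<in> sets M\<rbrakk> \<Longrightarrow>
    emeasure (model_prob M p \<theta>) A = (\<integral>\<^sup>+ \<omega>. ennreal (p \<theta> \<omega>) * indicator A \<omega> \<partial>M)"
  unfolding model_prob_def using p_meas by (intro emeasure_density) auto

lemma exists_positive:
  assumes "\<theta> \<in> \<Theta>" shows "\<exists>\<omega>\<in>space M. p \<theta> \<omega> \<noteq> 0"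
  using not_vanish_on_UNIV[OF model, of "{\<theta>}" T] assms unfolding vanish_on_def by auto

text \<open>At \<open>\<omega>\<close> the ratio is 0, so the increasing function \<open>h\<close>
  is 0 at all smaller values as well; a ratio that is 0 where it is defined leaves no room for a
  positive numerator. The next lemma is the dual, with the ratio infinite at all larger
  values.\<close>

lemma null_belowI:
  assumes \<theta>: "\<theta>' \<in> \<Theta>" "\<theta>'' \<in> \<Theta>" "\<theta>' < \<theta>''"
    and \<omega>: "\<omega> \<in> space M" "p \<theta>' \<omega> \<noteq> 0" "p \<theta>'' \<omega> = 0"
  shows "null_below \<theta>'' (T \<omega>)"
  unfolding null_below_def
proof (intro ballI impI)
  obtain h where h: "mono h" "ratio_is M p T \<theta>'' \<theta>' h"
    using mlr \<theta> unfolding monotone_likelihood_ratio_def by blast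
  have "h (T \<omega>) = ennreal (p \<theta>'' \<omega>) / ennreal (p \<theta>' \<omega>)"
    using ratio_isD[OF h(2) \<omega>(1)] \<omega>(2,3) by simp
  then have 0: "h (T \<omega>) = 0" using \<omega>(3) by simp
  fix \<omega>' assume \<omega>': "\<omega>' \<in> space M" "T \<omega>' \<le> T \<omega>"
  have h0: "h (T \<omega>') = 0" using monoD[OF h(1) \<omega>'(2)] 0 by simp
  show "p \<theta>'' \<omega>' = 0"
  proof (rule ccontr)
    assume nz: "p \<theta>'' \<omega>' \<noteq> 0"
    then have "ennreal (p \<theta>'' \<omega>') / ennreal (p \<theta>' \<omega>') = 0"
      using ratio_isD[OF h(2) \<omega>'(1)] h0 by simp
    then show False using nz p_nonneg[OF \<theta>(2) \<omega>'(1)] by (simp add: ennreal_eq_0_iff)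
  qed
qed

lemma null_aboveI:
  assumes \<theta>: "\<theta>' \<in> \<Theta>" "\<theta>'' \<in> \<Theta>" "\<theta>' < \<theta>''"
    and \<omega>: "\<omega> \<in> space M" "p \<theta>' \<omega> = 0" "p \<theta>'' \<omega> \<noteq> 0"
  shows "null_above \<theta>' (T \<omega>)"
  unfolding null_above_def
proof (intro ballI impI)
  obtain h where h: "mono h" "ratio_is M p T \<theta>'' \<theta>' h"
    using mlr \<theta> unfolding monotone_likelihood_ratio_def by blast
  have "h (T \<omega>) = ennreal (p \<theta>'' \<omega>) / ennreal (p \<theta>' \<omega>)"
    using ratio_isD[OF h(2) \<omega>(1)] \<omega>(2,3) by simp
  moreover have "0 < p \<theta>'' \<omega>" using \<omega>(3) p_nonneg[OF \<theta>(2) \<omega>(1)] by simp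
  ultimately have t: "h (T \<omega>) = top" using \<omega>(2) by (simp add: ennreal_divide_eq_top_iff ennreal_eq_0_iff)
  fix \<omega>' assume \<omega>': "\<omega>' \<in> space M" "T \<omega> \<le> T \<omega>'"
  have ht: "h (T \<omega>') = top" using monoD[OF h(1) \<omega>'(2)] t by (simp add: top_unique)
  show "p \<theta>' \<omega>' = 0"
  proof (rule ccontr)
    assume nz: "p \<theta>' \<omega>' \<noteq> 0"
    then have "ennreal (p \<theta>'' \<omega>') / ennreal (p \<theta>' \<omega>') = top"
      using ratio_isD[OF h(2) \<omega>'(1)] ht by simp
    then show False
      using nz p_nonneg[OF \<theta>(1) \<omega>'(1)] by (simp add: ennreal_divide_eq_top_iff ennreal_eq_0_iff)
  qed
qed

text \<open>If \<open>s \<le> t\<close>, the two half-lines would cover the line and the density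
  would vanish everywhere.\<close>

lemma not_null_above_below:
  assumes "\<theta> \<in> \<Theta>" "null_above \<theta> s" "null_below \<theta> t" shows "t < s"
proof (rule ccontr)
  assume "\<not> t < s"
  moreover obtain \<omega> where "\<omega> \<in> space M" "p \<theta> \<omega> \<noteq> 0" using exists_positive[OF assms(1)] by blast
  ultimately show False using assms(2,3) unfolding null_above_def null_below_def
    by (meson linear not_less order_trans)
qed

text \<open>An outcome above \<open>t\<close> at which \<open>\<theta>\<close> is positive and
  \<open>\<theta>'\<close> is not would, by \<open>null_belowI\<close>, also make
  \<open>\<theta>'\<close> null below it, hence null everywhere. With its dual, this makes
  \<open>\<Sigma>\<close> a lower and \<open>\<I>\<close> an upper set of parameters.\<close>

lemma null_above_antimono:
  assumes "\<theta> \<in> \<Theta>" "\<theta>' \<in> \<Theta>" "\<theta> \<le> \<theta>'" "null_above \<theta>' t" shows "null_above \<theta> t"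
proof (cases "\<theta> = \<theta>'")
  case False
  then have lt: "\<theta> < \<theta>'" using assms(3) by simp
  show ?thesis unfolding null_above_def
  proof (intro ballI impI, rule ccontr)
    fix \<omega> assume \<omega>: "\<omega> \<in> space M" "t \<le> T \<omega>" "p \<theta> \<omega> \<noteq> 0"
    then have "null_below \<theta>' (T \<omega>)"
      using assms(4) by (intro null_belowI[OF assms(1,2) lt]) (auto simp: null_above_def)
    then show False using not_null_above_below[OF assms(2,4)] \<omega>(2) by force
  qed
qed (use assms in simp)

lemma null_below_mono:
  assumes "\<theta> \<in> \<Theta>" "\<theta>' \<in> \<Theta>" "\<theta> \<le> \<theta>'" "null_below \<theta> t" shows "null_below \<theta>' t"
proof (cases "\<theta> = \<theta>'")
  case False
  then have lt: "\<theta> < \<theta>'" using assms(3) by simp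
  show ?thesis unfolding null_below_def
  proof (intro ballI impI, rule ccontr)
    fix \<omega> assume \<omega>: "\<omega> \<in> space M" "T \<omega> \<le> t" "p \<theta>' \<omega> \<noteq> 0"
    then have "null_above \<theta> (T \<omega>)"
      using assms(4) by (intro null_aboveI[OF assms(1,2) lt]) (auto simp: null_below_def)
    then show False using not_null_above_below[OF assms(1) _ assms(4)] \<omega>(2) by force
  qed
qed (use assms in simp)

text \<open>The half-line \<open>{t..}\<close> competes for being the largest null one, so
  membership reduces to a condition on each parameter separately.\<close>

lemma mem_upper_null:
  assumes "A \<subseteq> \<Theta>" "A \<noteq> {}"
  shows "t \<in> upper_null M p T A \<longleftrightarrow> (\<forall>\<theta>\<in>A. null_above \<theta> t)"
proof
  note u = upper_null_greatest[OF model assms, where T = T]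
  show "\<forall>\<theta>\<in>A. null_above \<theta> t" if t: "t \<in> upper_null M p T A"
  proof -
    have "{t..} \<subseteq> upper_null M p T A" by (rule upper_half_line_atLeast[OF u(1) t])
    then show ?thesis using u(2) unfolding vanish_on_def null_above_def by blast
  qed
  show "t \<in> upper_null M p T A" if t: "\<forall>\<theta>\<in>A. null_above \<theta> t"
  proof -
    have "{t..} \<subseteq> upper_null M p T A"
      by (rule u(3)) (use t in \<open>auto simp: vanish_on_def null_above_def upper_half_line_def\<close>)
    then show ?thesis by auto
  qed
qed

lemma mem_lower_null:
  assumes "A \<subseteq> \<Theta>" "A \<noteq> {}"
  shows "t \<in> lower_null M p T A \<longleftrightarrow> (\<forall>\<theta>\<in>A. null_below \<theta> t)"
proof
  note u = lower_null_greatest[OF model assms, where T = T]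
  show "\<forall>\<theta>\<in>A. null_below \<theta> t" if t: "t \<in> lower_null M p T A"
  proof -
    have "{..t} \<subseteq> lower_null M p T A" by (rule lower_half_line_atMost[OF u(1) t])
    then show ?thesis using u(2) unfolding vanish_on_def null_below_def by blast
  qed
  show "t \<in> lower_null M p T A" if t: "\<forall>\<theta>\<in>A. null_below \<theta> t"
  proof -
    have "{..t} \<subseteq> lower_null M p T A"
      by (rule u(3)) (use t in \<open>auto simp: vanish_on_def null_below_def lower_half_line_def\<close>)
    then show ?thesis by auto
  qed
qed

text \<open>Densities are compared at the level 1 of their ratio. If \<open>h\<close> exceeds 1
  somewhere on \<open>L\<close>, it exceeds 1 at every value outside \<open>L\<close>, and the
  larger parameter gives the complement more mass; otherwise \<open>h\<close> is at most 1 on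
  \<open>L\<close>, and the densities compare on \<open>L\<close> itself.\<close>

lemma prob_lower_antimono:
  assumes \<theta>: "\<theta>' \<in> \<Theta>" "\<theta>'' \<in> \<Theta>" "\<theta>' \<le> \<theta>''" and L: "\<And>x y. x \<in> L \<Longrightarrow> y \<le> x \<Longrightarrow> y \<in> L"
  shows "measure (model_prob M p \<theta>'') {\<omega> \<in> space M. T \<omega> \<in> L}
       \<le> measure (model_prob M p \<theta>') {\<omega> \<in> space M. T \<omega> \<in> L}"
proof (cases "\<theta>' = \<theta>''")
  case False
  then have lt: "\<theta>' < \<theta>''" using \<theta>(3) by simp
  interpret P': prob_space "model_prob M p \<theta>'" by (rule prob_space_model[OF \<theta>(1)])
  interpret P'': prob_space "model_prob M p \<theta>''" by (rule prob_space_model[OF \<theta>(2)])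
  obtain h where h: "mono h" "ratio_is M p T \<theta>'' \<theta>' h"
    using mlr \<theta> lt unfolding monotone_likelihood_ratio_def by blast
  define A where "A = {\<omega> \<in> space M. T \<omega> \<in> L}"
  have "is_interval L" using L unfolding is_interval_1 by blast
  then have A: "A \<in> sets M"
    unfolding A_def using measurable_sets[OF T_meas real_interval_borel_measurable]
    by (simp add: vimage_def Int_def conj_commute)
  show ?thesis
  proof (cases "\<exists>t\<in>L. 1 < h t")
    case True
    then obtain t where t: "t \<in> L" "1 < h t" by blast
    have le: "ennreal (p \<theta>' \<omega>) \<le> ennreal (p \<theta>'' \<omega>)" if \<omega>: "\<omega> \<in> space M - A" for \<omega>
    proof (cases "p \<theta>' \<omega> = 0")
      case False
      have "t \<le> T \<omega>" using L[OF t(1), of "T \<omega>"] \<omega> unfolding A_def by force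
      then have "1 < h (T \<omega>)" using t(2) monoD[OF h(1)] by (meson less_le_trans)
      moreover have "ennreal (p \<theta>'' \<omega>) / ennreal (p \<theta>' \<omega>) = h (T \<omega>)"
        using ratio_isD[OF h(2), of \<omega>] \<omega> False by blast
      moreover have "0 < p \<theta>' \<omega>" "0 \<le> p \<theta>'' \<omega>" using False p_nonneg[of _ \<omega>] \<theta> \<omega> by force+
      ultimately have "1 < p \<theta>'' \<omega> / p \<theta>' \<omega>"
        by (metis divide_ennreal ennreal_1 ennreal_less_iff zero_le_one)
      then show ?thesis using \<open>0 < p \<theta>' \<omega>\<close> by (intro ennreal_leI) (simp add: field_simps)
    qed simp
    have "emeasure (model_prob M p \<theta>') (space M - A) \<le> emeasure (model_prob M p \<theta>'') (space M - A)"
      using A \<theta> le by (subst (1 2) emeasure_model_prob) (auto intro!: nn_integral_mono split: split_indicator)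
    then have "measure (model_prob M p \<theta>') (space M - A) \<le> measure (model_prob M p \<theta>'') (space M - A)"
      by (simp add: P'.emeasure_eq_measure P''.emeasure_eq_measure)
    then show ?thesis using P'.prob_compl[of A] P''.prob_compl[of A] A unfolding A_def by simp
  next
    case False
    have le: "ennreal (p \<theta>'' \<omega>) \<le> ennreal (p \<theta>' \<omega>)" if \<omega>: "\<omega> \<in> A" for \<omega>
    proof (cases "p \<theta>'' \<omega> = 0")
      case nz: False
      have sp: "\<omega> \<in> space M" using \<omega> by (simp add: A_def)
      have "h (T \<omega>) \<le> 1" using False \<omega> unfolding A_def by force
      moreover have eq: "ennreal (p \<theta>'' \<omega>) / ennreal (p \<theta>' \<omega>) = h (T \<omega>)"
        using ratio_isD[OF h(2) sp] nz by blast
      moreover have pos: "0 < p \<theta>'' \<omega>" "0 \<le> p \<theta>' \<omega>" using nz p_nonneg[OF _ sp] \<theta> by force+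
      moreover have "p \<theta>' \<omega> \<noteq> 0"
      proof
        assume "p \<theta>' \<omega> = 0"
        then have "h (T \<omega>) = top" using eq pos(1) by (metis ennreal_0 ennreal_divide_eq_top_iff ennreal_eq_0_iff not_le)
        then show False using \<open>h (T \<omega>) \<le> 1\<close> by (simp add: top_unique)
      qed
      ultimately have "p \<theta>'' \<omega> / p \<theta>' \<omega> \<le> 1"
        by (metis divide_ennreal ennreal_1 ennreal_le_iff less_imp_le order_le_less zero_le_one)
      then show ?thesis using pos \<open>p \<theta>' \<omega> \<noteq> 0\<close> by (intro ennreal_leI) (simp add: field_simps)
    qed simp
    have "emeasure (model_prob M p \<theta>'') A \<le> emeasure (model_prob M p \<theta>') A"
      using A \<theta> le by (subst (1 2) emeasure_model_prob) (auto intro!: nn_integral_mono split: split_indicator)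
    then show ?thesis by (simp add: P'.emeasure_eq_measure P''.emeasure_eq_measure A_def)
  qed
qed simp

lemma mean_df_antimono:
  fixes K :: "real \<Rightarrow> ereal"
  assumes \<theta>: "\<theta>' \<in> \<Theta>" "\<theta>'' \<in> \<Theta>" "\<theta>' \<le> \<theta>''" and K: "mono K"
  shows "mean_df M p (\<lambda>\<omega>. K (T \<omega>)) \<theta>'' k \<le> mean_df M p (\<lambda>\<omega>. K (T \<omega>)) \<theta>' k"
proof -
  have "y \<in> {s. K s < k}" if "x \<in> {s. K s < k}" "y \<le> x" for x y
    using le_less_trans[OF monoD[OF K that(2)]] that(1) by simp
  note lt = prob_lower_antimono[OF \<theta> this]
  have "y \<in> {s. K s \<le> k}" if "x \<in> {s. K s \<le> k}" "y \<le> x" for x y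
    using order_trans[OF monoD[OF K that(2)]] that(1) by simp
  note le = prob_lower_antimono[OF \<theta> this]
  show ?thesis
    unfolding mean_df_def using add_mono[OF lt le] by (intro divide_right_mono) simp_all
qed

lemma mean_df_bounds:
  assumes "\<theta> \<in> \<Theta>"
  shows "0 \<le> mean_df M p S \<theta> k" "mean_df M p S \<theta> k \<le> 1"
proof -
  interpret prob_space "model_prob M p \<theta>" by (rule prob_space_model[OF assms])
  show "0 \<le> mean_df M p S \<theta> k" by (simp add: mean_df_def)
  show "mean_df M p S \<theta> k \<le> 1"
    unfolding mean_df_def
    by (rule order_trans[OF divide_right_mono[OF add_mono[OF prob_le_1 prob_le_1]]]) simp_all
qed

text \<open>The set of unseen values need not be Borel, and the model need not be dominated by countably
  many of its members, so a measurable cover has to be built. With \<open>D\<close> countable and dense in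
  \<open>\<Theta>\<close>, the set \<open>\<Phi> \<theta>\<close> collects the values that separate the parameters of \<open>D\<close> below \<open>\<theta>\<close> from
  those above it; these intervals are disjoint, and only countably many of them contain an unseen
  value: such a \<open>\<theta>\<close> either has a nondegenerate \<open>\<Phi> \<theta>\<close>, or is the end point of an interval of
  parameters \<open>x\<close> with empty \<open>\<Phi> x\<close>, because its support overlaps that of some \<open>d\<close> in \<open>D\<close>.\<close>

lemma unseen_values_null:
  "\<exists>E. null_event M p \<Theta> E \<and> T -` unseen_values M p T \<Theta> \<inter> space M \<subseteq> E"
proof -
  define N where "N = unseen_values M p T \<Theta>"
  obtain D where D: "countable D" "D \<subseteq> \<Theta>"
    and dense: "\<And>x y. \<lbrakk>x \<in> \<Theta>; y \<in> \<Theta>; x < y\<rbrakk> \<Longrightarrow> \<exists>d\<in>D. x < d \<and> d < y"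
    and ends: "\<And>x. x \<in> \<Theta> - D \<Longrightarrow> (\<exists>d\<in>D. d < x) \<and> (\<exists>d\<in>D. x < d)"
    using countable_dense_parameters[OF int] by blast
  define \<Phi> where "\<Phi> = (\<lambda>\<theta>. {t. \<forall>d\<in>D. (d < \<theta> \<longrightarrow> null_above d t) \<and> (\<theta> < d \<longrightarrow> null_below d t)})"
  have \<Phi>_above: "null_above d t" if "t \<in> \<Phi> \<theta>" "d \<in> D" "d < \<theta>" for t \<theta> d
    using that unfolding \<Phi>_def by blast
  have \<Phi>_below: "null_below d t" if "t \<in> \<Phi> \<theta>" "d \<in> D" "\<theta> < d" for t \<theta> d
    using that unfolding \<Phi>_def by blast
  \<comment> \<open>A member of \<open>D\<close> strictly between \<open>x\<close> and
    \<open>y\<close> would have a density null both above and below \<open>t\<close>.\<close>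
  have \<Phi>_lt: False if x: "x \<in> \<Theta>" "y \<in> \<Theta>" "x < y" "t \<in> \<Phi> x" "t \<in> \<Phi> y" for x y t
  proof -
    from dense[OF x(1-3)] obtain d where d: "d \<in> D" "x < d" "d < y" by blast
    then show False
      using not_null_above_below[of d t t] \<Phi>_above[OF x(5)] \<Phi>_below[OF x(4)] D(2) by blast
  qed
  have \<Phi>_inj: "x = y" if "x \<in> \<Theta>" "y \<in> \<Theta>" "t \<in> \<Phi> x" "t \<in> \<Phi> y" for x y t
    using \<Phi>_lt[of x y t] \<Phi>_lt[of y x t] that by (meson linorder_cases)
  have above_mono: "null_above d t'" if "null_above d t" "t \<le> t'" for d t t'
    using that unfolding null_above_def by (meson order_trans)
  have below_mono: "null_below d t'" if "null_below d t" "t' \<le> t" for d t t'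
    using that unfolding null_below_def by (meson order_trans)
  have \<Phi>_interval: "is_interval (\<Phi> \<theta>)" for \<theta>
    unfolding is_interval_1 \<Phi>_def using above_mono below_mono by blast
  define X where "X = {\<theta> \<in> \<Theta>. \<Phi> \<theta> \<inter> N \<noteq> {}}"
  define X1 where "X1 = {\<theta> \<in> \<Theta>. \<exists>r::rat. real_of_rat r \<in> \<Phi> \<theta>}"
  define X2 where "X2 = {\<theta> \<in> \<Theta>. \<Phi> \<theta> \<noteq> {} \<and> (\<exists>d\<in>\<Theta>. d < \<theta> \<and> (\<forall>x\<in>\<Theta>. d < x \<and> x < \<theta> \<longrightarrow> \<Phi> x = {}))}"
  define X3 where "X3 = {\<theta> \<in> \<Theta>. \<Phi> \<theta> \<noteq> {} \<and> (\<exists>d\<in>\<Theta>. \<theta> < d \<and> (\<forall>x\<in>\<Theta>. \<theta> < x \<and> x < d \<longrightarrow> \<Phi> x = {}))}"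
  have "countable X1"
  proof (rule countable_by_rationals[where R = "\<lambda>\<theta> r. real_of_rat r \<in> \<Phi> \<theta>"])
    show "\<exists>r::rat. real_of_rat r \<in> \<Phi> \<theta>" if "\<theta> \<in> X1" for \<theta> using that unfolding X1_def by blast
    show "x = y" if "x \<in> X1" "y \<in> X1" "real_of_rat r \<in> \<Phi> x" "real_of_rat r \<in> \<Phi> y" for x y r
      using \<Phi>_inj[of x y] that unfolding X1_def by blast
  qed
  moreover have "countable X2"
  proof (rule countable_by_rationals
      [where R = "\<lambda>\<theta> r. real_of_rat r < \<theta> \<and> (\<forall>x\<in>\<Theta>. real_of_rat r < x \<and> x < \<theta> \<longrightarrow> \<Phi> x = {})"])
    fix \<theta> assume "\<theta> \<in> X2"
    then obtain d where d: "d < \<theta>" "\<forall>x\<in>\<Theta>. d < x \<and> x < \<theta> \<longrightarrow> \<Phi> x = {}" unfolding X2_def by blast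
    from of_rat_dense[OF d(1)] obtain r where "d < real_of_rat r" "real_of_rat r < \<theta>" by blast
    then show "\<exists>r::rat. real_of_rat r < \<theta> \<and> (\<forall>x\<in>\<Theta>. real_of_rat r < x \<and> x < \<theta> \<longrightarrow> \<Phi> x = {})"
      using d(2) by (meson less_trans)
  next
    \<comment> \<open>If \<open>x < y\<close> shared the rational \<open>r\<close>, then
      \<open>x\<close> would lie in the gap below \<open>y\<close>, where every
      \<open>\<Phi>\<close> is empty.\<close>
    fix x y r assume "x \<in> X2" "y \<in> X2"
      "real_of_rat r < x \<and> (\<forall>z\<in>\<Theta>. real_of_rat r < z \<and> z < x \<longrightarrow> \<Phi> z = {})"
      "real_of_rat r < y \<and> (\<forall>z\<in>\<Theta>. real_of_rat r < z \<and> z < y \<longrightarrow> \<Phi> z = {})"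
    then show "x = y" unfolding X2_def by (cases x y rule: linorder_cases) auto
  qed
  moreover have "countable X3"
  proof (rule countable_by_rationals
      [where R = "\<lambda>\<theta> r. \<theta> < real_of_rat r \<and> (\<forall>x\<in>\<Theta>. \<theta> < x \<and> x < real_of_rat r \<longrightarrow> \<Phi> x = {})"])
    fix \<theta> assume "\<theta> \<in> X3"
    then obtain d where d: "\<theta> < d" "\<forall>x\<in>\<Theta>. \<theta> < x \<and> x < d \<longrightarrow> \<Phi> x = {}" unfolding X3_def by blast
    from of_rat_dense[OF d(1)] obtain r where "\<theta> < real_of_rat r" "real_of_rat r < d" by blast
    then show "\<exists>r::rat. \<theta> < real_of_rat r \<and> (\<forall>x\<in>\<Theta>. \<theta> < x \<and> x < real_of_rat r \<longrightarrow> \<Phi> x = {})"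
      using d(2) by (meson less_trans)
  next
    fix x y r assume "x \<in> X3" "y \<in> X3"
      "x < real_of_rat r \<and> (\<forall>z\<in>\<Theta>. x < z \<and> z < real_of_rat r \<longrightarrow> \<Phi> z = {})"
      "y < real_of_rat r \<and> (\<forall>z\<in>\<Theta>. y < z \<and> z < real_of_rat r \<longrightarrow> \<Phi> z = {})"
    then show "x = y" unfolding X3_def by (cases x y rule: linorder_cases) auto
  qed
  moreover have "X \<subseteq> X1 \<union> X2 \<union> X3"
  proof
    fix \<theta> assume "\<theta> \<in> X"
    then obtain t where \<theta>: "\<theta> \<in> \<Theta>" and t: "t \<in> \<Phi> \<theta>" "t \<in> N" unfolding X_def by blast
    obtain \<omega> where \<omega>: "\<omega> \<in> space M" "p \<theta> \<omega> \<noteq> 0" using exists_positive[OF \<theta>] by blast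
    then have st: "T \<omega> \<noteq> t" using t(2) \<theta> unfolding N_def unseen_values_def by auto
    show "\<theta> \<in> X1 \<union> X2 \<union> X3"
    proof (cases "T \<omega> \<in> \<Phi> \<theta>")
      case True
      have "\<exists>r::rat. real_of_rat r \<in> \<Phi> \<theta>"
      proof (cases "T \<omega> < t")
        case lt: True
        from of_rat_dense[OF lt] obtain r where "T \<omega> < real_of_rat r" "real_of_rat r < t" by blast
        then show ?thesis using mem_is_interval_1_I[OF \<Phi>_interval True t(1), of "real_of_rat r"] by auto
      next
        case False
        then have lt: "t < T \<omega>" using st by simp
        from of_rat_dense[OF lt] obtain r where "t < real_of_rat r" "real_of_rat r < T \<omega>" by blast
        then show ?thesis using mem_is_interval_1_I[OF \<Phi>_interval t(1) True, of "real_of_rat r"] by auto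
      qed
      then show ?thesis using \<theta> unfolding X1_def by blast
    next
      case False
      then obtain d where d: "d \<in> D" "(d < \<theta> \<and> \<not> null_above d (T \<omega>)) \<or> (\<theta> < d \<and> \<not> null_below d (T \<omega>))"
        unfolding \<Phi>_def by blast
      have d\<Theta>: "d \<in> \<Theta>" using d(1) D(2) by blast
      show ?thesis using d(2)
      proof
        assume d': "d < \<theta> \<and> \<not> null_above d (T \<omega>)"
        then have pd: "p d \<omega> \<noteq> 0" using null_aboveI[OF d\<Theta> \<theta> _ \<omega>(1) _ \<omega>(2)] by blast
        \<comment> \<open>A value \<open>t'\<close> of \<open>\<Phi> x\<close> exceeds
          \<open>T \<omega>\<close>, because \<open>d\<close> is positive at
          \<open>\<omega>\<close>. A member \<open>e\<close> of \<open>D\<close> between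
          \<open>x\<close> and \<open>\<theta>\<close> is null below \<open>t'\<close>, so it
          vanishes at \<open>\<omega>\<close> and, compared with \<open>\<theta>\<close>, is null
          above \<open>T \<omega>\<close> too: its density would vanish everywhere.\<close>
        have "\<Phi> x = {}" if x: "x \<in> \<Theta>" "d < x" "x < \<theta>" for x
        proof (rule ccontr)
          assume "\<Phi> x \<noteq> {}"
          then obtain t' where t': "t' \<in> \<Phi> x" by blast
          have lt: "T \<omega> < t'"
            using \<Phi>_above[OF t' d(1) x(2)] pd \<omega>(1) unfolding null_above_def by force
          from dense[OF x(1) \<theta> x(3)] obtain e where e: "e \<in> D" "x < e" "e < \<theta>" by blast
          have eb: "null_below e t'" by (rule \<Phi>_below[OF t' e(1,2)])
          then have "p e \<omega> = 0" using lt \<omega>(1) unfolding null_below_def by simp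
          moreover have e\<Theta>: "e \<in> \<Theta>" using e(1) D(2) by blast
          ultimately have "null_above e (T \<omega>)" using null_aboveI[OF _ \<theta> e(3) \<omega>(1) _ \<omega>(2)] by blast
          then show False using not_null_above_below[OF e\<Theta> _ eb] lt by force
        qed
        then have "\<theta> \<in> X2" unfolding X2_def using \<theta> t(1) d\<Theta> d' by blast
        then show ?thesis by blast
      next
        assume d': "\<theta> < d \<and> \<not> null_below d (T \<omega>)"
        then have pd: "p d \<omega> \<noteq> 0" using null_belowI[OF \<theta> d\<Theta> _ \<omega>] by blast
        have "\<Phi> x = {}" if x: "x \<in> \<Theta>" "\<theta> < x" "x < d" for x
        proof (rule ccontr)
          assume "\<Phi> x \<noteq> {}"
          then obtain t' where t': "t' \<in> \<Phi> x" by blast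
          have lt: "t' < T \<omega>"
            using \<Phi>_below[OF t' d(1) x(3)] pd \<omega>(1) unfolding null_below_def by force
          from dense[OF \<theta> x(1,2)] obtain e where e: "e \<in> D" "\<theta> < e" "e < x" by blast
          have ea: "null_above e t'" by (rule \<Phi>_above[OF t' e(1,3)])
          then have "p e \<omega> = 0" using lt \<omega>(1) unfolding null_above_def by simp
          moreover have e\<Theta>: "e \<in> \<Theta>" using e(1) D(2) by blast
          ultimately have "null_below e (T \<omega>)" using null_belowI[OF \<theta> _ e(2) \<omega>] by blast
          then show False using not_null_above_below[OF e\<Theta> ea] lt by force
        qed
        then have "\<theta> \<in> X3" unfolding X3_def using \<theta> t(1) d\<Theta> d' by blast
        then show ?thesis by blast
      qed
    qed
  qed
  ultimately have X: "countable X" by (meson countable_Un countable_subset)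
  have X\<Theta>: "X \<subseteq> \<Theta>" unfolding X_def by blast
  \<comment> \<open>\<open>C\<close> is made of countably many intervals. If all densities indexed
    by \<open>D \<union> X\<close> vanish at \<open>\<omega>\<close> but that of
    \<open>\<theta>\<close> does not, then \<open>T \<omega>\<close> lies in
    \<open>\<Phi> \<theta>\<close> with \<open>\<theta>\<close> outside \<open>D \<union> X\<close>,
    which each part of \<open>C\<close> rules out; so \<open>E\<close> is null. Conversely, the
    parts are chosen so that an unseen value outside \<open>C\<close> would determine a parameter in
    \<open>X\<close>, whose interval already belongs to \<open>C\<close>.\<close>
  define C1 where "C1 = (\<Union>d\<in>D. {t. \<not> null_above d t} \<inter> {t. \<not> null_below d t})"
  define C where "C = C1 \<union> (\<Union>\<theta>\<in>X \<union> D. \<Phi> \<theta>) \<union> {t. \<forall>d\<in>D. null_above d t} \<union> {t. \<forall>d\<in>D. null_below d t}"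
  have interval_above: "is_interval {t. \<not> null_above d t}" "is_interval {t. \<forall>d\<in>D. null_above d t}"
    and interval_below: "is_interval {t. \<not> null_below d t}" "is_interval {t. \<forall>d\<in>D. null_below d t}" for d
    unfolding is_interval_1 using above_mono below_mono by blast+
  have c1: "C1 \<in> sets borel"
    unfolding C1_def
    by (intro sets.countable_UN'[OF D(1)] image_subsetI sets.Int real_interval_borel_measurable
        interval_above interval_below)
  have c2: "(\<Union>\<theta>\<in>X \<union> D. \<Phi> \<theta>) \<in> sets borel"
    using D(1) X
    by (intro sets.countable_UN' image_subsetI real_interval_borel_measurable \<Phi>_interval) simp
  have C: "C \<in> sets borel"
    unfolding C_def by (rule sets.Un[OF sets.Un[OF sets.Un[OF c1 c2]
      real_interval_borel_measurable[OF interval_above(2)]]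
      real_interval_borel_measurable[OF interval_below(2)]])
  define E where "E = (space M - (\<Union>d\<in>D \<union> X. {\<omega> \<in> space M. p d \<omega> \<noteq> 0})) \<inter> (T -` C \<inter> space M)"
  have "(\<Union>d\<in>D \<union> X. {\<omega> \<in> space M. p d \<omega> \<noteq> 0}) \<in> sets M"
  proof (rule sets.countable_UN')
    show "countable (D \<union> X)" using D(1) X by simp
    show "(\<lambda>d. {\<omega> \<in> space M. p d \<omega> \<noteq> 0}) ` (D \<union> X) \<subseteq> sets M"
    proof (rule image_subsetI)
      fix d assume "d \<in> D \<union> X"
      then have [measurable]: "p d \<in> borel_measurable M" using p_meas D(2) X\<Theta> by blast
      show "{\<omega> \<in> space M. p d \<omega> \<noteq> 0} \<in> sets M" by measurable
    qed
  qed
  then have E: "E \<in> sets M"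
    unfolding E_def using measurable_sets[OF T_meas C] by blast
  have "emeasure (model_prob M p \<theta>) E = 0" if \<theta>: "\<theta> \<in> \<Theta>" for \<theta>
  proof -
    have "p \<theta> \<omega> = 0" if \<omega>: "\<omega> \<in> E" for \<omega>
    proof (rule ccontr)
      assume pos: "p \<theta> \<omega> \<noteq> 0"
      have sp: "\<omega> \<in> space M" and TC: "T \<omega> \<in> C" and z: "\<And>d. d \<in> D \<union> X \<Longrightarrow> p d \<omega> = 0"
        using \<omega> unfolding E_def by auto
      have \<theta>D: "\<theta> \<notin> D \<union> X" using z pos by blast
      have a: "null_above d (T \<omega>)" if "d \<in> D" "d < \<theta>" for d
        using null_aboveI[of d \<theta> \<omega>] that \<theta> sp z pos D(2) by blast
      have b: "null_below d (T \<omega>)" if "d \<in> D" "\<theta> < d" for d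
        using null_belowI[of \<theta> d \<omega>] that \<theta> sp z pos D(2) by blast
      have \<Phi>: "T \<omega> \<in> \<Phi> \<theta>" unfolding \<Phi>_def using a b by blast
      have "T \<omega> \<notin> C1"
      proof
        assume "T \<omega> \<in> C1"
        then obtain d where "d \<in> D" "\<not> null_above d (T \<omega>)" "\<not> null_below d (T \<omega>)"
          unfolding C1_def by blast
        then show False using a[of d] b[of d] \<theta>D by (cases d \<theta> rule: linorder_cases) auto
      qed
      moreover have "T \<omega> \<notin> \<Phi> \<theta>'" if "\<theta>' \<in> X \<union> D" for \<theta>'
        using \<Phi>_inj[OF \<theta> _ \<Phi>, of \<theta>'] that \<theta>D D(2) X\<Theta> by blast
      moreover obtain d d' where d: "d \<in> D" "d < \<theta>" "d' \<in> D" "\<theta> < d'" using ends[of \<theta>] \<theta> \<theta>D by blast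
      moreover have "\<not> null_below d (T \<omega>)" "\<not> null_above d' (T \<omega>)"
        using not_null_above_below[of _ "T \<omega>" "T \<omega>"] a[OF d(1,2)] b[OF d(3,4)] D(2) d(1,3) by blast+
      ultimately show False using TC unfolding C_def by blast
    qed
    then have "(\<integral>\<^sup>+ \<omega>. ennreal (p \<theta> \<omega>) * indicator E \<omega> \<partial>M) = (\<integral>\<^sup>+ \<omega>. 0 \<partial>M)"
      by (intro nn_integral_cong) (auto split: split_indicator)
    then show ?thesis using emeasure_model_prob[OF \<theta> E] by simp
  qed
  then have "null_event M p \<Theta> E" using E unfolding null_event_def by blast
  moreover have "T -` N \<inter> space M \<subseteq> E"
  proof
    fix \<omega> assume "\<omega> \<in> T -` N \<inter> space M"
    then have sp: "\<omega> \<in> space M" and TN: "T \<omega> \<in> N" by auto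
    have z: "p \<theta> \<omega> = 0" if "\<theta> \<in> \<Theta>" for \<theta>
      using TN sp that unfolding N_def unseen_values_def by auto
    have "T \<omega> \<in> C"
    proof (rule ccontr)
      assume nC: "T \<omega> \<notin> C"
      define L where "L = {d \<in> D. null_above d (T \<omega>)}"
      obtain l u where l: "l \<in> D" "\<not> null_below l (T \<omega>)" and u: "u \<in> D" "\<not> null_above u (T \<omega>)"
        using nC unfolding C_def by blast
      have each: "null_above d (T \<omega>) \<or> null_below d (T \<omega>)" if "d \<in> D" for d
        using nC that unfolding C_def C1_def by blast
      have lL: "l \<in> L" using each l unfolding L_def by blast
      have Lu: "x < v" if "x \<in> L" "v \<in> D - L" for x v
      proof (rule ccontr)
        assume "\<not> x < v"
        then show False using null_above_antimono[of v x "T \<omega>"] that D(2) unfolding L_def by auto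
      qed
      have uL: "u \<in> D - L" using u unfolding L_def by blast
      have bdd: "bdd_above L" using Lu uL by (meson bdd_aboveI less_imp_le)
      \<comment> \<open>\<open>L\<close> and the rest of \<open>D\<close> form a cut: null above on
        the left, null below on the right. Hence \<open>T \<omega>\<close> lies in
        \<open>\<Phi>\<close> of the supremum, and being unseen it puts that supremum into
        \<open>X\<close>.\<close>
      define \<theta> where "\<theta> = Sup L"
      have "l \<le> \<theta>" unfolding \<theta>_def using lL bdd by (rule cSup_upper)
      moreover have "\<theta> \<le> u" unfolding \<theta>_def using lL Lu[OF _ uL] by (intro cSup_least) (auto intro: less_imp_le)
      ultimately have \<theta>: "\<theta> \<in> \<Theta>" using mem_is_interval_1_I[OF int, of l u \<theta>] l(1) u(1) D(2) by blast
      have "null_above d (T \<omega>)" if d: "d \<in> D" "d < \<theta>" for d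
      proof -
        obtain x where "x \<in> L" "d < x" using less_cSupD[of L d] lL d(2) unfolding \<theta>_def by blast
        then show ?thesis using Lu[of x d] d(1) unfolding L_def by force
      qed
      moreover have "null_below d (T \<omega>)" if d: "d \<in> D" "\<theta> < d" for d
      proof -
        have "d \<notin> L" using cSup_upper[OF _ bdd, of d] d(2) unfolding \<theta>_def by auto
        then show ?thesis using each[OF d(1)] d(1) unfolding L_def by blast
      qed
      ultimately have "T \<omega> \<in> \<Phi> \<theta>" unfolding \<Phi>_def by blast
      moreover from this have "\<theta> \<in> X" unfolding X_def using TN \<theta> by blast
      ultimately show False using nC unfolding C_def by blast
    qed
    then show "\<omega> \<in> E" unfolding E_def using sp z D(2) X\<Theta> by auto
  qed
  ultimately show ?thesis unfolding N_def by blast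
qed

end

section \<open>One-sided limits along the parameter interval\<close>

text \<open>In the absence of a least parameter, the punctured neighbourhood of a finite infimum and
  the filter \<open>at_bot\<close> reduce to the same condition. In the unbounded case the interval
  property makes every sufficiently small real a parameter, and the bound \<open>x - 1\<close> turns
  the strict inequality into a weak one.\<close>

lemma eventually_to_inf:
  assumes int: "is_interval \<Theta>" and nl: "\<forall>a\<in>\<Theta>. \<exists>b\<in>\<Theta>. b < a" and ne: "\<Theta> \<noteq> {}"
  shows "eventually P (to_inf \<Theta>) \<longleftrightarrow> (\<exists>x\<in>\<Theta>. \<forall>y\<in>\<Theta>. y < x \<longrightarrow> P y)"
proof (cases "bdd_below \<Theta>")
  case True
  have low: "Inf \<Theta> < y" if y: "y \<in> \<Theta>" for y
  proof -
    obtain z where "z \<in> \<Theta>" "z < y" using nl y by blast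
    then show ?thesis using cInf_lower[OF _ True, of z] by simp
  qed
  have "eventually P (to_inf \<Theta>) \<longleftrightarrow> (\<exists>d>0. \<forall>y\<in>\<Theta>. y \<noteq> Inf \<Theta> \<and> dist y (Inf \<Theta>) < d \<longrightarrow> P y)"
    using True by (simp add: to_inf_def eventually_at)
  also have "\<dots> \<longleftrightarrow> (\<exists>x\<in>\<Theta>. \<forall>y\<in>\<Theta>. y < x \<longrightarrow> P y)"
  proof
    assume "\<exists>d>0. \<forall>y\<in>\<Theta>. y \<noteq> Inf \<Theta> \<and> dist y (Inf \<Theta>) < d \<longrightarrow> P y"
    then obtain d where d: "0 < d" "\<And>y. y \<in> \<Theta> \<Longrightarrow> y \<noteq> Inf \<Theta> \<Longrightarrow> dist y (Inf \<Theta>) < d \<Longrightarrow> P y" by blast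
    obtain x where x: "x \<in> \<Theta>" "x < Inf \<Theta> + d" using cInf_lessD[OF ne, of "Inf \<Theta> + d"] d(1) by auto
    have "P y" if "y \<in> \<Theta>" "y < x" for y
      using d(2)[OF that(1)] low[OF that(1)] that(2) x(2) by (simp add: dist_real_def)
    with x(1) show "\<exists>x\<in>\<Theta>. \<forall>y\<in>\<Theta>. y < x \<longrightarrow> P y" by blast
  next
    assume "\<exists>x\<in>\<Theta>. \<forall>y\<in>\<Theta>. y < x \<longrightarrow> P y"
    then obtain x where x: "x \<in> \<Theta>" "\<And>y. y \<in> \<Theta> \<Longrightarrow> y < x \<Longrightarrow> P y" by blast
    have "P y" if "y \<in> \<Theta>" "dist y (Inf \<Theta>) < x - Inf \<Theta>" for y
      using x(2)[OF that(1)] that(2) by (simp add: dist_real_def)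
    then show "\<exists>d>0. \<forall>y\<in>\<Theta>. y \<noteq> Inf \<Theta> \<and> dist y (Inf \<Theta>) < d \<longrightarrow> P y"
      using low[OF x(1)] by (intro exI[of _ "x - Inf \<Theta>"]) simp
  qed
  finally show ?thesis .
next
  case False
  have low: "\<exists>x\<in>\<Theta>. x < y" for y using False unfolding bdd_below_def by (meson not_le)
  have "eventually P (to_inf \<Theta>) \<longleftrightarrow> (\<exists>N. \<forall>n\<le>N. P n)"
    using False by (simp add: to_inf_def eventually_at_bot_linorder)
  also have "\<dots> \<longleftrightarrow> (\<exists>x\<in>\<Theta>. \<forall>y\<in>\<Theta>. y < x \<longrightarrow> P y)"
  proof
    assume "\<exists>N. \<forall>n\<le>N. P n"
    then obtain N where N: "\<And>n. n \<le> N \<Longrightarrow> P n" by blast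
    obtain x where "x \<in> \<Theta>" "x < N" using low by blast
    with N show "\<exists>x\<in>\<Theta>. \<forall>y\<in>\<Theta>. y < x \<longrightarrow> P y" by (intro bexI[of _ x]) auto
  next
    assume "\<exists>x\<in>\<Theta>. \<forall>y\<in>\<Theta>. y < x \<longrightarrow> P y"
    then obtain x where x: "x \<in> \<Theta>" "\<And>y. y \<in> \<Theta> \<Longrightarrow> y < x \<Longrightarrow> P y" by blast
    have "P y" if y: "y \<le> x - 1" for y
    proof -
      obtain z where "z \<in> \<Theta>" "z < y" using low by blast
      then have "y \<in> \<Theta>" using mem_is_interval_1_I[OF int _ x(1), of z y] y by simp
      then show ?thesis using x(2) y by simp
    qed
    then show "\<exists>N. \<forall>n\<le>N. P n" by blast
  qed
  finally show ?thesis .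
qed

lemma eventually_to_sup:
  assumes int: "is_interval \<Theta>" and nl: "\<forall>a\<in>\<Theta>. \<exists>b\<in>\<Theta>. a < b" and ne: "\<Theta> \<noteq> {}"
  shows "eventually P (to_sup \<Theta>) \<longleftrightarrow> (\<exists>x\<in>\<Theta>. \<forall>y\<in>\<Theta>. x < y \<longrightarrow> P y)"
proof (cases "bdd_above \<Theta>")
  case True
  have up: "y < Sup \<Theta>" if y: "y \<in> \<Theta>" for y
  proof -
    obtain z where "z \<in> \<Theta>" "y < z" using nl y by blast
    then show ?thesis using cSup_upper[OF _ True, of z] by simp
  qed
  have "eventually P (to_sup \<Theta>) \<longleftrightarrow> (\<exists>d>0. \<forall>y\<in>\<Theta>. y \<noteq> Sup \<Theta> \<and> dist y (Sup \<Theta>) < d \<longrightarrow> P y)"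
    using True by (simp add: to_sup_def eventually_at)
  also have "\<dots> \<longleftrightarrow> (\<exists>x\<in>\<Theta>. \<forall>y\<in>\<Theta>. x < y \<longrightarrow> P y)"
  proof
    assume "\<exists>d>0. \<forall>y\<in>\<Theta>. y \<noteq> Sup \<Theta> \<and> dist y (Sup \<Theta>) < d \<longrightarrow> P y"
    then obtain d where d: "0 < d" "\<And>y. y \<in> \<Theta> \<Longrightarrow> y \<noteq> Sup \<Theta> \<Longrightarrow> dist y (Sup \<Theta>) < d \<Longrightarrow> P y" by blast
    obtain x where x: "x \<in> \<Theta>" "Sup \<Theta> - d < x" using less_cSupD[OF ne, of "Sup \<Theta> - d"] d(1) by auto
    have "P y" if "y \<in> \<Theta>" "x < y" for y
      using d(2)[OF that(1)] up[OF that(1)] that(2) x(2) by (simp add: dist_real_def)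
    with x(1) show "\<exists>x\<in>\<Theta>. \<forall>y\<in>\<Theta>. x < y \<longrightarrow> P y" by blast
  next
    assume "\<exists>x\<in>\<Theta>. \<forall>y\<in>\<Theta>. x < y \<longrightarrow> P y"
    then obtain x where x: "x \<in> \<Theta>" "\<And>y. y \<in> \<Theta> \<Longrightarrow> x < y \<Longrightarrow> P y" by blast
    have "P y" if "y \<in> \<Theta>" "dist y (Sup \<Theta>) < Sup \<Theta> - x" for y
      using x(2)[OF that(1)] that(2) by (simp add: dist_real_def)
    then show "\<exists>d>0. \<forall>y\<in>\<Theta>. y \<noteq> Sup \<Theta> \<and> dist y (Sup \<Theta>) < d \<longrightarrow> P y"
      using up[OF x(1)] by (intro exI[of _ "Sup \<Theta> - x"]) simp
  qed
  finally show ?thesis .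
next
  case False
  have up: "\<exists>x\<in>\<Theta>. y < x" for y using False unfolding bdd_above_def by (meson not_le)
  have "eventually P (to_sup \<Theta>) \<longleftrightarrow> (\<exists>N. \<forall>n\<ge>N. P n)"
    using False by (simp add: to_sup_def eventually_at_top_linorder)
  also have "\<dots> \<longleftrightarrow> (\<exists>x\<in>\<Theta>. \<forall>y\<in>\<Theta>. x < y \<longrightarrow> P y)"
  proof
    assume "\<exists>N. \<forall>n\<ge>N. P n"
    then obtain N where N: "\<And>n. n \<ge> N \<Longrightarrow> P n" by blast
    obtain x where "x \<in> \<Theta>" "N < x" using up by blast
    with N show "\<exists>x\<in>\<Theta>. \<forall>y\<in>\<Theta>. x < y \<longrightarrow> P y" by (intro bexI[of _ x]) auto
  next
    assume "\<exists>x\<in>\<Theta>. \<forall>y\<in>\<Theta>. x < y \<longrightarrow> P y"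
    then obtain x where x: "x \<in> \<Theta>" "\<And>y. y \<in> \<Theta> \<Longrightarrow> x < y \<Longrightarrow> P y" by blast
    have "P y" if y: "y \<ge> x + 1" for y
    proof -
      obtain z where "z \<in> \<Theta>" "y < z" using up by blast
      then have "y \<in> \<Theta>" using mem_is_interval_1_I[OF int x(1), of z y] y by simp
      then show ?thesis using x(2) y by simp
    qed
    then show "\<exists>N. \<forall>n\<ge>N. P n" by blast
  qed
  finally show ?thesis .
qed

section \<open>End points in the extended reals, expressed by parameters\<close>

lemma ereal_neq_SUP_iff:
  assumes "a \<in> \<Theta>" shows "ereal a \<noteq> (SUP \<theta>\<in>\<Theta>. ereal \<theta>) \<longleftrightarrow> (\<exists>b\<in>\<Theta>. a < b)"
proof -
  have "ereal a \<le> (SUP \<theta>\<in>\<Theta>. ereal \<theta>)" using assms by (rule SUP_upper)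
  then have "ereal a \<noteq> (SUP \<theta>\<in>\<Theta>. ereal \<theta>) \<longleftrightarrow> ereal a < (SUP \<theta>\<in>\<Theta>. ereal \<theta>)" by (simp add: less_le)
  then show ?thesis by (simp add: less_SUP_iff)
qed

lemma ereal_neq_INF_iff:
  assumes "a \<in> \<Theta>" shows "ereal a \<noteq> (INF \<theta>\<in>\<Theta>. ereal \<theta>) \<longleftrightarrow> (\<exists>b\<in>\<Theta>. b < a)"
proof -
  have "(INF \<theta>\<in>\<Theta>. ereal \<theta>) \<le> ereal a" using assms by (rule INF_lower)
  then have "ereal a \<noteq> (INF \<theta>\<in>\<Theta>. ereal \<theta>) \<longleftrightarrow> (INF \<theta>\<in>\<Theta>. ereal \<theta>) < ereal a" by (auto simp: less_le)
  then show ?thesis by (simp add: INF_less_iff)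
qed

lemma SUP_notin_iff: "(SUP \<theta>\<in>\<Theta>. ereal \<theta>) \<notin> ereal ` \<Theta> \<longleftrightarrow> (\<forall>a\<in>\<Theta>. \<exists>b\<in>\<Theta>. a < b)"
proof -
  have "(SUP \<theta>\<in>\<Theta>. ereal \<theta>) \<notin> ereal ` \<Theta> \<longleftrightarrow> (\<forall>a\<in>\<Theta>. ereal a \<noteq> (SUP \<theta>\<in>\<Theta>. ereal \<theta>))" by (metis image_iff)
  then show ?thesis using ereal_neq_SUP_iff by simp
qed

lemma INF_notin_iff: "(INF \<theta>\<in>\<Theta>. ereal \<theta>) \<notin> ereal ` \<Theta> \<longleftrightarrow> (\<forall>a\<in>\<Theta>. \<exists>b\<in>\<Theta>. b < a)"
proof -
  have "(INF \<theta>\<in>\<Theta>. ereal \<theta>) \<notin> ereal ` \<Theta> \<longleftrightarrow> (\<forall>a\<in>\<Theta>. ereal a \<noteq> (INF \<theta>\<in>\<Theta>. ereal \<theta>))" by (metis image_iff)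
  then show ?thesis using ereal_neq_INF_iff by simp
qed

context vote_curve
begin

text \<open>For \<open>y\<close> between \<open>a\<close> and \<open>x\<close>, the value
  \<open>F y\<close> is caught between \<open>F a\<close> and \<open>F x\<close>, so a single good
  \<open>x\<close> controls a whole right neighbourhood. The parameter \<open>b\<close> guarantees
  that there are points to the right at all.\<close>

lemma right_continuous_iff:
  assumes a: "a \<in> \<Theta>" and b: "b \<in> \<Theta>" "a < b"
  shows "continuous (at a within \<Theta> \<inter> {a<..}) (\<lambda>\<theta>. 1 - F \<theta>) \<longleftrightarrow> (\<forall>e>0. \<exists>x\<in>\<Theta>. a < x \<and> F x < F a + e)"
proof
  assume c: "continuous (at a within \<Theta> \<inter> {a<..}) (\<lambda>\<theta>. 1 - F \<theta>)"
  show "\<forall>e>0. \<exists>x\<in>\<Theta>. a < x \<and> F x < F a + e"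
  proof (intro allI impI)
    fix e :: real assume "0 < e"
    then obtain d where d: "0 < d" "\<And>x. x \<in> \<Theta> \<inter> {a<..} \<Longrightarrow> dist x a < d \<Longrightarrow> dist (1 - F x) (1 - F a) < e"
      using c unfolding continuous_within_eps_delta by blast
    define x where "x = min b (a + d / 2)"
    have ax: "a < x" "x \<le> b" "x < a + d" using b d(1) by (auto simp: x_def min_def)
    have x: "x \<in> \<Theta>" using mem_is_interval_1_I[OF int a b(1), of x] ax by simp
    have "dist (1 - F x) (1 - F a) < e" using d(2)[of x] x ax by (simp add: dist_real_def)
    then have "F x < F a + e" unfolding dist_real_def by linarith
    then show "\<exists>x\<in>\<Theta>. a < x \<and> F x < F a + e" using x ax by blast
  qed
next
  assume r: "\<forall>e>0. \<exists>x\<in>\<Theta>. a < x \<and> F x < F a + e"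
  show "continuous (at a within \<Theta> \<inter> {a<..}) (\<lambda>\<theta>. 1 - F \<theta>)"
    unfolding continuous_within_eps_delta
  proof (intro allI impI)
    fix e :: real assume "0 < e"
    then obtain x where x: "x \<in> \<Theta>" "a < x" "F x < F a + e" using r by blast
    have "dist (1 - F y) (1 - F a) < e" if "y \<in> \<Theta> \<inter> {a<..}" "dist y a < x - a" for y
      using mono_F[of a y] mono_F[of y x] that a x by (auto simp: dist_real_def)
    then show "\<exists>d>0. \<forall>y\<in>\<Theta> \<inter> {a<..}. dist y a < d \<longrightarrow> dist (1 - F y) (1 - F a) < e"
      using x(2) by (intro exI[of _ "x - a"]) simp
  qed
qed

lemma left_continuous_iff:
  assumes a: "a \<in> \<Theta>" and b: "b \<in> \<Theta>" "b < a"
  shows "continuous (at a within \<Theta> \<inter> {..<a}) (\<lambda>\<theta>. 1 - F \<theta>) \<longleftrightarrow> (\<forall>e>0. \<exists>x\<in>\<Theta>. x < a \<and> F a - e < F x)"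
proof
  assume c: "continuous (at a within \<Theta> \<inter> {..<a}) (\<lambda>\<theta>. 1 - F \<theta>)"
  show "\<forall>e>0. \<exists>x\<in>\<Theta>. x < a \<and> F a - e < F x"
  proof (intro allI impI)
    fix e :: real assume "0 < e"
    then obtain d where d: "0 < d" "\<And>x. x \<in> \<Theta> \<inter> {..<a} \<Longrightarrow> dist x a < d \<Longrightarrow> dist (1 - F x) (1 - F a) < e"
      using c unfolding continuous_within_eps_delta by blast
    define x where "x = max b (a - d / 2)"
    have ax: "x < a" "b \<le> x" "a - d < x" using b d(1) by (auto simp: x_def max_def)
    have x: "x \<in> \<Theta>" using mem_is_interval_1_I[OF int b(1) a, of x] ax by simp
    have "dist (1 - F x) (1 - F a) < e" using d(2)[of x] x ax by (simp add: dist_real_def)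
    then have "F a - e < F x" unfolding dist_real_def by linarith
    then show "\<exists>x\<in>\<Theta>. x < a \<and> F a - e < F x" using x ax by blast
  qed
next
  assume r: "\<forall>e>0. \<exists>x\<in>\<Theta>. x < a \<and> F a - e < F x"
  show "continuous (at a within \<Theta> \<inter> {..<a}) (\<lambda>\<theta>. 1 - F \<theta>)"
    unfolding continuous_within_eps_delta
  proof (intro allI impI)
    fix e :: real assume "0 < e"
    then obtain x where x: "x \<in> \<Theta>" "x < a" "F a - e < F x" using r by blast
    have "dist (1 - F y) (1 - F a) < e" if "y \<in> \<Theta> \<inter> {..<a}" "dist y a < a - x" for y
      using mono_F[of y a] mono_F[of x y] that a x by (auto simp: dist_real_def)
    then show "\<exists>d>0. \<forall>y\<in>\<Theta> \<inter> {..<a}. dist y a < d \<longrightarrow> dist (1 - F y) (1 - F a) < e"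
      using x(2) by (intro exI[of _ "a - x"]) simp
  qed
qed

lemma tendsto_to_inf_iff:
  assumes nl: "\<forall>a\<in>\<Theta>. \<exists>b\<in>\<Theta>. b < a"
  shows "((\<lambda>\<theta>. 1 - F \<theta>) \<longlongrightarrow> 1) (to_inf \<Theta>) \<longleftrightarrow> (\<forall>e>0. \<exists>x\<in>\<Theta>. F x < e)"
proof -
  have ne: "\<Theta> \<noteq> {}" using \<theta>0 by blast
  have "(\<exists>x\<in>\<Theta>. \<forall>y\<in>\<Theta>. y < x \<longrightarrow> dist (1 - F y) 1 < e) \<longleftrightarrow> (\<exists>x\<in>\<Theta>. F x < e)" for e
  proof
    assume "\<exists>x\<in>\<Theta>. \<forall>y\<in>\<Theta>. y < x \<longrightarrow> dist (1 - F y) 1 < e"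
    then obtain x where x: "x \<in> \<Theta>" "\<And>y. y \<in> \<Theta> \<Longrightarrow> y < x \<Longrightarrow> dist (1 - F y) 1 < e" by blast
    obtain y where y: "y \<in> \<Theta>" "y < x" using nl x(1) by blast
    have "F y < e" using x(2)[OF y] by (simp add: dist_real_def)
    with y show "\<exists>x\<in>\<Theta>. F x < e" by blast
  next
    assume "\<exists>x\<in>\<Theta>. F x < e"
    then obtain x where x: "x \<in> \<Theta>" "F x < e" by blast
    have "dist (1 - F y) 1 < e" if "y \<in> \<Theta>" "y < x" for y
      using mono_F[OF that(1) x(1)] F01[OF that(1)] that(2) x(2) by (simp add: dist_real_def)
    with x(1) show "\<exists>x\<in>\<Theta>. \<forall>y\<in>\<Theta>. y < x \<longrightarrow> dist (1 - F y) 1 < e" by blast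
  qed
  then show ?thesis by (simp only: tendsto_iff eventually_to_inf[OF int nl ne])
qed

lemma tendsto_to_sup_iff:
  assumes nl: "\<forall>a\<in>\<Theta>. \<exists>b\<in>\<Theta>. a < b"
  shows "((\<lambda>\<theta>. 1 - F \<theta>) \<longlongrightarrow> 0) (to_sup \<Theta>) \<longleftrightarrow> (\<forall>e>0. \<exists>x\<in>\<Theta>. 1 - e < F x)"
proof -
  have ne: "\<Theta> \<noteq> {}" using \<theta>0 by blast
  have "(\<exists>x\<in>\<Theta>. \<forall>y\<in>\<Theta>. x < y \<longrightarrow> dist (1 - F y) 0 < e) \<longleftrightarrow> (\<exists>x\<in>\<Theta>. 1 - e < F x)" for e
  proof
    assume "\<exists>x\<in>\<Theta>. \<forall>y\<in>\<Theta>. x < y \<longrightarrow> dist (1 - F y) 0 < e"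
    then obtain x where x: "x \<in> \<Theta>" "\<And>y. y \<in> \<Theta> \<Longrightarrow> x < y \<Longrightarrow> dist (1 - F y) 0 < e" by blast
    obtain y where y: "y \<in> \<Theta>" "x < y" using nl x(1) by blast
    have "1 - e < F y" using x(2)[OF y] unfolding dist_real_def by linarith
    with y show "\<exists>x\<in>\<Theta>. 1 - e < F x" by blast
  next
    assume "\<exists>x\<in>\<Theta>. 1 - e < F x"
    then obtain x where x: "x \<in> \<Theta>" "1 - e < F x" by blast
    have "dist (1 - F y) 0 < e" if "y \<in> \<Theta>" "x < y" for y
      using mono_F[OF x(1) that(1)] F01[OF that(1)] that(2) x(2) by (simp add: dist_real_def)
    with x(1) show "\<exists>x\<in>\<Theta>. \<forall>y\<in>\<Theta>. x < y \<longrightarrow> dist (1 - F y) 0 < e" by blast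
  qed
  then show ?thesis by (simp only: tendsto_iff eventually_to_sup[OF int nl ne])
qed

end

section \<open>Votes under a global essential statistic\<close>

locale global_mlr_model = mlr_model M p T \<Theta>
  for M :: "'w measure" and p :: "real \<Rightarrow> 'w \<Rightarrow> real" and T :: "'w \<Rightarrow> real" and \<Theta> :: "real set" +
  fixes h :: "real set \<Rightarrow> real \<Rightarrow> real \<Rightarrow> real \<Rightarrow> ennreal" and K :: "real \<Rightarrow> ereal"
  assumes K: "global_ess_statistic M p T \<Theta> h K"
begin

abbreviation curve :: "real \<Rightarrow> real \<Rightarrow> real" where
  "curve t \<theta> \<equiv> 1 - mean_df M p (\<lambda>\<omega>. K (T \<omega>)) \<theta> (K t)"

abbreviation null_above_set :: "real \<Rightarrow> real set" where
  "null_above_set t \<equiv> {\<theta>. null_above \<theta> t}"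

abbreviation null_below_set :: "real \<Rightarrow> real set" where
  "null_below_set t \<equiv> {\<theta>. null_below \<theta> t}"

lemma K_mono: "mono K"
  using K unfolding global_ess_statistic_def by blast

lemma global_ess:
  assumes A: "A \<in> left_hypotheses \<Theta>" and t: "t \<notin> unseen_values M p T \<Theta>"
  shows "\<lbrakk>t \<notin> lower_null M p T (\<Theta> - A); t \<notin> upper_null M p T A; \<theta> \<in> \<Theta>\<rbrakk> \<Longrightarrow>
      mean_df M p (\<lambda>\<omega>. K (T \<omega>)) \<theta> (K t) =
      mean_df M p (\<lambda>\<omega>. ess_statistic A (\<Theta> - A) (h A) (T \<omega>)) \<theta> (ess_statistic A (\<Theta> - A) (h A) t)"
    and "\<lbrakk>t \<in> lower_null M p T (\<Theta> - A); \<theta> \<in> \<Theta> - A\<rbrakk> \<Longrightarrow> mean_df M p (\<lambda>\<omega>. K (T \<omega>)) \<theta> (K t) = 0"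
    and "\<lbrakk>t \<in> upper_null M p T A; \<theta> \<in> A\<rbrakk> \<Longrightarrow> mean_df M p (\<lambda>\<omega>. K (T \<omega>)) \<theta> (K t) = 1"
  using K left_hypothesesD(1)[OF A] t unfolding global_ess_statistic_def Let_def by blast+

lemma mem_null_of_left:
  assumes A: "A \<in> left_hypotheses \<Theta>"
  shows "t \<in> upper_null M p T A \<longleftrightarrow> A \<subseteq> null_above_set t"
    and "t \<in> lower_null M p T (\<Theta> - A) \<longleftrightarrow> \<Theta> - A \<subseteq> null_below_set t"
  using mem_upper_null[OF left_hypothesesD(2,3)[OF A]] mem_lower_null[OF _ left_hypothesesD(4)[OF A]]
  by auto

text \<open>A parameter \<open>x\<close> in \<open>\<Sigma>\<close> takes all smaller ones with it
  and stays below \<open>\<theta>0\<close>; so the section ending at \<open>x\<close> is a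
  hypothesis whose null upper half-line contains \<open>t\<close>, where the global statistic has
  mean distribution function 1. The argument for \<open>\<I>\<close> is dual, with the open section
  below \<open>x\<close> and the value 0.\<close>

lemma vote_curve_at:
  assumes t: "t \<notin> unseen_values M p T \<Theta>"
  obtains \<theta>0 where "vote_curve \<Theta> (curve t) (null_above_set t) (null_below_set t) \<theta>0"
proof -
  obtain \<omega> \<theta>0 where \<omega>: "\<omega> \<in> space M" "T \<omega> = t" "p \<theta>0 \<omega> \<noteq> 0" and \<theta>0: "\<theta>0 \<in> \<Theta>"
    using t unfolding unseen_values_def by auto
  have n: "\<not> null_above \<theta>0 t" "\<not> null_below \<theta>0 t"
    using \<omega> unfolding null_above_def null_below_def by auto
  have "vote_curve \<Theta> (curve t) (null_above_set t) (null_below_set t) \<theta>0"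
  proof
    show "is_interval \<Theta>" by (rule int)
    show "\<theta>0 \<in> \<Theta>" by (rule \<theta>0)
    show "\<theta>0 \<notin> null_above_set t" "\<theta>0 \<notin> null_below_set t" using n by simp_all
    show "curve t x \<le> curve t y" if "x \<in> \<Theta>" "y \<in> \<Theta>" "x \<le> y" for x y
      using mean_df_antimono[OF that K_mono, of "K t"] by simp
    show "0 \<le> curve t x \<and> curve t x \<le> 1" if "x \<in> \<Theta>" for x
      using mean_df_bounds[OF that] by simp
    show "curve t x = 0" if x: "x \<in> \<Theta>" "x \<in> null_above_set t" for x
    proof -
      have sub: "\<Theta> \<inter> {..x} \<subseteq> null_above_set t" using null_above_antimono[OF _ x(1)] x(2) by auto
      then have "x < \<theta>0" using n(1) \<theta>0 by force
      then have A: "\<Theta> \<inter> {..x} \<in> left_hypotheses \<Theta>" using x(1) \<theta>0 by (intro left_hypotheses_atMost) auto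
      show ?thesis using global_ess(3)[OF A t, of x] mem_null_of_left(1)[OF A] sub x(1) by simp
    qed
    show "curve t x = 1" if x: "x \<in> \<Theta>" "x \<in> null_below_set t" for x
    proof -
      have sub: "\<Theta> - \<Theta> \<inter> {..<x} \<subseteq> null_below_set t"
      proof
        fix y assume "y \<in> \<Theta> - \<Theta> \<inter> {..<x}"
        then have "y \<in> \<Theta>" "x \<le> y" by auto
        then show "y \<in> null_below_set t" using null_below_mono[OF x(1)] x(2) by simp
      qed
      then have "\<theta>0 < x" using n(2) \<theta>0 by force
      then have A: "\<Theta> \<inter> {..<x} \<in> left_hypotheses \<Theta>" using x(1) \<theta>0 by (intro left_hypotheses_lessThan) auto
      show ?thesis using global_ess(2)[OF A t, of x] mem_null_of_left(2)[OF A] sub x(1) by simp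
    qed
  qed
  then show thesis by (rule that)
qed

text \<open>The upper half-line is tested first, as in \<open>vote\<close>. Off both half-lines the
  defining identity of the global statistic replaces the essential statistic of the hypotheses by
  \<open>K\<close>.\<close>

lemma vote_eq:
  assumes \<omega>: "T \<omega> \<notin> unseen_values M p T \<Theta>" and A: "A \<in> left_hypotheses \<Theta>" and \<theta>: "\<theta> \<in> \<Theta>"
  shows "vote M p T A (\<Theta> - A) (h A) \<theta> \<omega> =
    (if A \<subseteq> null_above_set (T \<omega>) then 0 else if \<Theta> - A \<subseteq> null_below_set (T \<omega>) then 1 else curve (T \<omega>) \<theta>)"
  using global_ess(1)[OF A \<omega> _ _ \<theta>] mem_null_of_left[OF A] unfolding vote_def Let_def by simp

text \<open>Where \<open>A \<subseteq> \<Sigma>\<close>, the constant vote 0 and the supremum of the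
  curve coincide; \<open>not_both_null\<close> ensures that the other convention is not in force at
  the same time.\<close>

lemma votes_Q1_eq:
  assumes \<omega>: "T \<omega> \<notin> unseen_values M p T \<Theta>" and A: "A \<in> left_hypotheses \<Theta>"
  shows "votes_Q1 M p T \<Theta> h \<omega> A = vote_curve.q1 \<Theta> (curve (T \<omega>)) (null_below_set (T \<omega>)) A"
proof -
  obtain \<theta>0 where "vote_curve \<Theta> (curve (T \<omega>)) (null_above_set (T \<omega>)) (null_below_set (T \<omega>)) \<theta>0"
    using vote_curve_at[OF \<omega>] .
  then interpret V: vote_curve \<Theta> "curve (T \<omega>)" "null_above_set (T \<omega>)" "null_below_set (T \<omega>)" \<theta>0 .
  note A' = left_hypothesesD(2,3)[OF A]
  have sup: "votes_Q1 M p T \<Theta> h \<omega> A = (SUP \<theta>\<in>A.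
      if A \<subseteq> null_above_set (T \<omega>) then 0 else if \<Theta> - A \<subseteq> null_below_set (T \<omega>) then 1 else curve (T \<omega>) \<theta>)"
    unfolding votes_Q1_def by (rule SUP_cong[OF refl]) (rule vote_eq[OF \<omega> A subsetD[OF A'(1)]])
  have "(SUP \<theta>\<in>A. curve (T \<omega>) \<theta>) = (SUP \<theta>\<in>A. 0)" if "A \<subseteq> null_above_set (T \<omega>)"
    using that A'(1) V.F_\<Sigma> by (intro SUP_cong) auto
  then show ?thesis
    unfolding sup V.q1_def using A'(2) V.not_both_null[of A]
    by (cases "A \<subseteq> null_above_set (T \<omega>)"; cases "\<Theta> - A \<subseteq> null_below_set (T \<omega>)") simp_all
qed

lemma votes_Q0_eq:
  assumes \<omega>: "T \<omega> \<notin> unseen_values M p T \<Theta>" and A: "A \<in> left_hypotheses \<Theta>"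
  shows "votes_Q0 M p T \<Theta> h \<omega> A = vote_curve.q0 \<Theta> (curve (T \<omega>)) (null_above_set (T \<omega>)) A"
proof -
  obtain \<theta>0 where "vote_curve \<Theta> (curve (T \<omega>)) (null_above_set (T \<omega>)) (null_below_set (T \<omega>)) \<theta>0"
    using vote_curve_at[OF \<omega>] .
  then interpret V: vote_curve \<Theta> "curve (T \<omega>)" "null_above_set (T \<omega>)" "null_below_set (T \<omega>)" \<theta>0 .
  note A' = left_hypothesesD(2,4)[OF A]
  have sup: "votes_Q0 M p T \<Theta> h \<omega> A = 1 - (SUP \<theta>\<in>\<Theta> - A. 1 -
      (if A \<subseteq> null_above_set (T \<omega>) then 0 else if \<Theta> - A \<subseteq> null_below_set (T \<omega>) then 1 else curve (T \<omega>) \<theta>))"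
    unfolding votes_Q0_def
    by (rule arg_cong2[of _ _ _ _ minus, OF refl], rule SUP_cong[OF refl],
        rule arg_cong2[of _ _ _ _ minus, OF refl], rule vote_eq[OF \<omega> A]) blast
  have "(SUP \<theta>\<in>\<Theta> - A. 1 - curve (T \<omega>) \<theta>) = (SUP \<theta>\<in>\<Theta> - A. 0)" if "\<Theta> - A \<subseteq> null_below_set (T \<omega>)"
    using that V.F_\<I> by (intro SUP_cong) auto
  then show ?thesis
    unfolding sup V.q0_def using A'(2) V.not_both_null[of A]
    by (cases "A \<subseteq> null_above_set (T \<omega>)"; cases "\<Theta> - A \<subseteq> null_below_set (T \<omega>)") simp_all
qed

text \<open>The proviso that \<open>t\<close> avoids a null half-line amounts to a parameter
  \<open>b\<close> beyond \<open>a\<close> that is not null on the relevant side. The same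
  \<open>b\<close> shows that \<open>a\<close> is not the end point, and it is the point that
  \<open>right_continuous_iff\<close> and \<open>left_continuous_iff\<close> require.\<close>

lemma regular_at_iff:
  assumes t: "t \<notin> unseen_values M p T \<Theta>"
  shows "regular_at M p T \<Theta> K t \<longleftrightarrow>
    vote_curve.regular \<Theta> (curve t) (null_above_set t) (null_below_set t)"
proof -
  obtain \<theta>0 where "vote_curve \<Theta> (curve t) (null_above_set t) (null_below_set t) \<theta>0"
    using vote_curve_at[OF t] .
  then interpret V: vote_curve \<Theta> "curve t" "null_above_set t" "null_below_set t" \<theta>0 .
  let ?G = "\<lambda>\<theta>. mean_df M p (\<lambda>\<omega>. K (T \<omega>)) \<theta> (K t)"
  have right: "(ereal a \<noteq> (SUP \<theta>\<in>\<Theta>. ereal \<theta>) \<and> t \<notin> lower_null M p T {\<theta>\<in>\<Theta>. \<theta> > a} \<longrightarrow>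
        continuous (at a within \<Theta> \<inter> {a<..}) ?G) \<longleftrightarrow>
      (\<forall>b\<in>\<Theta>. a < b \<and> b \<notin> null_below_set t \<longrightarrow> (\<forall>e>0. \<exists>x\<in>\<Theta>. a < x \<and> curve t x < curve t a + e))"
    if a: "a \<in> \<Theta>" for a
  proof (cases "\<exists>b\<in>\<Theta>. a < b \<and> b \<notin> null_below_set t")
    case True
    then obtain b where b: "b \<in> \<Theta>" "a < b" "b \<notin> null_below_set t" by blast
    then have "t \<notin> lower_null M p T {\<theta>\<in>\<Theta>. \<theta> > a}" by (subst mem_lower_null) auto
    then show ?thesis using V.right_continuous_iff[OF a b(1,2)] ereal_neq_SUP_iff[OF a] b by auto
  next
    case False
    \<comment> \<open>With no parameter above \<open>a\<close>, the half-line refers to an empty set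
      of parameters, for which no largest one exists. But \<open>a\<close> is then the supremum, and
      both sides of the equivalence hold vacuously.\<close>
    then have "t \<in> lower_null M p T {\<theta>\<in>\<Theta>. \<theta> > a}" if "\<exists>b\<in>\<Theta>. a < b"
      using that by (subst mem_lower_null) auto
    then show ?thesis using False ereal_neq_SUP_iff[OF a] by blast
  qed
  have left: "(ereal a \<noteq> (INF \<theta>\<in>\<Theta>. ereal \<theta>) \<and> t \<notin> upper_null M p T {\<theta>\<in>\<Theta>. \<theta> < a} \<longrightarrow>
        continuous (at a within \<Theta> \<inter> {..<a}) ?G) \<longleftrightarrow>
      (\<forall>b\<in>\<Theta>. b < a \<and> b \<notin> null_above_set t \<longrightarrow> (\<forall>e>0. \<exists>x\<in>\<Theta>. x < a \<and> curve t a - e < curve t x))"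
    if a: "a \<in> \<Theta>" for a
  proof (cases "\<exists>b\<in>\<Theta>. b < a \<and> b \<notin> null_above_set t")
    case True
    then obtain b where b: "b \<in> \<Theta>" "b < a" "b \<notin> null_above_set t" by blast
    then have "t \<notin> upper_null M p T {\<theta>\<in>\<Theta>. \<theta> < a}" by (subst mem_upper_null) auto
    then show ?thesis using V.left_continuous_iff[OF a b(1,2)] ereal_neq_INF_iff[OF a] b by auto
  next
    case False
    then have "t \<in> upper_null M p T {\<theta>\<in>\<Theta>. \<theta> < a}" if "\<exists>b\<in>\<Theta>. b < a"
      using that by (subst mem_upper_null) auto
    then show ?thesis using False ereal_neq_INF_iff[OF a] by blast
  qed
  have inf: "((INF \<theta>\<in>\<Theta>. ereal \<theta>) \<notin> ereal ` \<Theta> \<longrightarrow> (?G \<longlongrightarrow> 1) (to_inf \<Theta>)) \<longleftrightarrow>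
      ((\<forall>a\<in>\<Theta>. \<exists>b\<in>\<Theta>. b < a) \<longrightarrow> (\<forall>e>0. \<exists>x\<in>\<Theta>. curve t x < e))"
    unfolding INF_notin_iff using V.tendsto_to_inf_iff by (intro imp_cong refl) simp
  have sup: "((SUP \<theta>\<in>\<Theta>. ereal \<theta>) \<notin> ereal ` \<Theta> \<longrightarrow> (?G \<longlongrightarrow> 0) (to_sup \<Theta>)) \<longleftrightarrow>
      ((\<forall>a\<in>\<Theta>. \<exists>b\<in>\<Theta>. a < b) \<longrightarrow> (\<forall>e>0. \<exists>x\<in>\<Theta>. 1 - e < curve t x))"
    unfolding SUP_notin_iff using V.tendsto_to_sup_iff by (intro imp_cong refl) simp
  show ?thesis
    unfolding regular_at_def Let_def V.regular_def inf sup
    by (intro conj_cong refl ball_cong) (rule right left; assumption)+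
qed

lemma compatible_at_votes_iff:
  assumes \<omega>: "T \<omega> \<notin> unseen_values M p T \<Theta>"
  shows "compatible_at \<Theta> (votes_Q1 M p T \<Theta> h \<omega>) \<and> compatible_at \<Theta> (votes_Q0 M p T \<Theta> h \<omega>) \<longleftrightarrow>
    regular_at M p T \<Theta> K (T \<omega>)"
    and "regular_at M p T \<Theta> K (T \<omega>) \<Longrightarrow> A \<in> left_hypotheses \<Theta> \<Longrightarrow>
      votes_Q1 M p T \<Theta> h \<omega> A = votes_Q0 M p T \<Theta> h \<omega> A"
proof -
  obtain \<theta>0 where "vote_curve \<Theta> (curve (T \<omega>)) (null_above_set (T \<omega>)) (null_below_set (T \<omega>)) \<theta>0"
    using vote_curve_at[OF \<omega>] .
  then interpret V: vote_curve \<Theta> "curve (T \<omega>)" "null_above_set (T \<omega>)" "null_below_set (T \<omega>)" \<theta>0 .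
  have "compatible_at \<Theta> (votes_Q1 M p T \<Theta> h \<omega>) \<longleftrightarrow> compatible_at \<Theta> V.q1"
    by (rule iffI; erule compatible_at_cong[rotated]) (simp_all add: votes_Q1_eq[OF \<omega>])
  moreover have "compatible_at \<Theta> (votes_Q0 M p T \<Theta> h \<omega>) \<longleftrightarrow> compatible_at \<Theta> V.q0"
    by (rule iffI; erule compatible_at_cong[rotated]) (simp_all add: votes_Q0_eq[OF \<omega>])
  ultimately show "compatible_at \<Theta> (votes_Q1 M p T \<Theta> h \<omega>) \<and> compatible_at \<Theta> (votes_Q0 M p T \<Theta> h \<omega>) \<longleftrightarrow>
      regular_at M p T \<Theta> K (T \<omega>)"
    using V.compatible_regular V.regular_compatible V.regular_compatible0 regular_at_iff[OF \<omega>] by blast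
  show "votes_Q1 M p T \<Theta> h \<omega> A = votes_Q0 M p T \<Theta> h \<omega> A"
    if "regular_at M p T \<Theta> K (T \<omega>)" "A \<in> left_hypotheses \<Theta>"
    using V.q1_eq_q0[OF _ that(2)] that regular_at_iff[OF \<omega>] votes_Q1_eq[OF \<omega> that(2)] votes_Q0_eq[OF \<omega> that(2)]
    by simp
qed

section \<open>Bounds for the votes, and passage to almost every outcome\<close>

lemma vote_bounds: "\<theta> \<in> \<Theta> \<Longrightarrow> 0 \<le> vote M p T A B g \<theta> \<omega> \<and> vote M p T A B g \<theta> \<omega> \<le> 1"
  unfolding vote_def Let_def using mean_df_bounds[of \<theta>] by simp

lemma votes_Q1_bounds:
  assumes A: "A \<in> left_hypotheses \<Theta>" shows "votes_Q1 M p T \<Theta> h \<omega> A \<in> {0..1}"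
proof -
  note A' = left_hypothesesD(2,3)[OF A]
  obtain \<theta> where \<theta>: "\<theta> \<in> A" using A'(2) by blast
  have v: "0 \<le> vote M p T A (\<Theta> - A) (h A) \<theta> \<omega> \<and> vote M p T A (\<Theta> - A) (h A) \<theta> \<omega> \<le> 1" if "\<theta> \<in> A" for \<theta>
    using vote_bounds that A'(1) by blast
  have "votes_Q1 M p T \<Theta> h \<omega> A \<le> 1"
    unfolding votes_Q1_def by (rule cSUP_least[OF A'(2)]) (use v in blast)
  moreover have "0 \<le> votes_Q1 M p T \<Theta> h \<omega> A"
    unfolding votes_Q1_def by (rule cSUP_upper2[OF _ \<theta>]) (use v \<theta> in \<open>auto intro!: bdd_aboveI[where M = 1]\<close>)
  ultimately show ?thesis by simp
qed

lemma votes_Q0_bounds: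
  assumes A: "A \<in> left_hypotheses \<Theta>" shows "votes_Q0 M p T \<Theta> h \<omega> A \<in> {0..1}"
proof -
  note A' = left_hypothesesD(2,4)[OF A]
  obtain \<theta> where \<theta>: "\<theta> \<in> \<Theta> - A" using A'(2) by blast
  have v: "0 \<le> 1 - vote M p T A (\<Theta> - A) (h A) \<theta> \<omega> \<and> 1 - vote M p T A (\<Theta> - A) (h A) \<theta> \<omega> \<le> 1"
    if "\<theta> \<in> \<Theta> - A" for \<theta>
    using vote_bounds[of \<theta> A "\<Theta> - A" "h A" \<omega>] that by simp
  have "(SUP \<theta>\<in>\<Theta> - A. 1 - vote M p T A (\<Theta> - A) (h A) \<theta> \<omega>) \<le> 1"
    by (rule cSUP_least[OF A'(2)]) (use v in blast)
  moreover have "0 \<le> (SUP \<theta>\<in>\<Theta> - A. 1 - vote M p T A (\<Theta> - A) (h A) \<theta> \<omega>)"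
    by (rule cSUP_upper2[OF _ \<theta>]) (use v \<theta> in \<open>auto intro!: bdd_aboveI[where M = 1]\<close>)
  ultimately show ?thesis unfolding votes_Q0_def by simp
qed

lemma null_event_Un:
  assumes "null_event M p \<Theta> E" "null_event M p \<Theta> E'" shows "null_event M p \<Theta> (E \<union> E')"
proof -
  have "emeasure (model_prob M p \<theta>) (E \<union> E') = 0" if "\<theta> \<in> \<Theta>" for \<theta>
    using emeasure_subadditive[of E "model_prob M p \<theta>" E'] assms that unfolding null_event_def by simp
  then show ?thesis using assms unfolding null_event_def by blast
qed

text \<open>Any deduction valid at seen values transfers to almost every outcome: the event covering
  the unseen values is joined to the two exceptional ones.\<close>

lemma almost_every_outcome_mono:
  assumes "almost_every_outcome M p \<Theta> P" "almost_every_outcome M p \<Theta> P'"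
    and "\<And>\<omega>. \<lbrakk>\<omega> \<in> space M; T \<omega> \<notin> unseen_values M p T \<Theta>; P \<omega>; P' \<omega>\<rbrakk> \<Longrightarrow> Q \<omega>"
  shows "almost_every_outcome M p \<Theta> Q"
proof -
  obtain E E' E'' where E: "null_event M p \<Theta> E" "\<And>\<omega>. \<omega> \<in> space M - E \<Longrightarrow> P \<omega>"
    and E': "null_event M p \<Theta> E'" "\<And>\<omega>. \<omega> \<in> space M - E' \<Longrightarrow> P' \<omega>"
    and E'': "null_event M p \<Theta> E''" "T -` unseen_values M p T \<Theta> \<inter> space M \<subseteq> E''"
    using assms(1,2) unseen_values_null unfolding almost_every_outcome_def by blast
  have "Q \<omega>" if "\<omega> \<in> space M - (E \<union> E' \<union> E'')" for \<omega>
    using that E(2) E'(2) E''(2) by (intro assms(3)) auto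
  moreover have "null_event M p \<Theta> (E \<union> E' \<union> E'')" using E(1) E'(1) E''(1) by (intro null_event_Un)
  ultimately show ?thesis unfolding almost_every_outcome_def by blast
qed

text \<open>For the converse direction, the exceptional set consists of all values where
  \<open>R\<close> fails; its preimage lies inside the exceptional event.\<close>

lemma almost_every_value_iff:
  "almost_every_value M p T \<Theta> R \<longleftrightarrow> almost_every_outcome M p \<Theta> (\<lambda>\<omega>. R (T \<omega>))"
proof
  assume "almost_every_value M p T \<Theta> R"
  then obtain S E where "null_event M p \<Theta> E" "T -` S \<inter> space M \<subseteq> E" "\<And>t. t \<notin> S \<Longrightarrow> R t"
    unfolding almost_every_value_def by blast
  then show "almost_every_outcome M p \<Theta> (\<lambda>\<omega>. R (T \<omega>))"
    unfolding almost_every_outcome_def by (intro exI[of _ E]) blast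
next
  assume "almost_every_outcome M p \<Theta> (\<lambda>\<omega>. R (T \<omega>))"
  then obtain E where "null_event M p \<Theta> E" "\<And>\<omega>. \<omega> \<in> space M - E \<Longrightarrow> R (T \<omega>)"
    unfolding almost_every_outcome_def by blast
  then show "almost_every_value M p T \<Theta> R"
    unfolding almost_every_value_def by (intro exI[of _ "{t. \<not> R t}"] exI[of _ E]) blast
qed

lemma compatible_votes_iff_regular:
  "compatible_votes M p \<Theta> (votes_Q1 M p T \<Theta> h) \<and> compatible_votes M p \<Theta> (votes_Q0 M p T \<Theta> h) \<longleftrightarrow>
    almost_every_value M p T \<Theta> (regular_at M p T \<Theta> K)"
proof
  assume c: "compatible_votes M p \<Theta> (votes_Q1 M p T \<Theta> h) \<and> compatible_votes M p \<Theta> (votes_Q0 M p T \<Theta> h)"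
  show "almost_every_value M p T \<Theta> (regular_at M p T \<Theta> K)"
    unfolding almost_every_value_iff
    by (rule almost_every_outcome_mono[OF c[THEN conjunct1, unfolded compatible_votes_iff, THEN conjunct2]
          c[THEN conjunct2, unfolded compatible_votes_iff, THEN conjunct2]])
      (simp add: compatible_at_votes_iff(1)[symmetric])
next
  assume "almost_every_value M p T \<Theta> (regular_at M p T \<Theta> K)"
  then have r: "almost_every_outcome M p \<Theta> (\<lambda>\<omega>. regular_at M p T \<Theta> K (T \<omega>))"
    unfolding almost_every_value_iff .
  have "almost_every_outcome M p \<Theta> (\<lambda>\<omega>. compatible_at \<Theta> (votes_Q1 M p T \<Theta> h \<omega>))"
    by (rule almost_every_outcome_mono[OF r r]) (simp add: compatible_at_votes_iff(1)[symmetric])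
  moreover have "almost_every_outcome M p \<Theta> (\<lambda>\<omega>. compatible_at \<Theta> (votes_Q0 M p T \<Theta> h \<omega>))"
    by (rule almost_every_outcome_mono[OF r r]) (simp add: compatible_at_votes_iff(1)[symmetric])
  ultimately show "compatible_votes M p \<Theta> (votes_Q1 M p T \<Theta> h) \<and> compatible_votes M p \<Theta> (votes_Q0 M p T \<Theta> h)"
    unfolding compatible_votes_iff using votes_Q1_bounds votes_Q0_bounds by blast
qed

text \<open>Regularity makes the two votes equal on every hypothesis, so the measure built for one
  also extends the other.\<close>

lemma common_extension:
  assumes "T \<omega> \<notin> unseen_values M p T \<Theta>" "regular_at M p T \<Theta> K (T \<omega>)"
  shows "\<exists>!\<nu>. extends_to \<Theta> (votes_Q1 M p T \<Theta> h \<omega>) \<nu> \<and> extends_to \<Theta> (votes_Q0 M p T \<Theta> h \<omega>) \<nu>"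
proof -
  have ne: "\<Theta> \<noteq> {}" using model unfolding statistical_model_def by blast
  have c: "compatible_at \<Theta> (votes_Q1 M p T \<Theta> h \<omega>)"
    using compatible_at_votes_iff(1)[OF assms(1)] assms(2) by blast
  obtain \<nu> where \<nu>: "extends_to \<Theta> (votes_Q1 M p T \<Theta> h \<omega>) \<nu>"
    using compatible_at_extends[OF int ne c votes_Q1_bounds] by blast
  moreover have "extends_to \<Theta> (votes_Q0 M p T \<Theta> h \<omega>) \<nu>"
    using \<nu> compatible_at_votes_iff(2)[OF assms] unfolding extends_to_def by simp
  ultimately show ?thesis using extends_to_unique[OF int] by blast
qed

end

theorem proposition5p2p3:
  fixes M :: "'w measure" and p :: "real \<Rightarrow> 'w \<Rightarrow> real" and T :: "'w \<Rightarrow> real"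
    and \<Theta> :: "real set"
    and h :: "real set \<Rightarrow> real \<Rightarrow> real \<Rightarrow> real \<Rightarrow> ennreal"
    and K :: "real \<Rightarrow> ereal"
  assumes "statistical_model M p \<Theta>"
    and "is_interval \<Theta>"
    and "T \<in> borel_measurable M"
    and "monotone_likelihood_ratio M p T \<Theta>"
    and "\<And>\<Theta>1 \<Theta>0. one_sided \<Theta> \<Theta>1 \<Theta>0 \<Longrightarrow> normalized_family M p T \<Theta>1 \<Theta>0 (h \<Theta>1)"
    and "global_ess_statistic M p T \<Theta> h K"
  shows "(compatible_votes M p \<Theta> (votes_Q1 M p T \<Theta> h) \<and>
          compatible_votes M p \<Theta> (votes_Q0 M p T \<Theta> h)
            \<longleftrightarrow> almost_every_value M p T \<Theta> (regular_at M p T \<Theta> K)) \<and>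
         (almost_every_value M p T \<Theta> (regular_at M p T \<Theta> K) \<longrightarrow>
           almost_every_outcome M p \<Theta> (\<lambda>\<omega>.
             \<exists>!\<nu>. extends_to \<Theta> (votes_Q1 M p T \<Theta> h \<omega>) \<nu> \<and>
                  extends_to \<Theta> (votes_Q0 M p T \<Theta> h \<omega>) \<nu>))"
proof -
  interpret global_mlr_model M p T \<Theta> h K
    using assms by unfold_locales
  show ?thesis
  proof (intro conjI impI)
    show "compatible_votes M p \<Theta> (votes_Q1 M p T \<Theta> h) \<and> compatible_votes M p \<Theta> (votes_Q0 M p T \<Theta> h)
        \<longleftrightarrow> almost_every_value M p T \<Theta> (regular_at M p T \<Theta> K)"
      by (rule compatible_votes_iff_regular)
    assume "almost_every_value M p T \<Theta> (regular_at M p T \<Theta> K)"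
    then have r: "almost_every_outcome M p \<Theta> (\<lambda>\<omega>. regular_at M p T \<Theta> K (T \<omega>))"
      unfolding almost_every_value_iff .
    show "almost_every_outcome M p \<Theta> (\<lambda>\<omega>.
        \<exists>!\<nu>. extends_to \<Theta> (votes_Q1 M p T \<Theta> h \<omega>) \<nu> \<and> extends_to \<Theta> (votes_Q0 M p T \<Theta> h \<omega>) \<nu>)"
      by (rule almost_every_outcome_mono[OF r r common_extension])
  qed
qed

end
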